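(* Let $F_1,\ldots,F_m$ and $\Phi$ be polynomials in $\mathbb{C}[z_1,\ldots,z_n]$, and let $\mathcal{P}\subseteq\mathbb{R}^n_{\ge 0}$ be a lattice polytope that contains the origin and the supports $\operatorname{supp}F_j$ ($1\le j\le m$). Assume that the $F_j$ have no common zeros at infinity (with respect to $\mathcal{P}$). Moreover, assume that $\Phi$ is in the integral closure of the ideal $(F)$ and that $\operatorname{supp}\Phi\subseteq e\mathcal{P}$, where $e\ge 0$ is a real number such that $e\mathcal{P}$ is a lattice polytope. Then there are polynomials $G_1,\ldots,G_m\in\mathbb{C}[z_1,\ldots,z_n]$ such that $$\sum_{j=1}^m F_jG_j=\Phi^n$$ and $$\operatorname{supp}(F_jG_j)\subseteq \max(n+1,ne)\,\mathcal{P}\qquad(1\le j\le m).$$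
   Context: Notation. $(F)$ is the ideal of $\mathbb{C}[z_1,\ldots,z_n]$ generated by $F_1,\ldots,F_m$. For a polynomial $F=\sum_{\alpha}c_\alpha z^\alpha$, $\operatorname{supp}F=\{\alpha\in\mathbb{Z}^n: c_\alpha\neq 0\}$. For $c\ge 0$, $c\mathcal{P}=\{cx:x\in\mathcal{P}\}$. A lattice polytope in $\mathbb{R}^n$ is the convex hull of finitely many points of $\mathbb{Z}^n$. Integral closure. $\Phi$ lies in the integral closure of $(F)$ if it satisfies a monic equation $\Phi^r+H_1\Phi^{r-1}+\cdots+H_r=0$ with $H_j\in(F)^j$ for $1\le j\le r$; equivalently, locally on $\mathbb{C}^n$, $|\Phi|\le C|F|$ for some constant $C$, where $|F|^2=|F_1|^2+\cdots+|F_m|^2$. Compatible fans. Let $\mathcal{P}$ be a lattice polytope. A complete fan $\Delta$ in $\mathbb{R}^n$ (of rational, strongly convex polyhedral cones) is compatible with $\mathcal{P}$ if it refines the (inner) normal fan of $\mathcal{P}$, i.e. if for every cone $\sigma\in\Delta$ there is a vertex $v_\sigma$ of $\mathcal{P}$ such that $\langle u,v_\sigma\rangle=\min_{x\in\mathcal{P}}\langle u,x\rangle$ for all $u\in\sigma$. Let $X_\Delta$ be the toric variety of $\Delta$, obtained by gluing the affine charts $\mathcal{U}_\sigma=\operatorname{Spec}\mathbb{C}[\sigma^\vee\cap\mathbb{Z}^n]$, $\sigma\in\Delta$, where $\sigma^\vee=\{x\in\mathbb{R}^n:\langle u,x\rangle\ge 0 \text{ for all } u\in\sigma\}$. Then $\mathcal{P}$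 defines a line bundle $\mathcal{O}(D_{\mathcal{P}})$ on $X_\Delta$ whose global sections correspond to the (Laurent) polynomials $F$ with $\operatorname{supp}F\subseteq\mathcal{P}$; on the chart $\mathcal{U}_\sigma$ the section $f$ corresponding to $F$ is given, in a local trivialization, by the regular function $z^{-v_\sigma}F$. No common zeros at infinity. Let $\mathcal{P}\subseteq\mathbb{R}^n_{\ge0}$ be a lattice polytope containing the origin and $\operatorname{supp}F_1,\ldots,\operatorname{supp}F_m$. Then there is a complete fan $\Delta$ compatible with $\mathcal{P}$ that contains the first orthant $\sigma_0=\mathbb{R}^n_{\ge 0}$ as a cone. Identify $\mathcal{U}_{\sigma_0}$ with $\mathbb{C}^n$ and let $V_\infty=X_\Delta\setminus\mathcal{U}_{\sigma_0}$ (the variety at infinity). The $F_j$ have no common zeros at infinity (with respect to $\mathcal{P}$) if the sections $f_1,\ldots,f_m$ of $\mathcal{O}(D_{\mathcal{P}})$ over $X_\Delta$ corresponding to $F_1,\ldots,F_m$ have no common zero in $V_\infty$. This does not depend on the choice of such a $\Delta$. *)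

theory Defs
  imports "HOL-Analysis.Analysis" "HOL-Algebra.Ideal_Product" "HOL-Library.Poly_Mapping"
begin

section \<open>Polynomials, Laurent polynomials and their supports\<close>

text \<open>
  The number of variables is \<open>n = CARD('n)\<close>. A polynomial is a finitely supported map from
  exponents to coefficients; the ring structure on \<^type>\<open>poly_mapping\<close> is convolution.
\<close>

type_synonym 'n poly_ring = "(nat ^ 'n) \<Rightarrow>\<^sub>0 complex"
type_synonym 'n laurent_ring = "(int ^ 'n) \<Rightarrow>\<^sub>0 complex"

definition nat_vec :: "nat ^ 'n \<Rightarrow> real ^ 'n"
  where "nat_vec \<alpha> = (\<chi> i. real (\<alpha> $ i))"

definition int_vec :: "int ^ 'n \<Rightarrow> real ^ 'n"
  where "int_vec \<alpha> = (\<chi> i. real_of_int (\<alpha> $ i))"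

definition supp :: "'n::finite poly_ring \<Rightarrow> (real ^ 'n) set"
  where "supp F = nat_vec ` Poly_Mapping.keys F"

definition laurent_supp :: "'n::finite laurent_ring \<Rightarrow> (real ^ 'n) set"
  where "laurent_supp f = int_vec ` Poly_Mapping.keys f"

definition to_laurent :: "'n::finite poly_ring \<Rightarrow> 'n laurent_ring"
  where "to_laurent F =
    (\<Sum>\<alpha>\<in>Poly_Mapping.keys F. Poly_Mapping.single (\<chi> i. int (\<alpha> $ i)) (Poly_Mapping.lookup F \<alpha>))"

definition laurent_monom :: "int ^ 'n::finite \<Rightarrow> 'n laurent_ring"
  where "laurent_monom \<alpha> = Poly_Mapping.single \<alpha> 1"

text \<open>A subring of a commutative ring given by a type class, as an object of \<open>HOL-Algebra\<close>.\<close>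

definition ring_on :: "'a::comm_ring_1 set \<Rightarrow> 'a ring"
  where "ring_on A = \<lparr>carrier = A, mult = (*), one = 1, zero = 0, add = (+)\<rparr>"

lemma ring_on_simps [simp]:
  "carrier (ring_on A) = A" "mult (ring_on A) = (*)" "one (ring_on A) = 1"
  "zero (ring_on A) = 0" "add (ring_on A) = (+)"
  by (simp_all add: ring_on_def)

lemma cring_ring_on:
  fixes A :: "'a::comm_ring_1 set"
  assumes "0 \<in> A" "1 \<in> A" "\<And>x. x \<in> A \<Longrightarrow> - x \<in> A"
    "\<And>x y. x \<in> A \<Longrightarrow> y \<in> A \<Longrightarrow> x + y \<in> A" "\<And>x y. x \<in> A \<Longrightarrow> y \<in> A \<Longrightarrow> x * y \<in> A"
  shows "cring (ring_on A)"
proof (rule cringI)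
  show "abelian_group (ring_on A)"
  proof (rule abelian_groupI)
    show "\<exists>y\<in>carrier (ring_on A). y \<oplus>\<^bsub>ring_on A\<^esub> x = \<zero>\<^bsub>ring_on A\<^esub>"
      if "x \<in> carrier (ring_on A)" for x
      using that assms(3) by (intro bexI[of _ "- x"]) auto
  qed (use assms in \<open>auto simp: algebra_simps\<close>)
  show "Group.comm_monoid (ring_on A)"
    by (rule comm_monoidI) (use assms in \<open>auto simp: algebra_simps\<close>)
qed (auto simp: algebra_simps)


section \<open>Integral closure of an ideal\<close>

definition in_integral_closure :: "'a::comm_ring_1 set \<Rightarrow> 'a \<Rightarrow> bool"
  where "in_integral_closure I \<Phi> \<longleftrightarrow>
    (\<exists>r H. 1 \<le> r \<and> (\<forall>j\<in>{1..r}. H j \<in> I [^]\<^bsub>ideals_set (ring_on UNIV)\<^esub> (j::nat)) \<and>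
      \<Phi> ^ r + (\<Sum>j=1..r. H j * \<Phi> ^ (r - j)) = 0)"


section \<open>Lattice polytopes, cones and fans\<close>

definition lattice_polytope :: "(real ^ 'n::finite) set \<Rightarrow> bool"
  where "lattice_polytope P \<longleftrightarrow> (\<exists>S :: (int ^ 'n) set. finite S \<and> P = convex hull (int_vec ` S))"

definition orthant :: "(real ^ 'n::finite) set"
  where "orthant = {x. \<forall>i. 0 \<le> x $ i}"

text \<open>Rational, strongly convex polyhedral cones; \<open>convex_cone hull {}\<close> is \<open>{0}\<close>.\<close>

definition lattice_cone :: "(real ^ 'n::finite) set \<Rightarrow> bool"
  where "lattice_cone \<sigma> \<longleftrightarrow>
    (\<exists>S :: (int ^ 'n) set. finite S \<and> \<sigma> = convex_cone hull (int_vec ` S)) \<and>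
    (\<forall>x. x \<in> \<sigma> \<and> - x \<in> \<sigma> \<longrightarrow> x = 0)"

text \<open>\<^const>\<open>face_of\<close> admits the empty set as a face, which is not a cone.\<close>

definition complete_fan :: "(real ^ 'n::finite) set set \<Rightarrow> bool"
  where "complete_fan \<Delta> \<longleftrightarrow>
    finite \<Delta> \<and> (\<forall>\<sigma>\<in>\<Delta>. lattice_cone \<sigma>) \<and>
    (\<forall>\<sigma>\<in>\<Delta>. \<forall>\<tau>. \<tau> face_of \<sigma> \<and> \<tau> \<noteq> {} \<longrightarrow> \<tau> \<in> \<Delta>) \<and>
    (\<forall>\<sigma>\<in>\<Delta>. \<forall>\<sigma>'\<in>\<Delta>. (\<sigma> \<inter> \<sigma>') face_of \<sigma> \<and> (\<sigma> \<inter> \<sigma>') face_of \<sigma>') \<and>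
    \<Union>\<Delta> = UNIV"

text \<open>
  \<open>cone_vertex P \<sigma> v\<close>: \<open>v\<close> is a vertex of \<open>P\<close> that minimizes every functional in \<open>\<sigma>\<close> over \<open>P\<close>.
  The vertices of a lattice polytope are lattice points, so \<open>v\<close> may be taken in \<open>int ^ 'n\<close>.
\<close>

definition cone_vertex :: "(real ^ 'n::finite) set \<Rightarrow> (real ^ 'n) set \<Rightarrow> int ^ 'n \<Rightarrow> bool"
  where "cone_vertex P \<sigma> v \<longleftrightarrow>
    int_vec v extreme_point_of P \<and> (\<forall>u\<in>\<sigma>. \<forall>x\<in>P. u \<bullet> int_vec v \<le> u \<bullet> x)"

definition compatible :: "(real ^ 'n::finite) set set \<Rightarrow> (real ^ 'n) set \<Rightarrow> bool"
  where "compatible \<Delta> P \<longleftrightarrow> (\<forall>\<sigma>\<in>\<Delta>. \<exists>v. cone_vertex P \<sigma> v)"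


section \<open>The toric variety of a fan\<close>

definition dual_cone :: "(real ^ 'n::finite) set \<Rightarrow> (real ^ 'n) set"
  where "dual_cone \<sigma> = {x. \<forall>u\<in>\<sigma>. 0 \<le> u \<bullet> x}"

definition chart_ring :: "(real ^ 'n::finite) set \<Rightarrow> 'n laurent_ring ring"
  where "chart_ring \<sigma> = ring_on {f. laurent_supp f \<subseteq> dual_cone \<sigma>}"

text \<open>
  The points of an affine variety \<open>Spec A\<close> are its closed points, that is, the maximal ideals
  of \<open>A\<close>.
\<close>

definition chart :: "(real ^ 'n::finite) set \<Rightarrow> 'n laurent_ring set set"
  where "chart \<sigma> = {p. maximalideal p (chart_ring \<sigma>)}"

text \<open>
  For a face \<open>\<tau>\<close> of \<open>\<sigma>\<close> the inclusion of \<open>chart_ring \<sigma>\<close> into \<open>chart_ring \<tau>\<close> induces the open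
  immersion of the chart of \<open>\<tau>\<close> into that of \<open>\<sigma>\<close>; on points it is contraction of ideals. The
  charts of \<open>\<sigma>\<close> and \<open>\<sigma>'\<close> are glued along the chart of \<open>\<sigma> \<inter> \<sigma>'\<close>;
  for a fan \<open>\<Delta>\<close> the resulting relation \<open>glue \<Delta>\<close> is an equivalence (the charts intersect in the charts of common faces).
\<close>

definition contraction :: "(real ^ 'n::finite) set \<Rightarrow> 'n laurent_ring set \<Rightarrow> 'n laurent_ring set"
  where "contraction \<sigma> p = p \<inter> carrier (chart_ring \<sigma>)"

definition glue ::
    "(real ^ 'n::finite) set set \<Rightarrow> ((real ^ 'n) set \<times> 'n laurent_ring set) rel"
  where "glue \<Delta> = {((\<sigma>, p), (\<sigma>', p')). \<sigma> \<in> \<Delta> \<and> \<sigma>' \<in> \<Delta> \<and> p \<in> chart \<sigma> \<and> p' \<in> chart \<sigma>' \<and>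
    (\<exists>q\<in>chart (\<sigma> \<inter> \<sigma>'). contraction \<sigma> q = p \<and> contraction \<sigma>' q = p')}"

definition toric_variety ::
    "(real ^ 'n::finite) set set \<Rightarrow> ((real ^ 'n) set \<times> 'n laurent_ring set) set set"
  where "toric_variety \<Delta> = (SIGMA \<sigma>:\<Delta>. chart \<sigma>) // glue \<Delta>"

definition variety_at_infinity ::
    "(real ^ 'n::finite) set set \<Rightarrow> ((real ^ 'n) set \<times> 'n laurent_ring set) set set"
  where "variety_at_infinity \<Delta> = toric_variety \<Delta> - ({orthant} \<times> chart orthant) // glue \<Delta>"


section \<open>Sections of the line bundle of a polytope\<close>

text \<open>
  In the trivialization over the chart of \<open>\<sigma>\<close>, the section corresponding to \<open>F\<close> is
  \<open>z\<^bsup>-v\<^esup> F\<close> with \<open>v\<close> a vertex of \<open>P\<close> as in \<^const>\<open>cone_vertex\<close>. If \<open>\<sigma>\<close> is not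
  full-dimensional, then \<open>v\<close> need not be unique, but another choice changes the local section
  only by a unit of \<open>chart_ring \<sigma>\<close> (see \<open>local_section_transition\<close>).
\<close>

definition local_section ::
    "(real ^ 'n::finite) set \<Rightarrow> 'n laurent_ring \<Rightarrow> (real ^ 'n) set \<Rightarrow> 'n laurent_ring"
  where "local_section P F \<sigma> = laurent_monom (- (SOME v. cone_vertex P \<sigma> v)) * F"

text \<open>
  A regular function vanishes at a point of a chart iff it lies in the corresponding maximal
  ideal; by \<open>local_section_vanishes_iff\<close> this does not depend on the chart.
\<close>

definition section_vanishes_at :: "(real ^ 'n::finite) set \<Rightarrow> 'n laurent_ring \<Rightarrow>
    ((real ^ 'n) set \<times> 'n laurent_ring set) set \<Rightarrow> bool"
  where "section_vanishes_at P F x \<longleftrightarrow> (\<exists>(\<sigma>, p)\<in>x. local_section P F \<sigma> \<in> p)"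

definition no_common_zeros_at_infinity ::
    "(real ^ 'n::finite) set \<Rightarrow> 'n poly_ring set \<Rightarrow> bool"
  where "no_common_zeros_at_infinity P \<F> \<longleftrightarrow>
    (\<exists>\<Delta>. complete_fan \<Delta> \<and> compatible \<Delta> P \<and> orthant \<in> \<Delta> \<and>
      \<not> (\<exists>x\<in>variety_at_infinity \<Delta>. \<forall>F\<in>\<F>. section_vanishes_at P (to_laurent F) x))"


section \<open>Well-definedness\<close>

lemma int_vec_simps [simp]:
  "int_vec 0 = 0" "int_vec (\<alpha> + \<beta>) = int_vec \<alpha> + int_vec \<beta>"
  "int_vec (\<alpha> - \<beta>) = int_vec \<alpha> - int_vec \<beta>" "int_vec (- \<alpha>) = - int_vec \<alpha>"
  by (auto simp: int_vec_def vec_eq_iff)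

lemma laurent_supp_mult:
  "laurent_supp (f * g) \<subseteq> {x + y |x y. x \<in> laurent_supp f \<and> y \<in> laurent_supp g}"
  using keys_mult[of f g] by (fastforce simp: laurent_supp_def)

lemma dual_cone_add: "x \<in> dual_cone \<sigma> \<Longrightarrow> y \<in> dual_cone \<sigma> \<Longrightarrow> x + y \<in> dual_cone \<sigma>"
  by (auto simp: dual_cone_def inner_add_right)

lemma dual_cone_antimono: "\<tau> \<subseteq> \<sigma> \<Longrightarrow> dual_cone \<sigma> \<subseteq> dual_cone \<tau>"
  by (auto simp: dual_cone_def)

lemma carrier_chart_ring: "carrier (chart_ring \<sigma>) = {f. laurent_supp f \<subseteq> dual_cone \<sigma>}"
  by (simp add: chart_ring_def)

lemma cring_chart_ring: "cring (chart_ring \<sigma>)"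
  unfolding chart_ring_def
proof (rule cring_ring_on; clarsimp)
  show "x \<in> dual_cone \<sigma>" if "x \<in> laurent_supp 0" for x
    using that by (simp add: laurent_supp_def)
  show "x \<in> dual_cone \<sigma>" if "x \<in> laurent_supp 1" for x
    using that by (auto simp: laurent_supp_def dual_cone_def)
  show "x \<in> dual_cone \<sigma>" if "laurent_supp f \<subseteq> dual_cone \<sigma>" "x \<in> laurent_supp (- f)" for f x
    using that by (auto simp: laurent_supp_def)
  show "x \<in> dual_cone \<sigma>" if "laurent_supp f \<subseteq> dual_cone \<sigma>" "laurent_supp g \<subseteq> dual_cone \<sigma>"
    "x \<in> laurent_supp (f + g)" for f g x
    using that keys_add[of f g] by (fastforce simp: laurent_supp_def)
  show "x \<in> dual_cone \<sigma>" if "laurent_supp f \<subseteq> dual_cone \<sigma>" "laurent_supp g \<subseteq> dual_cone \<sigma>"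
    "x \<in> laurent_supp (f * g)" for f g x
    using that laurent_supp_mult[of f g] by (fastforce intro: dual_cone_add)
qed

lemma laurent_monom_add: "laurent_monom (\<alpha> + \<beta>) = laurent_monom \<alpha> * laurent_monom \<beta>"
  by (simp add: laurent_monom_def mult_single)

lemma laurent_supp_monom [simp]: "laurent_supp (laurent_monom \<alpha>) = {int_vec \<alpha>}"
  by (simp add: laurent_supp_def laurent_monom_def)

lemma cone_vertex_diff:
  assumes "cone_vertex P \<sigma> v" "x \<in> P"
  shows "x - int_vec v \<in> dual_cone \<sigma>"
  using assms by (auto simp: cone_vertex_def dual_cone_def inner_diff_right)

lemma cone_vertex_some:
  assumes "compatible \<Delta> P" "\<sigma> \<in> \<Delta>"
  shows "cone_vertex P \<sigma> (SOME v. cone_vertex P \<sigma> v)"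
  using assms someI_ex unfolding compatible_def by fast

lemma local_section_in_chart_ring:
  assumes "compatible \<Delta> P" "\<sigma> \<in> \<Delta>" "laurent_supp F \<subseteq> P"
  shows "local_section P F \<sigma> \<in> carrier (chart_ring \<sigma>)"
proof -
  let ?v = "SOME v. cone_vertex P \<sigma> v"
  have "x - int_vec ?v \<in> dual_cone \<sigma>" if "x \<in> laurent_supp F" for x
    using cone_vertex_diff[OF cone_vertex_some[OF assms(1,2)]] that assms(3) by blast
  then show ?thesis
    using laurent_supp_mult[of "laurent_monom (- ?v)" F]
    by (fastforce simp: carrier_chart_ring local_section_def)
qed

lemma local_section_transition:
  assumes "cone_vertex P \<sigma> v" "cone_vertex P \<sigma>' w" "\<tau> \<subseteq> \<sigma>" "\<tau> \<subseteq> \<sigma>'"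
  shows "laurent_monom (v - w) \<in> carrier (chart_ring \<tau>)"
    and "laurent_monom (- w) * F = laurent_monom (v - w) * (laurent_monom (- v) * F)"
proof -
  have "int_vec v \<in> P"
    using assms(1) by (simp add: cone_vertex_def extreme_point_of_def)
  then have "int_vec v - int_vec w \<in> dual_cone \<sigma>'"
    by (rule cone_vertex_diff[OF assms(2)])
  then show "laurent_monom (v - w) \<in> carrier (chart_ring \<tau>)"
    using dual_cone_antimono[OF assms(4)] by (auto simp: carrier_chart_ring)
  show "laurent_monom (- w) * F = laurent_monom (v - w) * (laurent_monom (- v) * F)"
    by (simp add: mult.assoc[symmetric] laurent_monom_add[symmetric])
qed

lemma glue_sym: "(a, b) \<in> glue \<Delta> \<Longrightarrow> (b, a) \<in> glue \<Delta>"
  unfolding glue_def by (auto simp: Int_commute)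

lemma glue_refl: "\<sigma> \<in> \<Delta> \<Longrightarrow> p \<in> chart \<sigma> \<Longrightarrow> ((\<sigma>, p), (\<sigma>, p)) \<in> glue \<Delta>"
proof -
  assume *: "\<sigma> \<in> \<Delta>" "p \<in> chart \<sigma>"
  then have "p \<subseteq> carrier (chart_ring \<sigma>)"
    unfolding chart_def
    by (metis additive_subgroup.a_subset ideal.axioms(1) maximalideal.axioms(1) mem_Collect_eq)
  with * show ?thesis
    by (auto simp: glue_def contraction_def)
qed

lemma local_section_vanishes_iff:
  assumes "compatible \<Delta> P" "laurent_supp F \<subseteq> P" "((\<sigma>, p), (\<sigma>', p')) \<in> glue \<Delta>"
  shows "local_section P F \<sigma> \<in> p \<longleftrightarrow> local_section P F \<sigma>' \<in> p'"
proof -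
  have *: "local_section P F \<sigma>' \<in> p'"
    if glue: "((\<sigma>, p), (\<sigma>', p')) \<in> glue \<Delta>" and van: "local_section P F \<sigma> \<in> p" for \<sigma> \<sigma>' p p'
  proof -
    obtain q where q: "\<sigma> \<in> \<Delta>" "\<sigma>' \<in> \<Delta>" "q \<in> chart (\<sigma> \<inter> \<sigma>')" "contraction \<sigma> q = p"
      "contraction \<sigma>' q = p'"
      using glue by (auto simp: glue_def)
    let ?v = "SOME v. cone_vertex P \<sigma> v" and ?w = "SOME v. cone_vertex P \<sigma>' v"
    note tr = local_section_transition[OF cone_vertex_some[OF assms(1) q(1)]
        cone_vertex_some[OF assms(1) q(2)], of "\<sigma> \<inter> \<sigma>'"]
    have "local_section P F \<sigma> \<in> q"
      using van q(4) by (auto simp: contraction_def)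
    moreover have "ideal q (chart_ring (\<sigma> \<inter> \<sigma>'))"
      using q(3) by (simp add: chart_def maximalideal.axioms(1))
    ultimately have "laurent_monom (?v - ?w) * local_section P F \<sigma> \<in> q"
      using ideal.I_l_closed[of q "chart_ring (\<sigma> \<inter> \<sigma>')"] tr(1)
      by (auto simp: chart_ring_def)
    then have "local_section P F \<sigma>' \<in> q"
      using tr(2)[of F] by (simp add: local_section_def)
    then show ?thesis
      using local_section_in_chart_ring[OF assms(1) q(2) assms(2)] q(5)
      by (auto simp: contraction_def)
  qed
  show ?thesis
    using *[OF assms(3)] *[OF glue_sym[OF assms(3)]] by blast
qed

end

theory Submission
  imports Defs "HOL-Computational_Algebra.Polynomial" "HOL-Computational_Algebra.Primes"
begin

text \<open>
  Put \<open>e' = max (1 + 1/n) e\<close> and let \<open>A\<close> be the ring of all \<open>\<Sum>k. g\<^sub>k y\<^sup>k\<close> where \<open>g\<^sub>k\<close> is a combination of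
  products of \<open>k\<close> of the \<open>F\<^sub>j\<close> with coefficients supported in \<open>(e' - 1) k P\<close>. The element \<open>\<Phi> y\<close> is
  integral over \<open>A\<close>. Otherwise Zorn's lemma gives a larger subring \<open>B\<close>, maximal among those over which
  \<open>\<Phi> y\<close> is not integral; it contains each Laurent monomial or its inverse, so the exponents of the
  monomials in \<open>B\<close> contain the dual of a cone of the fan (Gordan's theorem). In the first orthant this
  contradicts the integral dependence of \<open>\<Phi>\<close>; at infinity it contradicts the unit ideal generated by
  the local sections. Hence there is one nonzero \<open>c\<close> such that \<open>c \<Phi>\<^sup>q\<close> lies in the \<open>q\<close>-th piece of
  \<open>A\<close>, up to a bounded enlargement of supports, for all \<open>q\<close>.

  A dimension count shows that \<open>n\<close> combinations of the \<open>F\<^sub>j\<close> form a reduction modulo some \<open>F\<^sub>j\<close>, so a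
  Briancon--Skoda argument in the style of tight closure applies. If \<open>\<Phi>\<^sup>n\<close> were not of the desired
  form, a linear functional would separate it from the elements that are. All data live in a
  finitely generated subring of the complex numbers, in which only finitely many primes are
  invertible; the Frobenius twist of the functional modulo a large prime \<open>p\<close>, applied to \<open>c \<Phi>\<^bsup>n p\<^esup>\<close>, then
  shows that a nonzero coefficient of \<open>c\<close> is divisible by \<open>p\<close>, for all large \<open>p\<close>.
\<close>


section \<open>The semiring of additive subgroups of a commutative ring\<close>

text \<open>A graded ring of sections in \<open>n\<close> variables needs up to \<open>n + 1\<close>
  parameters, and pigeonhole over \<open>n + 1\<close> elements would only reach the power
  \<open>n + 1\<close> of \<open>\<Phi>\<close>. The exponent \<open>n\<close> is saved by paying
  for one parameter, some nonzero \<open>F j\<close>, with support instead: the reduction turns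
  \<open>p\<close> factors of degree one and \<open>n p\<close> factors from the ideal, up to a
  bounded number, into \<open>p\<close>-th powers either of one of \<open>n\<close> combinations or
  of that \<open>F j\<close>. The \<open>p\<close> factors of degree one have to be split off from a
  support of size \<open>(e' - 1) n p\<close>, so \<open>(e' - 1) n \<ge> 1\<close> is required.
  This is the origin of \<open>1 + 1/n\<close> and of the \<open>n + 1\<close> in the bound. The
  maximal subring \<open>B\<close> takes the place of a valuation ring, and the cone found for it is
  the one whose orbit would contain the center of the valuation. Of the properties of valuation
  rings only the dichotomy for a unit and its inverse and the behaviour of non-units are
  needed.\<close>

inductive_set add_span :: "'a::ab_group_add set \<Rightarrow> 'a set" for X where
  base: "x \<in> X \<Longrightarrow> x \<in> add_span X"
| zero: "0 \<in> add_span X"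
| diff: "x \<in> add_span X \<Longrightarrow> y \<in> add_span X \<Longrightarrow> x - y \<in> add_span X"

text \<open>With sums and products these subgroups form an idempotent commutative semiring, so
  containments between modules, ideals and their powers become inequalities within reach of
  \<open>algebra_simps\<close>. Subgroups rather than modules over a fixed ring are used because the
  ring of constants has to shrink from the complex numbers to a finitely generated subring.\<close>

typedef (overloaded) 'a asub =
  "{H :: 'a::comm_ring_1 set. 0 \<in> H \<and> (\<forall>x\<in>H. \<forall>y\<in>H. x - y \<in> H)}"
  morphisms els Asub
  by (rule exI[of _ "{0}"]) simp

lemma zero_els [simp]: "0 \<in> els H"
  using els[of H] by auto

lemma diff_els: "x \<in> els H \<Longrightarrow> y \<in> els H \<Longrightarrow> x - y \<in> els H"
  using els[of H] by auto

lemma uminus_els: "x \<in> els H \<Longrightarrow> - x \<in> els H"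
  using diff_els[of 0 H x] by simp

lemma add_els: "x \<in> els H \<Longrightarrow> y \<in> els H \<Longrightarrow> x + y \<in> els H"
  using diff_els[of x H "- y"] uminus_els[of y] by simp

lemma sum_els: "(\<And>i. i \<in> I \<Longrightarrow> f i \<in> els H) \<Longrightarrow> sum f I \<in> els H"
  by (induction I rule: infinite_finite_induct) (auto intro: add_els)

definition gen :: "'a::comm_ring_1 set \<Rightarrow> 'a asub"
  where "gen X = Asub (add_span X)"

lemma els_Asub:
  assumes "0 \<in> H" "\<And>x y. x \<in> H \<Longrightarrow> y \<in> H \<Longrightarrow> x - y \<in> H"
  shows "els (Asub H) = H"
  using assms by (intro Asub_inverse) auto

lemma els_gen: "els (gen X) = add_span X"
  unfolding gen_def by (rule els_Asub) (auto intro: add_span.intros)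

lemma gen_base: "x \<in> X \<Longrightarrow> x \<in> els (gen X)"
  by (simp add: els_gen add_span.base)

instantiation asub :: (comm_ring_1) order
begin
definition less_eq_asub :: "'a asub \<Rightarrow> 'a asub \<Rightarrow> bool" where "H \<le> K \<longleftrightarrow> els H \<subseteq> els K"
definition less_asub :: "'a asub \<Rightarrow> 'a asub \<Rightarrow> bool" where "H < K \<longleftrightarrow> els H \<subset> els K"
instance
  by standard (auto simp: less_eq_asub_def less_asub_def els_inject)
end

lemma leD_els: "H \<le> K \<Longrightarrow> x \<in> els H \<Longrightarrow> x \<in> els K"
  by (auto simp: less_eq_asub_def)

lemma leI_els: "(\<And>x. x \<in> els H \<Longrightarrow> x \<in> els K) \<Longrightarrow> H \<le> K"
  by (auto simp: less_eq_asub_def)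

lemma gen_le_iff: "gen X \<le> H \<longleftrightarrow> X \<subseteq> els H"
proof
  show "X \<subseteq> els H" if "gen X \<le> H"
    using that by (auto intro: leD_els gen_base)
  show "gen X \<le> H" if X: "X \<subseteq> els H"
  proof (rule leI_els)
    show "x \<in> els H" if "x \<in> els (gen X)" for x
      using that[unfolded els_gen] X by induction (auto intro: diff_els)
  qed
qed

lemma gen_els [simp]: "gen (els H) = H"
  by (rule order.antisym) (auto simp: gen_le_iff intro: leI_els gen_base)

lemma gen_mono: "X \<subseteq> Y \<Longrightarrow> gen X \<le> gen Y"
  by (auto simp: gen_le_iff intro: gen_base)

instantiation asub :: (comm_ring_1) comm_semiring_1
begin
definition zero_asub :: "'a asub" where "0 = gen {}"
definition one_asub :: "'a asub" where "1 = gen {1}"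
definition plus_asub :: "'a asub \<Rightarrow> 'a asub \<Rightarrow> 'a asub"
  where "H + K = gen (els H \<union> els K)"
definition times_asub :: "'a asub \<Rightarrow> 'a asub \<Rightarrow> 'a asub"
  where "H * K = gen {x * y |x y. x \<in> els H \<and> y \<in> els K}"

lemma plus_le_iff0: "H + K \<le> J \<longleftrightarrow> H \<le> J \<and> K \<le> (J :: 'a asub)"
  by (simp add: plus_asub_def gen_le_iff) (simp add: less_eq_asub_def)

lemma times_le_iff0: "H * K \<le> J \<longleftrightarrow> (\<forall>x\<in>els H. \<forall>y\<in>els K. x * y \<in> els (J :: 'a asub))"
  unfolding times_asub_def gen_le_iff by blast

lemma mult_els0: "x \<in> els H \<Longrightarrow> y \<in> els K \<Longrightarrow> x * y \<in> els (H * K :: 'a asub)"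
  using times_le_iff0[of H K "H * K"] by auto

lemma gen_times_le0: "gen X * H \<le> J \<longleftrightarrow> (\<forall>x\<in>X. \<forall>y\<in>els H. x * y \<in> els (J :: 'a asub))"
proof
  show "\<forall>x\<in>X. \<forall>y\<in>els H. x * y \<in> els J" if "gen X * H \<le> J"
    using that gen_base[of _ X] unfolding times_le_iff0 by blast
  assume *: "\<forall>x\<in>X. \<forall>y\<in>els H. x * y \<in> els J"
  show "gen X * H \<le> J" unfolding times_le_iff0
  proof (intro ballI)
    show "x * y \<in> els J" if "x \<in> els (gen X)" "y \<in> els H" for x y
      using that(1)[unfolded els_gen] that(2) *
      by induction (auto simp: left_diff_distrib intro: diff_els)
  qed
qed

instance
proof
  fix a b c :: "'a asub"
  show "a + b = b + a" by (simp add: plus_asub_def Un_commute)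
  show "a * b = b * a"
    unfolding times_asub_def by (rule arg_cong[of _ _ gen]) (auto, (metis mult.commute)+)
  have comm: "a * b = b * a" for a b :: "'a asub"
    unfolding times_asub_def by (rule arg_cong[of _ _ gen]) (auto, (metis mult.commute)+)
  have ge: "a \<le> a + b" "b \<le> a + b" for a b :: "'a asub"
    using plus_le_iff0[of a b "a + b"] by auto
  show "a + b + c = a + (b + c)"
  proof (rule order.antisym)
    have 1: "x \<le> y \<Longrightarrow> x \<le> y + z" "x \<le> z \<Longrightarrow> x \<le> y + z" for x y z :: "'a asub"
      using ge order.trans by blast+
    show "a + b + c \<le> a + (b + c)" by (simp add: plus_le_iff0 1)
    show "a + (b + c) \<le> a + b + c" by (simp add: plus_le_iff0 1)
  qed
  show "0 + a = a"
  proof (rule order.antisym)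
    have "0 \<le> a" by (simp add: zero_asub_def gen_le_iff)
    then show "0 + a \<le> a" by (simp add: plus_le_iff0)
  qed (rule ge)
  have as: "a * b * c \<le> a * (b * c)" for a b c :: "'a asub"
    unfolding times_asub_def[of a b] gen_times_le0
    using mult_els0[of _ a _ "b * c"] mult_els0[of _ b _ c] by (force simp: mult.assoc)
  show "a * b * c = a * (b * c)"
    using as[of a b c] as[of c b a] comm[of "c * b" a] comm[of c b] comm[of c "b * a"] comm[of b a]
    by (intro order.antisym) auto
  show "1 * a = a"
  proof (rule order.antisym)
    show "1 * a \<le> a" unfolding one_asub_def gen_times_le0 by auto
    show "a \<le> 1 * a"
      using mult_els0[of 1 1 _ a] by (auto intro!: leI_els simp: one_asub_def gen_base)
  qed
  show "0 * a = 0" "a * 0 = 0"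
  proof -
    have "0 * a \<le> 0" unfolding zero_asub_def gen_times_le0 by auto
    moreover have "(0::'a asub) \<le> 0 * a" unfolding zero_asub_def gen_le_iff by auto
    ultimately show "0 * a = 0" "a * 0 = 0" by (auto simp: comm)
  qed
  have mono: "a \<le> b \<Longrightarrow> a * c \<le> b * c" for a b c :: "'a asub"
    unfolding times_le_iff0[of a] by (auto intro!: mult_els0 intro: leD_els)
  show "(a + b) * c = a * c + b * c"
  proof (rule order.antisym)
    show "(a + b) * c \<le> a * c + b * c"
      unfolding plus_asub_def[of a b] gen_times_le0
      using leD_els[OF ge(1)[of "a * c" "b * c"]] leD_els[OF ge(2)[of "b * c" "a * c"]]
      by (auto intro: mult_els0)
    show "a * c + b * c \<le> (a + b) * c"
      by (auto simp: plus_le_iff0 intro!: mono ge)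
  qed
  show "(0::'a asub) \<noteq> 1"
  proof
    assume eq: "(0::'a asub) = 1"
    have "(1::'a) \<in> els (0 :: 'a asub)" unfolding eq one_asub_def by (auto intro: gen_base)
    moreover have "els (0 :: 'a asub) \<subseteq> {0}"
    proof
      show "x \<in> {0}" if "x \<in> els (0 :: 'a asub)" for x
        using that[unfolded zero_asub_def els_gen] by induction auto
    qed
    ultimately show False by auto
  qed
qed
end

lemmas plus_le_iff = plus_le_iff0
lemmas times_le_iff = times_le_iff0
lemmas mult_els = mult_els0
lemmas gen_times_le_iff = gen_times_le0

lemma asub_mult_mono: "a \<le> b \<Longrightarrow> c \<le> d \<Longrightarrow> a * c \<le> b * (d :: 'a::comm_ring_1 asub)"
  unfolding times_le_iff by (auto intro!: mult_els intro: leD_els)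

lemma asub_power_mono: "a \<le> b \<Longrightarrow> a ^ n \<le> (b :: 'a::comm_ring_1 asub) ^ n"
  by (induction n) (auto intro: asub_mult_mono)

lemma asub_le_plus [simp]: "a \<le> a + b" "a \<le> b + (a :: 'a::comm_ring_1 asub)"
  using plus_le_iff[of a b "a + b"] plus_le_iff[of b a "b + a"] by auto

lemma asub_le_plusI1: "a \<le> b \<Longrightarrow> a \<le> b + (c :: 'a::comm_ring_1 asub)"
  by (rule order.trans[OF _ asub_le_plus(1)])

lemma asub_le_plusI2: "a \<le> c \<Longrightarrow> a \<le> b + (c :: 'a::comm_ring_1 asub)"
  by (rule order.trans[OF _ asub_le_plus(2)])

lemma asub_plus_mono: "a \<le> b \<Longrightarrow> c \<le> d \<Longrightarrow> a + c \<le> b + (d :: 'a::comm_ring_1 asub)"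
  by (simp add: plus_le_iff asub_le_plusI1 asub_le_plusI2)

lemma asub_plus_idem [simp]: "a + a = (a :: 'a::comm_ring_1 asub)"
  by (rule order.antisym) (auto simp: plus_le_iff)

lemma asub_zero_le [simp]: "0 \<le> (a :: 'a::comm_ring_1 asub)"
  by (simp add: zero_asub_def gen_le_iff)

lemma asub_sum_le_iff: "finite I \<Longrightarrow> sum f I \<le> (a :: 'a::comm_ring_1 asub) \<longleftrightarrow> (\<forall>i\<in>I. f i \<le> a)"
  by (induction I rule: finite_induct) (auto simp: plus_le_iff)

lemma asub_le_sum: "finite I \<Longrightarrow> i \<in> I \<Longrightarrow> f i \<le> (sum f I :: 'a::comm_ring_1 asub)"
  using asub_sum_le_iff[of I f "sum f I"] by auto

lemma asub_sum_mono: "(\<And>i. i \<in> I \<Longrightarrow> f i \<le> g i) \<Longrightarrow> sum f I \<le> (sum g I :: 'a::comm_ring_1 asub)"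
  by (induction I rule: infinite_finite_induct) (auto intro: asub_plus_mono)

lemma one_le_iff: "1 \<le> (a :: 'a::comm_ring_1 asub) \<longleftrightarrow> 1 \<in> els a"
  by (simp add: one_asub_def gen_le_iff)

lemma asub_le_mult_one: "1 \<le> b \<Longrightarrow> a \<le> a * (b :: 'a::comm_ring_1 asub)"
  using asub_mult_mono[of a a 1 b] by simp

lemma asub_one_le_power: "1 \<le> a \<Longrightarrow> 1 \<le> (a :: 'a::comm_ring_1 asub) ^ n"
  using asub_power_mono[of 1 a n] by simp

lemma asub_power_increasing: "1 \<le> a \<Longrightarrow> m \<le> n \<Longrightarrow> (a :: 'a::comm_ring_1 asub) ^ m \<le> a ^ n"
  using asub_le_mult_one[of "a ^ (n - m)" "a ^ m"] asub_one_le_power[of a "n - m"]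
  by (simp add: power_add[symmetric])

lemma gen_times_gen: "gen X * gen Y = gen {x * y |x y. x \<in> X \<and> y \<in> Y}"
proof (rule order.antisym)
  have *: "x * y \<in> els (gen {x * y |x y. x \<in> X \<and> y \<in> Y})" if "x \<in> X" "y \<in> els (gen Y)" for x y
    using that(2)[unfolded els_gen]
  proof induction
    case (base y)
    then show ?case using that by (intro gen_base) blast
  qed (auto simp: right_diff_distrib intro: diff_els)
  show "gen X * gen Y \<le> gen {x * y |x y. x \<in> X \<and> y \<in> Y}"
    unfolding gen_times_le_iff by (intro ballI *)
  have "x * y \<in> els (gen X * gen Y)" if "x \<in> X" "y \<in> Y" for x y
    using that by (intro mult_els gen_base)
  then show "gen {x * y |x y. x \<in> X \<and> y \<in> Y} \<le> gen X * gen Y"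
    unfolding gen_le_iff by blast
qed

lemma gen_singleton_mult: "gen {x} * gen {y} = gen {x * y}"
  by (simp add: gen_times_gen)

lemma gen_singleton_power: "gen {x} ^ n = gen {x ^ n}"
  by (induction n) (auto simp: one_asub_def gen_singleton_mult)

lemma gen_one: "gen {1} = 1"
  by (simp add: one_asub_def)

lemma gen_Un: "gen (X \<union> Y) = gen X + gen Y"
proof (rule order.antisym)
  show "gen (X \<union> Y) \<le> gen X + gen Y"
    unfolding gen_le_iff
    using leD_els[OF asub_le_plus(1), of _ "gen X" "gen Y"] leD_els[OF asub_le_plus(2), of _ "gen Y" "gen X"]
      gen_base[of _ X] gen_base[of _ Y] by blast
qed (simp add: plus_le_iff gen_mono)

lemma gen_UN: "finite I \<Longrightarrow> gen (\<Union>i\<in>I. X i) = (\<Sum>i\<in>I. gen (X i))"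
  by (induction I rule: finite_induct) (simp_all add: gen_Un zero_asub_def)

lemma els_plusE:
  assumes "x \<in> els (H + K)"
  obtains y z where "x = y + z" "y \<in> els H" "z \<in> els K"
proof -
  have "x \<in> add_span (els H \<union> els K)" using assms by (simp add: plus_asub_def els_gen)
  then have "\<exists>y z. x = y + z \<and> y \<in> els H \<and> z \<in> els K"
  proof induction
    case (base x)
    then show ?case by (metis Un_iff add.left_neutral add.right_neutral zero_els)
  next
    case zero
    then show ?case by (metis add.left_neutral zero_els)
  next
    case (diff x y)
    then obtain a b c d where "x = a + b" "y = c + d" "a \<in> els H" "b \<in> els K" "c \<in> els H" "d \<in> els K"
      by blast
    then show ?case
      by (intro exI[of _ "a - c"] exI[of _ "b - d"]) (auto intro: diff_els)
  qed
  then show ?thesis using that by blast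
qed

lemma els_sumE:
  assumes "finite I" "x \<in> els (\<Sum>i\<in>I. H i)"
  obtains y where "x = (\<Sum>i\<in>I. y i)" "\<And>i. i \<in> I \<Longrightarrow> y i \<in> els (H i)"
proof -
  have "\<exists>y. x = (\<Sum>i\<in>I. y i) \<and> (\<forall>i\<in>I. y i \<in> els (H i))"
    using assms
  proof (induction I arbitrary: x rule: finite_induct)
    case empty
    then have "x \<in> add_span {}" by (simp add: zero_asub_def els_gen)
    then have "x = 0" by induction auto
    then show ?case by simp
  next
    case (insert i I)
    then obtain a b where ab: "x = a + b" "a \<in> els (H i)" "b \<in> els (\<Sum>i\<in>I. H i)"
      by (auto elim: els_plusE)
    from insert.IH[OF ab(3)] obtain y where "b = sum y I" "\<forall>i\<in>I. y i \<in> els (H i)" by blast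
    with ab insert show ?case
      by (intro exI[of _ "y(i := a)"]) (auto intro!: sum.cong)
  qed
  then show ?thesis using that by blast
qed

lemma els_gen_singleton_times:
  assumes "x \<in> els (gen {a} * H)"
  obtains y where "x = a * y" "y \<in> els H"
proof -
  have "els (Asub {a * y |y. y \<in> els H}) = {a * y |y. y \<in> els H}"
  proof (rule els_Asub)
    show "0 \<in> {a * y |y. y \<in> els H}" by (auto intro!: exI[of _ 0])
    show "x - y \<in> {a * y |y. y \<in> els H}" if "x \<in> {a * y |y. y \<in> els H}" "y \<in> {a * y |y. y \<in> els H}" for x y
      using that by (auto simp flip: right_diff_distrib intro: diff_els)
  qed
  moreover from this have "gen {a} * H \<le> Asub {a * y |y. y \<in> els H}"
    by (auto simp: gen_times_le_iff)
  ultimately show ?thesis using assms that by (auto dest: leD_els)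
qed

subsection \<open>Pigeonhole inequalities\<close>

text \<open>Pigeonhole: a product of \<open>a + b\<close> factors, each from \<open>x\<close> or
  \<open>y\<close>, has at least \<open>a\<close> of the first kind or at least \<open>b\<close> of
  the second. The remaining factors are only recorded as lying in \<open>x + y\<close>.\<close>

lemma asub_power_add_le:
  fixes x y :: "'a::comm_ring_1 asub"
  shows "(x + y) ^ (a + b) \<le> x ^ a * (x + y) ^ b + y ^ b * (x + y) ^ a"
proof (induction a arbitrary: b)
  case 0
  show ?case by (auto intro: asub_le_plusI1)
next
  case (Suc a)
  show ?case
  proof (induction b)
    case 0
    show ?case by (auto intro: asub_le_plusI2)
  next
    case (Suc b)
    have "(x + y) ^ (Suc a + Suc b) = x * (x + y) ^ (a + Suc b) + y * (x + y) ^ (Suc a + b)"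
      by (simp add: distrib_right)
    also have "\<dots> \<le> x * (x ^ a * (x + y) ^ Suc b + y ^ Suc b * (x + y) ^ a) +
        y * (x ^ Suc a * (x + y) ^ b + y ^ b * (x + y) ^ Suc a)"
      by (intro asub_plus_mono asub_mult_mono order.refl Suc.IH \<open>\<And>b. (x + y) ^ (a + b) \<le> x ^ a * (x + y) ^ b + y ^ b * (x + y) ^ a\<close>)
    also have "\<dots> = x ^ Suc a * (x + y) ^ Suc b + y ^ Suc b * (x * (x + y) ^ a) +
        (x ^ Suc a * (y * (x + y) ^ b) + y ^ Suc b * (x + y) ^ Suc a)"
      by (simp add: algebra_simps)
    also have "\<dots> \<le> (x ^ Suc a * (x + y) ^ Suc b + y ^ Suc b * (x + y) ^ Suc a) +
        (x ^ Suc a * (x + y) ^ Suc b + y ^ Suc b * (x + y) ^ Suc a)"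
    proof (intro asub_plus_mono asub_mult_mono order.refl)
      show "x * (x + y) ^ a \<le> (x + y) ^ Suc a" "y * (x + y) ^ b \<le> (x + y) ^ Suc b"
        by (simp_all add: asub_mult_mono)
    qed
    also have "\<dots> = x ^ Suc a * (x + y) ^ Suc b + y ^ Suc b * (x + y) ^ Suc a"
      by (rule asub_plus_idem)
    finally show ?case .
  qed
qed

text \<open>Pigeonhole for several summands: among \<open>card I * p\<close> factors some index
  occurs \<open>p\<close> times. When the \<open>f i\<close> have one generator each, this is how
  \<open>p\<close>-th powers of generators arise.\<close>

lemma asub_sum_power_le:
  fixes f :: "'i \<Rightarrow> 'a::comm_ring_1 asub"
  assumes "finite I" "I \<noteq> {}"
  shows "sum f I ^ (card I * p) \<le> (\<Sum>i\<in>I. f i ^ p * sum f I ^ ((card I - 1) * p))"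
  using assms
proof (induction I rule: finite_ne_induct)
  case (insert i I)
  let ?S = "f i + sum f I" and ?k = "card I"
  have "sum f (insert i I) ^ (card (insert i I) * p) = ?S ^ (p + ?k * p)"
    using insert by simp
  also have "\<dots> \<le> f i ^ p * ?S ^ (?k * p) + sum f I ^ (?k * p) * ?S ^ p"
    by (rule asub_power_add_le)
  also have "\<dots> \<le> f i ^ p * ?S ^ (?k * p) + (\<Sum>j\<in>I. f j ^ p * sum f I ^ ((?k - 1) * p)) * ?S ^ p"
    by (intro asub_plus_mono asub_mult_mono order.refl insert.IH)
  also have "(\<Sum>j\<in>I. f j ^ p * sum f I ^ ((?k - 1) * p)) * ?S ^ p
      \<le> (\<Sum>j\<in>I. f j ^ p * ?S ^ (?k * p))"
    unfolding sum_distrib_right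
  proof (rule asub_sum_mono)
    fix j assume "j \<in> I"
    have k: "?k * p = (?k - 1) * p + p"
      using insert by (cases "?k") (auto simp: card_gt_0_iff)
    have "f j ^ p * sum f I ^ ((?k - 1) * p) * ?S ^ p \<le> f j ^ p * ?S ^ ((?k - 1) * p) * ?S ^ p"
      by (intro asub_mult_mono order.refl asub_power_mono) simp
    then show "f j ^ p * sum f I ^ ((?k - 1) * p) * ?S ^ p \<le> f j ^ p * ?S ^ (?k * p)"
      by (subst k) (simp add: power_add mult.assoc)
  qed
  finally show ?case using insert by (simp add: asub_plus_mono)
qed simp

text \<open>In a mixed product of powers of \<open>y\<close> and of its inverse \<open>z\<close> the
  smaller exponent cancels, which leaves a power of only one of them. This makes the module in
  \<open>max_non_integ_dichotomy\<close> stable.\<close>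

lemma asub_laurent_power_le:
  fixes y z :: "'a::comm_ring_1 asub"
  assumes "y * z = 1"
  shows "(1 + y) ^ N * (1 + z) ^ N \<le> (1 + y) ^ N + (1 + z) ^ N"
proof -
  have aux: "z * (1 + y) ^ N \<le> z + (1 + y) ^ N" if yz: "y * z = 1" for y z :: "'a asub" and N
  proof (induction N)
    case (Suc N)
    have "z * (1 + y) ^ Suc N = (z * (1 + y) ^ N) * (1 + y)" by (simp add: mult_ac)
    also have "\<dots> \<le> (z + (1 + y) ^ N) * (1 + y)"
      by (intro asub_mult_mono Suc.IH order.refl)
    also have "\<dots> = z + 1 + (1 + y) ^ Suc N"
      using yz by (simp add: algebra_simps)
    also have "\<dots> \<le> z + (1 + y) ^ Suc N"
      using asub_one_le_power[of "1 + y" "Suc N"]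
      by (auto simp: plus_le_iff simp del: power_Suc intro: asub_le_plusI2)
    finally show ?case .
  qed simp
  show ?thesis
  proof (induction N)
    case (Suc N)
    have e: "(1 + y) * (1 + z) = 1 + y + z"
      using assms by (simp add: algebra_simps) (metis add.assoc add.commute asub_plus_idem)
    have "(1 + y) ^ Suc N * (1 + z) ^ Suc N = ((1 + y) ^ N * (1 + z) ^ N) * ((1 + y) * (1 + z))"
      by (simp add: mult_ac)
    also have "\<dots> \<le> ((1 + y) ^ N + (1 + z) ^ N) * (1 + y + z)"
      unfolding e by (intro asub_mult_mono Suc.IH order.refl)
    also have "\<dots> = ((1 + y) ^ Suc N + (1 + z) ^ Suc N) + (z * (1 + y) ^ N + y * (1 + z) ^ N)"
      by (simp add: algebra_simps)
    also have "\<dots> \<le> (1 + y) ^ Suc N + (1 + z) ^ Suc N"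
    proof -
      have *: "y \<le> (1 + y) ^ Suc N" for y :: "'a asub"
        using order.trans[OF asub_le_plus(2) asub_power_increasing[of "1 + y" 1 "Suc N", simplified]]
        by simp
      have **: "(1 + y) ^ N \<le> (1 + y) ^ Suc N" for y :: "'a asub"
        by (rule asub_power_increasing) auto
      have "z * (1 + y) ^ N \<le> (1 + z) ^ Suc N + (1 + y) ^ Suc N"
        by (rule order.trans[OF aux[OF assms] asub_plus_mono[OF * **]])
      moreover have "y * (1 + z) ^ N \<le> (1 + y) ^ Suc N + (1 + z) ^ Suc N"
        by (rule order.trans[OF aux asub_plus_mono[OF * **]]) (use assms in \<open>simp add: mult.commute\<close>)
      ultimately show ?thesis by (simp add: plus_le_iff add.commute)
    qed
    finally show ?case .
  qed simp
qed

text \<open>Each use of \<open>red\<close> trades a factor \<open>V\<close> for \<open>T\<close> or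
  a factor \<open>W\<close> for \<open>B\<close>, and it applies as long as the exponents exceed
  \<open>r\<close> and \<open>s\<close>. So it stops only when \<open>T\<close> has been extracted
  \<open>l\<close> times or \<open>B\<close> has been extracted \<open>k\<close> times; extracted
  factors of the other kind are returned to \<open>V\<close> or \<open>W\<close>.\<close>

lemma asub_joint_reduction_power:
  fixes W V T B :: "'a::comm_ring_1 asub"
  assumes red: "W ^ Suc r * V ^ Suc s \<le> T * (W ^ Suc r * V ^ s) + B * (W ^ r * V ^ Suc s)"
    and TV: "T \<le> V" and BW: "B \<le> W"
  shows "W ^ (r + k) * V ^ (s + l) \<le> T ^ l * (W ^ (r + k) * V ^ s) + B ^ k * (W ^ r * V ^ (s + l))"
proof -
  have red': "W ^ (r + Suc k) * V ^ (s + Suc l)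
      \<le> T * (W ^ (r + Suc k) * V ^ (s + l)) + B * (W ^ (r + k) * V ^ (s + Suc l))" for k l
  proof -
    have "W ^ (r + Suc k) * V ^ (s + Suc l) = (W ^ k * V ^ l) * (W ^ Suc r * V ^ Suc s)"
      by (simp add: power_add algebra_simps)
    also have "\<dots> \<le> (W ^ k * V ^ l) * (T * (W ^ Suc r * V ^ s) + B * (W ^ r * V ^ Suc s))"
      by (intro asub_mult_mono order.refl red)
    finally show ?thesis by (simp add: power_add algebra_simps)
  qed
  show ?thesis
  proof (induction k arbitrary: l)
    case 0
    show ?case by (auto intro: asub_le_plusI2)
  next
    case (Suc k)
    show ?case
    proof (induction l)
      case 0
      show ?case by (auto intro: asub_le_plusI1)
    next
      case (Suc l)
      let ?R = "T ^ Suc l * (W ^ (r + Suc k) * V ^ s) + B ^ Suc k * (W ^ r * V ^ (s + Suc l))"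
      have "W ^ (r + Suc k) * V ^ (s + Suc l)
          \<le> T * (W ^ (r + Suc k) * V ^ (s + l)) + B * (W ^ (r + k) * V ^ (s + Suc l))"
        by (rule red')
      also have "\<dots> \<le> T * (T ^ l * (W ^ (r + Suc k) * V ^ s) + B ^ Suc k * (W ^ r * V ^ (s + l)))
          + B * (T ^ Suc l * (W ^ (r + k) * V ^ s) + B ^ k * (W ^ r * V ^ (s + Suc l)))"
        by (intro asub_plus_mono asub_mult_mono order.refl Suc.IH
            \<open>\<And>l. W ^ (r + k) * V ^ (s + l) \<le> T ^ l * (W ^ (r + k) * V ^ s) + B ^ k * (W ^ r * V ^ (s + l))\<close>)
      also have "\<dots> = T ^ Suc l * (W ^ (r + Suc k) * V ^ s) + B ^ Suc k * (W ^ r * (T * V ^ (s + l)))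
          + (T ^ Suc l * ((B * W ^ (r + k)) * V ^ s) + B ^ Suc k * (W ^ r * V ^ (s + Suc l)))"
        by (simp add: algebra_simps)
      also have "\<dots> \<le> ?R + ?R"
      proof (intro asub_plus_mono asub_mult_mono order.refl)
        show "T * V ^ (s + l) \<le> V ^ (s + Suc l)"
          using asub_mult_mono[OF TV order.refl, of "V ^ (s + l)"] by simp
        show "B * W ^ (r + k) \<le> W ^ (r + Suc k)"
          using asub_mult_mono[OF BW order.refl, of "W ^ (r + k)"] by simp
      qed
      finally show ?case by simp
    qed
  qed
qed

section \<open>Invertible primes in finitely generated subrings of the complex numbers\<close>

definition subring_set :: "'a::comm_ring_1 set \<Rightarrow> bool"
  where "subring_set A \<longleftrightarrow> 1 \<in> A \<and> (\<forall>x\<in>A. \<forall>y\<in>A. x - y \<in> A \<and> x * y \<in> A)"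

lemma subring_setD:
  assumes "subring_set A"
  shows "1 \<in> A" "0 \<in> A"
    "x \<in> A \<Longrightarrow> y \<in> A \<Longrightarrow> x - y \<in> A" "x \<in> A \<Longrightarrow> - x \<in> A"
    "x \<in> A \<Longrightarrow> y \<in> A \<Longrightarrow> x + y \<in> A" "x \<in> A \<Longrightarrow> y \<in> A \<Longrightarrow> x * y \<in> A"
    "x \<in> A \<Longrightarrow> x ^ k \<in> A" "of_nat k \<in> A" "(\<And>i. i \<in> I \<Longrightarrow> h i \<in> A) \<Longrightarrow> sum h I \<in> A"
proof -
  show 1: "1 \<in> A" and d: "x \<in> A \<Longrightarrow> y \<in> A \<Longrightarrow> x - y \<in> A"
    and m: "x \<in> A \<Longrightarrow> y \<in> A \<Longrightarrow> x * y \<in> A" for x y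
    using assms by (auto simp: subring_set_def)
  show 0: "0 \<in> A" using d[OF 1 1] by simp
  show u: "x \<in> A \<Longrightarrow> - x \<in> A" for x using d[OF 0, of x] by simp
  show a: "x \<in> A \<Longrightarrow> y \<in> A \<Longrightarrow> x + y \<in> A" for x y using d[of x "- y"] u[of y] by simp
  show "x \<in> A \<Longrightarrow> x ^ k \<in> A" by (induction k) (auto intro: 1 m)
  show "of_nat k \<in> A" by (induction k) (auto intro: 0 1 a)
  show "(\<And>i. i \<in> I \<Longrightarrow> h i \<in> A) \<Longrightarrow> sum h I \<in> A"
    by (induction I rule: infinite_finite_induct) (auto intro: 0 a)
qed

inductive_set ring_gen :: "'a::comm_ring_1 set \<Rightarrow> 'a set" for K where
  base: "x \<in> K \<Longrightarrow> x \<in> ring_gen K"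
| one: "1 \<in> ring_gen K"
| diff: "x \<in> ring_gen K \<Longrightarrow> y \<in> ring_gen K \<Longrightarrow> x - y \<in> ring_gen K"
| mult: "x \<in> ring_gen K \<Longrightarrow> y \<in> ring_gen K \<Longrightarrow> x * y \<in> ring_gen K"

lemma subring_ring_gen: "subring_set (ring_gen K)"
  by (auto simp: subring_set_def intro: ring_gen.intros)

lemma ring_gen_subset: "subring_set A \<Longrightarrow> K \<subseteq> A \<Longrightarrow> ring_gen K \<subseteq> A"
proof
  assume *: "subring_set A" "K \<subseteq> A"
  show "x \<in> A" if "x \<in> ring_gen K" for x
    using that by induction (use * in \<open>auto simp: subring_set_def\<close>)
qed

lemma ring_gen_mono: "K \<subseteq> K' \<Longrightarrow> ring_gen K \<subseteq> ring_gen K'"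
  by (rule ring_gen_subset) (auto intro: subring_ring_gen ring_gen.base)

definition poly_over :: "'a::comm_ring_1 set \<Rightarrow> 'a poly set"
  where "poly_over A = {f. \<forall>i. coeff f i \<in> A}"

lemma subring_poly_over: "subring_set A \<Longrightarrow> subring_set (poly_over A)"
  unfolding subring_set_def[of "poly_over A"]
  by (auto simp: poly_over_def coeff_mult coeff_1 subring_setD intro!: subring_setD(9))

lemma const_poly_over: "subring_set A \<Longrightarrow> a \<in> A \<Longrightarrow> [:a:] \<in> poly_over A"
  by (auto simp: poly_over_def coeff_pCons subring_setD split: nat.splits)

lemma monom_poly_over: "subring_set A \<Longrightarrow> a \<in> A \<Longrightarrow> monom a k \<in> poly_over A"
  by (auto simp: poly_over_def subring_setD)

lemma smult_poly_over: "subring_set A \<Longrightarrow> a \<in> A \<Longrightarrow> f \<in> poly_over A \<Longrightarrow> smult a f \<in> poly_over A"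
  by (auto simp: poly_over_def subring_setD)

text \<open>Multiplying by the leading coefficient of \<open>f\<close> before each cancellation
  avoids denominators, so that quotient and remainder keep their coefficients in
  \<open>A\<close>.\<close>

lemma pseudo_division:
  fixes f g :: "'a::idom poly"
  assumes A: "subring_set A" and f: "f \<in> poly_over A" "degree f > 0" and g: "g \<in> poly_over A"
  shows "\<exists>M q r. q \<in> poly_over A \<and> r \<in> poly_over A \<and>
    smult (lead_coeff f ^ M) g = f * q + r \<and> degree r < degree f"
  using g
proof (induction "degree g" arbitrary: g rule: less_induct)
  case less
  note PA = subring_setD[OF subring_poly_over[OF A]]
  have lf: "lead_coeff f \<in> A" and lg: "lead_coeff g \<in> A"
    using f less.prems by (auto simp: poly_over_def)
  show ?case
  proof (cases "degree g < degree f")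
    case True
    then show ?thesis
      using less.prems PA(2) by (intro exI[of _ 0] exI[of _ "0 :: 'a poly"] exI[of _ g]) auto
  next
    case False
    define m where "m = monom (lead_coeff g) (degree g - degree f)"
    define g' where "g' = smult (lead_coeff f) g - m * f"
    have m: "m \<in> poly_over A" unfolding m_def by (rule monom_poly_over[OF A lg])
    have g': "g' \<in> poly_over A"
      unfolding g'_def by (intro PA(3) PA(6) smult_poly_over[OF A lf] less.prems m f)
    have "degree g' < degree g"
    proof (rule degree_lessI)
      show "g' \<noteq> 0 \<or> 0 < degree g" using False f by auto
      show "\<forall>k\<ge>degree g. coeff g' k = 0"
      proof (intro allI impI)
        fix k assume k: "k \<ge> degree g"
        show "coeff g' k = 0"
        proof (cases "k = degree g")
          case True
          then show ?thesis using False
            by (simp add: g'_def m_def coeff_monom_mult mult.commute[of "lead_coeff f" "lead_coeff g"])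
        next
          case g: False
          then have "degree f < k - (degree g - degree f)" using k False by linarith
          then show ?thesis using g k
            by (simp add: g'_def m_def coeff_monom_mult coeff_eq_0)
        qed
      qed
    qed
    from less.hyps[OF this g'] obtain M q r where *: "q \<in> poly_over A" "r \<in> poly_over A"
      "smult (lead_coeff f ^ M) g' = f * q + r" "degree r < degree f" by blast
    have "smult (lead_coeff f ^ Suc M) g = smult (lead_coeff f ^ M) g' + f * smult (lead_coeff f ^ M) m"
      by (simp add: g'_def smult_diff_right mult.commute)
    also have "\<dots> = f * (q + smult (lead_coeff f ^ M) m) + r"
      by (simp add: *(3) algebra_simps)
    finally show ?thesis
      using * m by (intro exI[of _ "Suc M"] exI[of _ "q + smult (lead_coeff f ^ M) m"] exI[of _ r])
        (auto intro!: PA(5) smult_poly_over[OF A] subring_setD(7)[OF A] lf)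
  qed
qed

text \<open>For \<open>s = 1\<close> these are the primes invertible in \<open>A\<close>, in general
  those that become invertible together with \<open>s\<close>. The parameter \<open>s\<close>
  carries the induction over the generators: adjoining an algebraic element introduces a leading
  coefficient as a denominator.\<close>

definition primes_dividing :: "complex set \<Rightarrow> complex \<Rightarrow> nat set"
  where "primes_dividing A s = {p. prime p \<and> (\<exists>g\<in>A. \<exists>k. of_nat p * g = s ^ k)}"

text \<open>If \<open>x\<close> is transcendental over \<open>A\<close>, leading coefficients carry
  an identity \<open>p g = s ^ k\<close> back to \<open>A\<close>. If it is algebraic, some nonzero
  multiple \<open>a\<close> of \<open>s\<close> lies in \<open>A\<close>, and division by a
  polynomial \<open>f\<close> of least degree vanishing at \<open>x\<close> carries the identity
  back with \<open>s\<close> replaced by \<open>a\<close> times the leading coefficient of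
  \<open>f\<close>.\<close>

lemma finite_primes_dividing_adjoin:
  assumes A: "subring_set A" and fin: "\<And>s. s \<in> A \<Longrightarrow> s \<noteq> 0 \<Longrightarrow> finite (primes_dividing A s)"
    and s: "s \<in> (\<lambda>f. poly f x) ` poly_over A" "s \<noteq> 0"
  shows "finite (primes_dividing ((\<lambda>f. poly f x) ` poly_over A) s)"
proof -
  note PA = subring_setD[OF subring_poly_over[OF A]]
  obtain \<sigma> where \<sigma>: "\<sigma> \<in> poly_over A" "s = poly \<sigma> x" using s by blast
  show ?thesis
  proof (cases "\<exists>f\<in>poly_over A. f \<noteq> 0 \<and> poly f x = 0")
    case False
    have "primes_dividing ((\<lambda>f. poly f x) ` poly_over A) s \<subseteq> primes_dividing A (lead_coeff \<sigma>)"
    proof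
      fix p assume "p \<in> primes_dividing ((\<lambda>f. poly f x) ` poly_over A) s"
      then obtain g k where g: "prime p" "g \<in> poly_over A" "of_nat p * poly g x = s ^ k"
        by (auto simp: primes_dividing_def)
      have "poly (smult (of_nat p) g - \<sigma> ^ k) x = 0"
        using g \<sigma> by simp
      moreover have "smult (of_nat p) g - \<sigma> ^ k \<in> poly_over A"
        by (intro PA smult_poly_over[OF A] g \<sigma> subring_setD(8)[OF A])
      ultimately have "smult (of_nat p) g = \<sigma> ^ k" using False by auto
      then have "of_nat p * coeff g (degree (\<sigma> ^ k)) = lead_coeff (\<sigma> ^ k)"
        by (metis coeff_smult)
      then have "of_nat p * coeff g (degree (\<sigma> ^ k)) = lead_coeff \<sigma> ^ k"
        by (simp add: lead_coeff_power)
      with g show "p \<in> primes_dividing A (lead_coeff \<sigma>)"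
        by (auto simp: primes_dividing_def poly_over_def)
    qed
    moreover have "lead_coeff \<sigma> \<in> A" "lead_coeff \<sigma> \<noteq> 0"
      using \<sigma> s by (auto simp: poly_over_def)
    ultimately show ?thesis using fin finite_subset by blast
  next
    case True
    define S where "S = {f \<in> poly_over A. f \<noteq> 0 \<and> poly f x = 0}"
    define f where "f = arg_min degree (\<lambda>f. f \<in> S)"
    have f: "f \<in> S" and f_min: "\<And>g. g \<in> S \<Longrightarrow> degree f \<le> degree g"
      using True arg_min_nat_lemma[of "\<lambda>f. f \<in> S" _ degree] by (auto simp: f_def S_def)
    have small: "g = 0" if "g \<in> poly_over A" "poly g x = 0" "degree g < degree f" for g
      using that f_min[of g] by (auto simp: S_def not_le)
    have degf: "degree f > 0"
      using f by (auto simp: S_def intro!: gr0I elim!: degree_eq_zeroE)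
    \<comment> \<open>Polynomials whose value at \<open>x\<close> is a nonzero multiple of
      \<open>s\<close>. One of least degree turns out to be constant and yields the multiple
      \<open>a\<close> of \<open>s\<close> in \<open>A\<close>; this takes the place of a
      norm.\<close>
    define T where "T = {g \<in> poly_over A. poly g x \<noteq> 0 \<and> (\<exists>h\<in>poly_over A. poly g x = s * poly h x)}"
    define g where "g = arg_min degree (\<lambda>f. f \<in> T)"
    have "\<sigma> \<in> T" using \<sigma> s PA(1) by (auto simp: T_def intro!: bexI[of _ 1])
    then have g: "g \<in> T" and g_min: "\<And>h. h \<in> T \<Longrightarrow> degree g \<le> degree h"
      using arg_min_nat_lemma[of "\<lambda>f. f \<in> T" _ degree] by (auto simp: g_def)
    obtain h where h: "h \<in> poly_over A" "poly g x = s * poly h x" using g by (auto simp: T_def)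
    have "degree g = 0"
    proof (rule ccontr)
      assume dg: "degree g \<noteq> 0"
      have gA: "g \<in> poly_over A" and gx: "poly g x \<noteq> 0" using g by (auto simp: T_def)
      have fA: "f \<in> poly_over A" "f \<noteq> 0" "poly f x = 0" using f by (auto simp: S_def)
      have less: "degree g < degree f"
      proof (rule ccontr)
        assume "\<not> degree g < degree f"
        obtain M q r where *: "q \<in> poly_over A" "r \<in> poly_over A"
          "smult (lead_coeff f ^ M) g = f * q + r" "degree r < degree f"
          using pseudo_division[OF A fA(1) degf gA] by blast
        have "lead_coeff f ^ M \<in> A" using fA A by (auto simp: poly_over_def intro: subring_setD)
        then have "r \<in> T"
          using arg_cong[OF *(3), of "\<lambda>u. poly u x"] gx fA *(2) h
            smult_poly_over[OF A _ h(1), of "lead_coeff f ^ M"]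
          by (auto simp: T_def mult_ac intro!: bexI[of _ "smult (lead_coeff f ^ M) h"])
        then show False using g_min[of r] *(4) \<open>\<not> degree g < degree f\<close> by linarith
      qed
      obtain M q r where *: "q \<in> poly_over A" "r \<in> poly_over A"
        "smult (lead_coeff g ^ M) f = g * q + r" "degree r < degree g"
        using pseudo_division[OF A gA _ fA(1)] dg by blast
      have rx: "poly r x = - (poly g x * poly q x)"
        using arg_cong[OF *(3), of "\<lambda>u. poly u x"] fA by (simp add: eq_neg_iff_add_eq_0 add.commute)
      \<comment> \<open>A nonzero value would put the remainder into \<open>T\<close> below the
        minimal degree. So \<open>x\<close> is a root of \<open>r\<close> and of \<open>q\<close>,
        both of degree below that of \<open>f\<close>, and both have to vanish.\<close>
      have "poly r x = 0"
      proof (rule ccontr)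
        assume "poly r x \<noteq> 0"
        then have "r \<in> T" using rx * h
          by (auto simp: T_def intro!: bexI[of _ "- (h * q)"] PA)
        then show False using g_min[of r] *(4) by linarith
      qed
      then have q0: "poly q x = 0" using rx gx by simp
      have "r = 0" using small[OF *(2) \<open>poly r x = 0\<close>] *(4) less by linarith
      then have gq: "smult (lead_coeff g ^ M) f = g * q" using *(3) by simp
      have "g \<noteq> 0" using gx by auto
      then have "g * q \<noteq> 0" using gq fA(2) by (metis leading_coeff_0_iff power_not_zero smult_eq_0_iff)
      then have "q \<noteq> 0" by auto
      have "degree f = degree g + degree q"
        using arg_cong[OF gq, of degree] \<open>g \<noteq> 0\<close> \<open>q \<noteq> 0\<close> by (simp add: degree_mult_eq)
      then show False using small[OF *(1) q0] \<open>q \<noteq> 0\<close> dg by linarith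
    qed
    then obtain a where a: "g = [:a:]" by (auto elim: degree_eq_zeroE)
    have aA: "a \<in> A" "a \<noteq> 0" "a = s * poly h x"
      using g h a by (auto simp: T_def poly_over_def coeff_pCons split: nat.splits)
    let ?l = "lead_coeff f"
    have l: "?l \<in> A" "?l \<noteq> 0" using f by (auto simp: S_def poly_over_def)
    have "primes_dividing ((\<lambda>f. poly f x) ` poly_over A) s \<subseteq> primes_dividing A (?l * a)"
    proof
      fix p assume "p \<in> primes_dividing ((\<lambda>f. poly f x) ` poly_over A) s"
      then obtain u k where u: "prime p" "u \<in> poly_over A" "of_nat p * poly u x = s ^ k"
        by (auto simp: primes_dividing_def)
      have uh: "u * h ^ k \<in> poly_over A" by (intro PA u h)
      have fA: "f \<in> poly_over A" "poly f x = 0" using f by (auto simp: S_def)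
      obtain M q r where *: "q \<in> poly_over A" "r \<in> poly_over A"
        "smult (?l ^ M) (u * h ^ k) = f * q + r" "degree r < degree f"
        using pseudo_division[OF A fA(1) degf uh] by blast
      have "a ^ k = of_nat p * poly (u * h ^ k) x"
        by (simp add: aA(3) power_mult_distrib u(3)[symmetric] mult.assoc)
      then have "?l ^ M * a ^ k = of_nat p * poly r x"
        using arg_cong[OF *(3), of "\<lambda>u. poly u x"] fA by (simp add: mult_ac)
      \<comment> \<open>A polynomial that vanishes at \<open>x\<close> and has degree below that of
        \<open>f\<close> is zero, so constant coefficients can be compared inside
        \<open>A\<close>.\<close>
      then have "poly (smult (of_nat p) r - [:?l ^ M * a ^ k:]) x = 0" by simp
      moreover have "smult (of_nat p) r - [:?l ^ M * a ^ k:] \<in> poly_over A"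
        by (intro PA(3) smult_poly_over[OF A] const_poly_over[OF A] *(2) subring_setD[OF A] l aA)
      moreover have "degree (smult (of_nat p) r - [:?l ^ M * a ^ k:]) < degree f"
        using *(4) degf by (intro degree_diff_less) auto
      ultimately have "smult (of_nat p) r - [:?l ^ M * a ^ k:] = 0" using small by blast
      then have "coeff (smult (of_nat p) r - [:?l ^ M * a ^ k:]) 0 = 0" by simp
      then have e: "of_nat p * coeff r 0 = ?l ^ M * a ^ k" by simp
      have "of_nat p * (coeff r 0 * ?l ^ k * a ^ M) = (?l * a) ^ (M + k)"
        using e by (simp add: power_add power_mult_distrib mult_ac)
      moreover have "coeff r 0 * ?l ^ k * a ^ M \<in> A"
        using *(2) l aA by (intro subring_setD[OF A]) (auto simp: poly_over_def)
      ultimately show "p \<in> primes_dividing A (?l * a)"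
        using u(1) by (auto simp: primes_dividing_def)
    qed
    moreover have "finite (primes_dividing A (?l * a))"
      using l aA by (intro fin subring_setD[OF A]) auto
    ultimately show ?thesis using finite_subset by blast
  qed
qed

lemma subring_adjoin:
  assumes A: "subring_set A"
  shows "subring_set ((\<lambda>f. poly f x) ` poly_over A)"
proof -
  note PA = subring_setD[OF subring_poly_over[OF A]]
  have "poly f x - poly g x \<in> (\<lambda>f. poly f x) ` poly_over A"
    "poly f x * poly g x \<in> (\<lambda>f. poly f x) ` poly_over A" if "f \<in> poly_over A" "g \<in> poly_over A" for f g
    using rev_image_eqI[OF PA(3)[OF that], of "poly f x - poly g x" "\<lambda>f. poly f x"]
      rev_image_eqI[OF PA(6)[OF that], of "poly f x * poly g x" "\<lambda>f. poly f x"] by simp_all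
  moreover have "1 \<in> (\<lambda>f. poly f x) ` poly_over A"
    by (rule rev_image_eqI[OF PA(1)]) simp
  ultimately show ?thesis unfolding subring_set_def by blast
qed

lemma finite_primes_dividing_ring_gen:
  assumes "finite K" "s \<in> ring_gen K" "s \<noteq> 0"
  shows "finite (primes_dividing (ring_gen K) s)"
  using assms
proof (induction K arbitrary: s rule: finite_induct)
  case empty
  have Z: "ring_gen {} \<subseteq> (\<int> :: complex set)"
    by (rule ring_gen_subset) (auto simp: subring_set_def)
  then obtain z where z: "s = of_int z" using empty by (auto elim!: Ints_cases)
  have "primes_dividing (ring_gen {}) s \<subseteq> {p. int p dvd z}"
  proof
    fix p assume "p \<in> primes_dividing (ring_gen {}) s"
    then obtain g k where g: "prime p" "g \<in> ring_gen {}" "of_nat p * g = s ^ k"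
      by (auto simp: primes_dividing_def)
    then obtain w where "g = of_int w" using Z by (auto elim!: Ints_cases)
    then have "of_int (int p * w) = (of_int (z ^ k) :: complex)" using g z by simp
    then have "int p * w = z ^ k" by (simp only: of_int_eq_iff)
    then have "int p dvd z ^ k" by (metis dvd_triv_left)
    then show "p \<in> {p. int p dvd z}" using g(1) prime_dvd_power[of "int p" z k] by simp
  qed
  moreover have "finite {p. int p dvd z}"
  proof -
    have "z \<noteq> 0" using empty z by auto
    then have "{p. int p dvd z} \<subseteq> {.. nat \<bar>z\<bar>}" by (auto dest: zdvd_imp_le simp: dvd_imp_le_int zdvd_not_zless)
        (metis abs_of_nat dvd_imp_le_int nat_int nat_mono)
    then show ?thesis using finite_subset by blast
  qed
  ultimately show ?case using finite_subset by blast
next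
  case (insert x K)
  let ?B = "(\<lambda>f. poly f x) ` poly_over (ring_gen K)"
  have "ring_gen (insert x K) \<subseteq> ?B"
  proof (rule ring_gen_subset[OF subring_adjoin[OF subring_ring_gen]])
    have "x \<in> ?B"
      by (rule rev_image_eqI[OF monom_poly_over[OF subring_ring_gen ring_gen.one, of 1]]) (simp add: poly_monom)
    moreover have "y \<in> ?B" if "y \<in> K" for y
      by (rule rev_image_eqI[OF const_poly_over[OF subring_ring_gen ring_gen.base[OF that]]]) simp
    ultimately show "insert x K \<subseteq> ?B" by blast
  qed
  moreover have "finite (primes_dividing ?B s)"
    using insert calculation by (intro finite_primes_dividing_adjoin subring_ring_gen) auto
  moreover have "primes_dividing (ring_gen (insert x K)) s \<subseteq> primes_dividing ?B s"
    unfolding primes_dividing_def using calculation(1) by blast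
  ultimately show ?case using finite_subset by blast
qed

text \<open>Reduction modulo \<open>p\<close> is only informative where \<open>1\<close> is not a
  multiple of \<open>p\<close>; in a finitely generated ring this excludes finitely many primes, so
  \<open>p\<close> may also be taken as large as desired.\<close>

lemma ring_gen_noninvertible_prime:
  assumes "finite K"
  obtains p where "prime p" "p > N" "\<And>a. a \<in> ring_gen K \<Longrightarrow> of_nat p * a \<noteq> (1::complex)"
proof -
  have "finite (primes_dividing (ring_gen K) 1)"
    by (rule finite_primes_dividing_ring_gen[OF assms]) (auto intro: ring_gen.one)
  then have "\<not> {p. prime p} \<subseteq> primes_dividing (ring_gen K) 1 \<union> {..N}"
    using primes_infinite finite_subset[of "{p. prime p}"] by blast
  then obtain p where p: "prime p" "p \<notin> primes_dividing (ring_gen K) 1 \<union> {..N}" by blast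
  from p have "of_nat p * a \<noteq> 1" if "a \<in> ring_gen K" for a
    using that by (auto simp: primes_dividing_def)
  then show ?thesis using p that[of p] by auto
qed

section \<open>Finitely generated subgroups and scalars\<close>

definition fg :: "'a::comm_ring_1 asub \<Rightarrow> bool"
  where "fg X \<longleftrightarrow> (\<exists>Y. finite Y \<and> X = gen Y)"

lemma fg_gen: "finite Y \<Longrightarrow> fg (gen Y)"
  by (auto simp: fg_def)

lemma fg_0: "fg 0" and fg_1: "fg 1"
  by (auto simp: zero_asub_def one_asub_def intro: fg_gen)

lemma fg_add: "fg X \<Longrightarrow> fg Y \<Longrightarrow> fg (X + Y)"
  by (auto simp: fg_def gen_Un[symmetric])

lemma fg_mult: "fg X \<Longrightarrow> fg Y \<Longrightarrow> fg (X * Y)"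
  unfolding fg_def
proof (elim exE conjE)
  fix A B assume "finite A" "X = gen A" "finite B" "Y = gen B"
  moreover have "{x * y |x y. x \<in> A \<and> y \<in> B} = (\<lambda>(x, y). x * y) ` (A \<times> B)" by auto
  ultimately show "\<exists>C. finite C \<and> X * Y = gen C"
    by (intro exI[of _ "{x * y |x y. x \<in> A \<and> y \<in> B}"]) (auto simp: gen_times_gen)
qed

lemma fg_power: "fg X \<Longrightarrow> fg (X ^ n)"
  by (induction n) (auto intro: fg_1 fg_mult)

lemma fg_sum: "(\<And>i. i \<in> I \<Longrightarrow> fg (X i)) \<Longrightarrow> fg (sum X I)"
  by (induction I rule: infinite_finite_induct) (auto intro: fg_0 fg_add)

lemma fg_prod: "(\<And>i. i \<in> I \<Longrightarrow> fg (X i)) \<Longrightarrow> fg (prod X I)"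
  by (induction I rule: infinite_finite_induct) (auto intro: fg_1 fg_mult)

text \<open>Two instances are used: constants in Laurent polynomials, and constants in polynomials
  over these. With \<open>sca A\<close> as a factor, an \<open>A\<close>-submodule is a product of
  subgroups, and a change of the ring of constants is monotonicity in that factor.\<close>

locale scalars =
  fixes s :: "complex \<Rightarrow> 'a::comm_ring_1"
  assumes s_diff: "s (x - y) = s x - s y"
    and s_mult: "s (x * y) = s x * s y"
    and s_1: "s 1 = 1"
begin

definition sca :: "complex set \<Rightarrow> 'a asub"
  where "sca A = gen (s ` A)"

lemma sca_mono: "A \<subseteq> B \<Longrightarrow> sca A \<le> sca B"
  unfolding sca_def by (intro gen_mono) auto

lemma s_in_sca: "c \<in> A \<Longrightarrow> s c \<in> els (sca A)"
  by (auto simp: sca_def intro: gen_base)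

lemma one_le_sca: "1 \<in> A \<Longrightarrow> 1 \<le> sca A"
  using s_in_sca[of 1 A] by (simp add: one_le_iff s_1)

lemma sca_mult: "subring_set A \<Longrightarrow> sca A * sca A = sca A"
proof (rule order.antisym)
  assume A: "subring_set A"
  show "sca A * sca A \<le> sca A"
    unfolding sca_def gen_times_gen
    by (rule gen_mono) (auto simp: s_mult[symmetric] intro: subring_setD(6)[OF A])
  show "sca A \<le> sca A * sca A"
    by (rule asub_le_mult_one[OF one_le_sca[OF subring_setD(1)[OF A]]])
qed

lemma sca_power: "subring_set A \<Longrightarrow> n > 0 \<Longrightarrow> sca A ^ n = sca A"
proof (induction n)
  case (Suc n)
  then show ?case by (cases n) (simp_all add: sca_mult)
qed simp

lemma mem_sca_descent:
  assumes "x \<in> els (sca UNIV * Z)"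
  shows "\<exists>K. finite K \<and> x \<in> els (sca (ring_gen K) * Z)"
proof -
  have "sca UNIV * Z = gen {a * z |a z. a \<in> range s \<and> z \<in> els Z}"
    unfolding sca_def by (subst gen_els[symmetric, of Z]) (simp only: gen_times_gen)
  then have "x \<in> add_span {a * z |a z. a \<in> range s \<and> z \<in> els Z}"
    using assms by (simp add: els_gen)
  then show ?thesis
  proof induction
    case (base x)
    then obtain c z where "x = s c * z" "z \<in> els Z" by auto
    then show ?case
      by (intro exI[of _ "{c}"]) (auto intro!: mult_els s_in_sca ring_gen.base)
  next
    case zero
    then show ?case by (intro exI[of _ "{}"]) auto
  next
    case (diff x y)
    then obtain K K' where *: "finite K" "x \<in> els (sca (ring_gen K) * Z)"
      "finite K'" "y \<in> els (sca (ring_gen K') * Z)" by blast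
    have "sca (ring_gen K) * Z \<le> sca (ring_gen (K \<union> K')) * Z"
      "sca (ring_gen K') * Z \<le> sca (ring_gen (K \<union> K')) * Z"
      by (intro asub_mult_mono order.refl sca_mono ring_gen_mono; auto)+
    with * have "x - y \<in> els (sca (ring_gen (K \<union> K')) * Z)"
      by (intro diff_els) (auto dest: leD_els)
    with * show ?case by (intro exI[of _ "K \<union> K'"]) auto
  qed
qed

text \<open>Finitely many generators involve finitely many scalars. Every inclusion found over the
  complex numbers is transferred to a finitely generated ring of constants in this way.\<close>

lemma fg_sca_descent:
  assumes "fg X" "X \<le> sca UNIV * Z"
  shows "\<exists>K. finite K \<and> X \<le> sca (ring_gen K) * Z"
proof -
  obtain Y where Y: "finite Y" "X = gen Y" using assms by (auto simp: fg_def)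
  then have "\<forall>y\<in>Y. \<exists>K. finite K \<and> y \<in> els (sca (ring_gen K) * Z)"
    using assms by (auto simp: gen_le_iff intro!: mem_sca_descent)
  then obtain K where K: "\<And>y. y \<in> Y \<Longrightarrow> finite (K y) \<and> y \<in> els (sca (ring_gen (K y)) * Z)"
    by metis
  have "sca (ring_gen (K y)) * Z \<le> sca (ring_gen (\<Union>(K ` Y))) * Z" if "y \<in> Y" for y
    using that by (intro asub_mult_mono order.refl sca_mono ring_gen_mono) auto
  with K have "X \<le> sca (ring_gen (\<Union>(K ` Y))) * Z"
    unfolding Y(2) gen_le_iff by (auto dest: leD_els)
  then show ?thesis using K Y by (intro exI[of _ "\<Union>(K ` Y)"]) auto
qed

lemma sca_descent_mono:
  assumes "X \<le> sca (ring_gen K) * Z" "K \<subseteq> K'"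
  shows "X \<le> sca (ring_gen K') * Z"
  by (rule order.trans[OF assms(1)]) (intro asub_mult_mono order.refl sca_mono ring_gen_mono assms(2))

end

section \<open>Laurent polynomials\<close>

abbreviation cst :: "complex \<Rightarrow> 'n::finite laurent_ring"
  where "cst c \<equiv> Poly_Mapping.single 0 c"

interpretation laurent: scalars "cst :: complex \<Rightarrow> 'n::finite laurent_ring"
  by standard (simp_all add: single_diff mult_single)

abbreviation "coef \<equiv> Poly_Mapping.lookup"

lemma poly_mapping_sum_single:
  fixes f :: "'a \<Rightarrow>\<^sub>0 'b::comm_monoid_add"
  assumes "finite K" "Poly_Mapping.keys f \<subseteq> K"
  shows "f = (\<Sum>a\<in>K. Poly_Mapping.single a (coef f a))"
proof (rule poly_mapping_eqI)
  fix k
  have "coef f k = 0" if "k \<notin> K" using that assms by (auto simp: in_keys_iff)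
  then show "coef f k = coef (\<Sum>a\<in>K. Poly_Mapping.single a (coef f a)) k"
    using assms(1) by (auto simp: lookup_sum lookup_single when_def)
qed

lemma cst_times_monom: "cst c * laurent_monom a = Poly_Mapping.single a c"
  by (simp add: laurent_monom_def mult_single)

lemma laurent_sum_monom:
  assumes "finite K" "Poly_Mapping.keys f \<subseteq> K"
  shows "f = (\<Sum>a\<in>K. cst (coef f a) * laurent_monom a)"
  using poly_mapping_sum_single[OF assms] by (simp add: cst_times_monom)

lemma coef_single_times:
  fixes f :: "('a::ab_group_add) \<Rightarrow>\<^sub>0 'b::comm_ring_1"
  shows "coef (Poly_Mapping.single a c * f) w = c * coef f (w - a)"
proof -
  have "Poly_Mapping.single a c * f
      = (\<Sum>b\<in>Poly_Mapping.keys f. Poly_Mapping.single (a + b) (c * coef f b))"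
    by (subst poly_mapping_sum_single[OF finite_keys order.refl, of f])
      (simp add: sum_distrib_left mult_single)
  moreover have "a + b = w \<longleftrightarrow> b = w - a" for b by (auto simp: algebra_simps)
  ultimately have "coef (Poly_Mapping.single a c * f) w
      = (\<Sum>b\<in>Poly_Mapping.keys f. if b = w - a then c * coef f b else 0)"
    by (simp add: lookup_sum lookup_single when_def)
  then show ?thesis by (simp add: in_keys_iff)
qed

lemma coef_cst_times: "coef (cst c * f) w = c * coef f w"
  by (simp add: coef_single_times)

lemma laurent_monom_0 [simp]: "laurent_monom 0 = 1"
  by (simp add: laurent_monom_def)

lemma laurent_monom_inverse: "laurent_monom a * laurent_monom (- a) = 1"
  by (simp add: laurent_monom_add[symmetric])

lemma laurent_monom_sum: "laurent_monom (\<Sum>i\<in>I. a i) = (\<Prod>i\<in>I. laurent_monom (a i))"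
  by (induction I rule: infinite_finite_induct) (simp_all add: laurent_monom_add)

lemma inj_int_vec: "inj int_vec"
  by (auto simp: inj_on_def int_vec_def vec_eq_iff)

lemma int_vec_eq_iff [simp]: "int_vec a = int_vec b \<longleftrightarrow> a = b"
  using inj_int_vec by (auto dest: injD)

text \<open>
  A pair of exponents maximizing the norm of the sum is the only pair with that sum, because
  the norm is strictly convex.
\<close>

lemma laurent_no_zero_divisors:
  fixes f g :: "'n::finite laurent_ring"
  assumes "f \<noteq> 0" "g \<noteq> 0"
  shows "f * g \<noteq> 0"
proof -
  let ?A = "Poly_Mapping.keys f" and ?B = "Poly_Mapping.keys g"
  let ?N = "\<lambda>(a, b). norm (int_vec (a + b) :: real ^ 'n)"
  have fin: "finite (?A \<times> ?B)" and ne: "?A \<times> ?B \<noteq> {}"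
    using assms by auto
  have "Max (?N ` (?A \<times> ?B)) \<in> ?N ` (?A \<times> ?B)"
    by (rule Max_in) (use fin ne in simp_all)
  then obtain p where p: "p \<in> ?A \<times> ?B" "?N p = Max (?N ` (?A \<times> ?B))" by force
  have p': "?N q \<le> ?N p" if "q \<in> ?A \<times> ?B" for q
    unfolding p(2) by (rule Max_ge) (use fin that in simp_all)
  obtain a b where ab: "p = (a, b)" by fastforce
  have uniq: "a' = a \<and> b' = b" if "a' \<in> ?A" "b' \<in> ?B" "a' + b' = a + b" for a' b'
  proof (rule ccontr)
    assume ne: "\<not> (a' = a \<and> b' = b)"
    define d :: "real ^ 'n" where "d = int_vec (a' - a)"
    define x :: "real ^ 'n" where "x = int_vec (a + b)"
    have b': "b' = b - (a' - a)" using that(3) by (simp add: algebra_simps)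
    have "a' \<noteq> a" using ne b' by auto
    then have "d \<noteq> 0" using int_vec_eq_iff[of "a' - a" 0] by (auto simp: d_def simp del: int_vec_eq_iff int_vec_simps(2,3,4))
    have 1: "norm (x + d) \<le> norm x"
      using p'[of "(a', b)"] that p(1) by (simp add: ab x_def d_def algebra_simps)
    have 2: "norm (x - d) \<le> norm x"
      using p'[of "(a, b')"] that p(1) by (simp add: ab x_def d_def b' algebra_simps)
    have "(norm (x + d))\<^sup>2 + (norm (x - d))\<^sup>2 = 2 * (norm x)\<^sup>2 + 2 * (norm d)\<^sup>2"
      by (simp add: power2_norm_eq_inner inner_diff inner_add inner_commute)
    moreover have "(norm (x + d))\<^sup>2 \<le> (norm x)\<^sup>2" "(norm (x - d))\<^sup>2 \<le> (norm x)\<^sup>2"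
      using 1 2 by (auto intro: power_mono)
    moreover have "(norm d)\<^sup>2 > 0" using \<open>d \<noteq> 0\<close> by simp
    ultimately show False by linarith
  qed
  have "coef (f * g) (a + b) = (\<Sum>a'\<in>?A. coef f a' * coef g (a + b - a'))"
    by (subst poly_mapping_sum_single[OF finite_keys order.refl, of f])
      (simp add: sum_distrib_right lookup_sum coef_single_times)
  also have "\<dots> = (\<Sum>a'\<in>?A. if a' = a then coef f a * coef g b else 0)"
  proof (rule sum.cong[OF refl])
    fix a' assume a': "a' \<in> ?A"
    show "coef f a' * coef g (a + b - a') = (if a' = a then coef f a * coef g b else 0)"
    proof (cases "a + b - a' \<in> ?B")
      case True
      have *: "a' = a \<and> a + b - a' = b" by (rule uniq[OF a' True]) simp
      show ?thesis unfolding conjunct2[OF *] using conjunct1[OF *] by simp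
    next
      case False
      then have 0: "coef g (a + b - a') = 0" by (simp only: in_keys_iff not_not)
      have "a + b - a \<in> ?B" using p(1) ab by simp
      then have "a' \<noteq> a" using False by blast
      then show ?thesis unfolding 0 by simp
    qed
  qed
  also have "\<dots> = coef f a * coef g b" using p(1) ab by simp
  also have "\<dots> \<noteq> 0" using p(1) ab by (auto simp: in_keys_iff)
  finally show ?thesis by auto
qed

lemma laurent_power_nonzero: "f \<noteq> 0 \<Longrightarrow> (f :: 'n::finite laurent_ring) ^ k \<noteq> 0"
  by (induction k) (simp_all add: laurent_no_zero_divisors)

lemma laurent_cancel:
  fixes b :: "'n::finite laurent_ring"
  assumes "b \<noteq> 0" "b * x = b * y"
  shows "x = y"
  using laurent_no_zero_divisors[of b "x - y"] assms by (auto simp: right_diff_distrib)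

lemma laurent_monom_nonzero [simp]: "laurent_monom a \<noteq> 0"
  by (metis laurent_monom_inverse mult_zero_left zero_neq_one)

definition mon :: "(int ^ 'n::finite) set \<Rightarrow> 'n laurent_ring asub"
  where "mon X = gen (laurent_monom ` X)"

lemma mon_times: "mon X * mon Y = mon {x + y |x y. x \<in> X \<and> y \<in> Y}"
  unfolding mon_def gen_times_gen
  by (rule arg_cong[of _ _ gen]) (auto simp: laurent_monom_add image_iff, (metis laurent_monom_add)+)

lemma mon_mono: "X \<subseteq> Y \<Longrightarrow> mon X \<le> mon Y"
  unfolding mon_def by (intro gen_mono) auto

lemma monom_in_mon: "a \<in> X \<Longrightarrow> laurent_monom a \<in> els (mon X)"
  unfolding mon_def by (intro gen_base) auto

lemma mon_singleton: "mon {a} = gen {laurent_monom a}"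
  by (simp add: mon_def)

lemma one_le_mon: "0 \<in> X \<Longrightarrow> 1 \<le> mon X"
  using monom_in_mon[of 0 X] by (simp add: one_le_iff)

lemma fg_mon: "finite X \<Longrightarrow> fg (mon X)"
  unfolding mon_def by (intro fg_gen) auto

text \<open>The way back from the semiring: supports and coefficients can be controlled at the same
  time.\<close>

lemma mem_sca_mon:
  fixes f :: "'n::finite laurent_ring"
  assumes "subring_set A"
  shows "f \<in> els (laurent.sca A * mon X) \<longleftrightarrow> Poly_Mapping.keys f \<subseteq> X \<and> (\<forall>a. coef f a \<in> A)"
proof
  assume *: "Poly_Mapping.keys f \<subseteq> X \<and> (\<forall>a. coef f a \<in> A)"
  have "(\<Sum>a\<in>Poly_Mapping.keys f. cst (coef f a) * laurent_monom a) \<in> els (laurent.sca A * mon X)"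
    using * by (intro sum_els mult_els laurent.s_in_sca monom_in_mon) auto
  then show "f \<in> els (laurent.sca A * mon X)"
    using laurent_sum_monom[OF finite_keys order.refl, of f] by simp
next
  let ?H = "{f :: 'n laurent_ring. Poly_Mapping.keys f \<subseteq> X \<and> (\<forall>a. coef f a \<in> A)}"
  have "els (Asub ?H) = ?H"
  proof (rule els_Asub)
    show "x - y \<in> ?H" if "x \<in> ?H" "y \<in> ?H" for x y
    proof -
      have "Poly_Mapping.keys (x - y) \<subseteq> Poly_Mapping.keys x \<union> Poly_Mapping.keys y"
        by (rule keys_diff)
      then show ?thesis using that subring_setD(3)[OF assms] by (auto simp: lookup_minus)
    qed
  qed (auto intro: subring_setD[OF assms])
  moreover have "laurent.sca A * mon X \<le> Asub ?H"
    unfolding laurent.sca_def mon_def gen_times_gen gen_le_iff calculation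
    using subring_setD(2)[OF assms]
    by (auto simp: cst_times_monom lookup_single when_def split: if_splits)
  ultimately show "Poly_Mapping.keys f \<subseteq> X \<and> (\<forall>a. coef f a \<in> A)"
    if "f \<in> els (laurent.sca A * mon X)" using that by (auto dest: leD_els)
qed

lemma subring_UNIV: "subring_set UNIV"
  by (simp add: subring_set_def)

lemma mem_sca_UNIV_mon: "f \<in> els (laurent.sca UNIV * mon X) \<longleftrightarrow> Poly_Mapping.keys f \<subseteq> X"
  by (simp add: mem_sca_mon[OF subring_UNIV])

section \<open>Linear algebra\<close>

text \<open>Gaussian elimination: an unknown that occurs in one equation is used to remove both the
  unknown and the equation.\<close>

lemma nontrivial_solution:
  fixes M :: "'i \<Rightarrow> 'k \<Rightarrow> 'a::field"
  assumes "finite K" "finite I" "card K < card I"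
  shows "\<exists>c. (\<exists>i\<in>I. c i \<noteq> 0) \<and> (\<forall>k\<in>K. (\<Sum>i\<in>I. c i * M i k) = 0)"
  using assms
proof (induction K arbitrary: I M rule: finite_induct)
  case empty
  then show ?case by (intro exI[of _ "\<lambda>_. 1"]) (auto simp: card_gt_0_iff)
next
  case (insert k K)
  show ?case
  proof (cases "\<forall>i\<in>I. M i k = 0")
    case True
    have "card K < card I" using insert by simp
    from insert.IH[OF insert.prems(1) this, of M] True show ?thesis by auto
  next
    case False
    then obtain j where j: "j \<in> I" "M j k \<noteq> 0" by blast
    define M' where "M' = (\<lambda>i l. M i l - M i k / M j k * M j l)"
    have "card K < card (I - {j})" using insert j by simp
    from insert.IH[OF _ this, of M'] insert.prems obtain c where
      c: "\<exists>i\<in>I - {j}. c i \<noteq> 0" "\<forall>l\<in>K. (\<Sum>i\<in>I - {j}. c i * M' i l) = 0" by auto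
    define d where "d = - (\<Sum>i\<in>I - {j}. c i * M i k / M j k)"
    have e: "(\<Sum>i\<in>I. (c(j := d)) i * M i l) = (\<Sum>i\<in>I - {j}. c i * M' i l)" for l
    proof -
      have "(\<Sum>i\<in>I. (c(j := d)) i * M i l) = d * M j l + (\<Sum>i\<in>I - {j}. c i * M i l)"
        using insert.prems j by (subst sum.remove[of I j]) (auto intro!: sum.cong)
      then show ?thesis
        by (simp add: d_def M'_def right_diff_distrib sum_subtractf sum_distrib_left sum_distrib_right mult_ac)
    qed
    show ?thesis
    proof (intro exI conjI ballI)
      show "\<exists>i\<in>I. (c(j := d)) i \<noteq> 0" using c(1) by auto
      show "(\<Sum>i\<in>I. (c(j := d)) i * M i l) = 0" if "l \<in> insert k K" for l
        unfolding e using that c(2) j(2) by (auto simp: M'_def)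
    qed
  qed
qed

lemma separating_functional:
  fixes H :: "'n::finite laurent_ring set"
  assumes "0 \<in> H" "\<And>x y. x \<in> H \<Longrightarrow> y \<in> H \<Longrightarrow> x + y \<in> H" "\<And>c x. x \<in> H \<Longrightarrow> cst c * x \<in> H"
    and "z \<notin> H"
  obtains L where "\<And>x y. L (x + y) = L x + L y" "\<And>c x. L (cst c * x) = c * L x"
    "\<And>x. x \<in> H \<Longrightarrow> L x = (0 :: complex)" "L z = 1"
proof -
  interpret V: vector_space "\<lambda>c (x :: 'n laurent_ring). cst c * x"
    by standard (simp_all add: algebra_simps single_add mult_single)
  interpret C: vector_space "(*) :: complex \<Rightarrow> complex \<Rightarrow> complex"
    by standard (simp_all add: algebra_simps)
  interpret P: vector_space_pair "\<lambda>c (x :: 'n laurent_ring). cst c * x" "(*) :: complex \<Rightarrow> complex \<Rightarrow> complex" ..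
  have H: "V.subspace H" using assms by (auto simp: V.subspace_def)
  obtain B where B: "B \<subseteq> H" "V.independent B" "H \<subseteq> V.span B"
    by (rule V.basis_exists[of H])
  have "V.span B \<subseteq> H" by (rule V.span_minimal[OF B(1) H])
  then have "V.independent (insert z B)"
    using B(1,2) assms(4) unfolding V.independent_insert by auto
  from P.linear_independent_extend[OF this, of "\<lambda>x. if x = z then 1 else 0"]
  obtain L where L: "Vector_Spaces.linear (\<lambda>c (x :: 'n laurent_ring). cst c * x) (*) L" "\<forall>x\<in>insert z B. L x = (if x = z then 1 else 0)"
    by blast
  interpret L: Vector_Spaces.linear "\<lambda>c (x :: 'n laurent_ring). cst c * x" "(*)" L by (rule L(1))
  have "L x = 0" if "x \<in> H" for x
  proof (rule P.linear_eq_0_on_span[OF L(1)])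
    show "x \<in> V.span B" using that B(3) by auto
    show "L y = 0" if "y \<in> B" for y using bspec[OF L(2), of y] that B(1) assms(4) by auto
  qed
  then show ?thesis
    using that[of L] bspec[OF L(2), of z] L.add L.scale by simp
qed

section \<open>The Frobenius map modulo a prime\<close>

text \<open>The error term is kept inside \<open>S\<close> because over the complex numbers every
  element is a multiple of \<open>p\<close>; only within a suitable subring does the congruence
  carry information.\<close>

lemma frobenius_add:
  fixes x y :: "'a::comm_ring_1"
  assumes S: "subring_set S" and p: "prime p" and xy: "x \<in> S" "y \<in> S"
  shows "\<exists>z\<in>S. (x + y) ^ p = x ^ p + y ^ p + of_nat p * z"
proof -
  have p0: "p > 0" using p prime_gt_0_nat by blast
  have "{..p} = insert 0 (insert p {0<..<p})" using p0 by auto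
  then have "(x + y) ^ p = x ^ p + y ^ p + (\<Sum>k\<in>{0<..<p}. of_nat (p choose k) * x ^ k * y ^ (p - k))"
    using p0 by (simp add: binomial_ring algebra_simps)
  also have "(\<Sum>k\<in>{0<..<p}. of_nat (p choose k) * x ^ k * y ^ (p - k))
      = of_nat p * (\<Sum>k\<in>{0<..<p}. of_nat ((p choose k) div p) * x ^ k * y ^ (p - k))"
    unfolding sum_distrib_left
  proof (rule sum.cong[OF refl])
    fix k assume "k \<in> {0<..<p}"
    then have "p dvd (p choose k)" using p by (intro dvd_choose_prime) auto
    then have "of_nat (p choose k) = (of_nat p * of_nat ((p choose k) div p) :: 'a)"
      by (simp add: of_nat_mult[symmetric] del: of_nat_mult)
    then show "of_nat (p choose k) * x ^ k * y ^ (p - k)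
        = of_nat p * (of_nat ((p choose k) div p) * x ^ k * y ^ (p - k))" by (simp add: mult.assoc)
  qed
  finally show ?thesis
    by (rule bexI) (intro subring_setD[OF S] xy)
qed

lemma frobenius_sum:
  fixes x :: "'i \<Rightarrow> 'a::comm_ring_1"
  assumes S: "subring_set S" and p: "prime p" and x: "\<And>i. i \<in> I \<Longrightarrow> x i \<in> S"
  shows "\<exists>z\<in>S. (\<Sum>i\<in>I. x i) ^ p = (\<Sum>i\<in>I. x i ^ p) + of_nat p * z"
  using x
proof (induction I rule: infinite_finite_induct)
  case (insert i I)
  then obtain z where z: "z \<in> S" "(\<Sum>i\<in>I. x i) ^ p = (\<Sum>i\<in>I. x i ^ p) + of_nat p * z" by auto
  obtain w where w: "w \<in> S" "(x i + sum x I) ^ p = x i ^ p + sum x I ^ p + of_nat p * w"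
    using frobenius_add[OF S p, of "x i" "sum x I"] insert.prems by (auto intro: subring_setD[OF S])
  show ?case using insert z w
    by (intro bexI[of _ "z + w"]) (auto simp: algebra_simps intro: subring_setD[OF S])
qed (use p prime_gt_0_nat[OF p] in \<open>auto simp: power_0_left intro: bexI[of _ 0] subring_setD(2)[OF S]\<close>)

section \<open>Lattice points of polytopes and cones\<close>

lemma convex_hull_int_vec:
  assumes "finite S"
  shows "x \<in> convex hull (int_vec ` S) \<longleftrightarrow>
    (\<exists>c. (\<forall>s\<in>S. 0 \<le> c s) \<and> sum c S = 1 \<and> x = (\<Sum>s\<in>S. c s *\<^sub>R int_vec s))"
proof
  assume "x \<in> convex hull (int_vec ` S)"
  then obtain u where u: "\<forall>y\<in>int_vec ` S. 0 \<le> u y" "sum u (int_vec ` S) = 1"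
    "(\<Sum>y\<in>int_vec ` S. u y *\<^sub>R y) = x"
    using assms by (auto simp: convex_hull_finite)
  have inj: "inj_on int_vec S" using inj_int_vec by (rule inj_on_subset) auto
  show "\<exists>c. (\<forall>s\<in>S. 0 \<le> c s) \<and> sum c S = 1 \<and> x = (\<Sum>s\<in>S. c s *\<^sub>R int_vec s)"
    using u by (intro exI[of _ "u \<circ> int_vec"]) (simp add: sum.reindex[OF inj] o_def)
next
  assume "\<exists>c. (\<forall>s\<in>S. 0 \<le> c s) \<and> sum c S = 1 \<and> x = (\<Sum>s\<in>S. c s *\<^sub>R int_vec s)"
  then obtain c where c: "\<forall>s\<in>S. 0 \<le> c s" "sum c S = 1" "x = (\<Sum>s\<in>S. c s *\<^sub>R int_vec s)" by blast
  show "x \<in> convex hull (int_vec ` S)"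
    unfolding c(3) using c(1,2) assms
    by (intro convex_sum convex_convex_hull hull_inc) auto
qed

lemma simultaneous_approximation:
  fixes \<theta> :: "'j \<Rightarrow> real"
  assumes "finite J" "\<epsilon> > 0"
  obtains q :: int and p :: "'j \<Rightarrow> int"
  where "q > 0" "\<And>j. j \<in> J \<Longrightarrow> \<bar>of_int q * \<theta> j - of_int (p j)\<bar> < \<epsilon>"
proof -
  obtain N :: nat where N: "N > 0" "1 / real N < \<epsilon>"
    using reals_Archimedean[OF assms(2)] by (metis inverse_eq_divide zero_less_Suc)
  obtain h where h: "bij_betw h J {0..<card J}"
    using ex_bij_betw_finite_nat[OF assms(1)] by blast
  define g where "g = the_inv_into J h"
  obtain q p where qp: "0 < q" "\<And>i. i < card J \<Longrightarrow> \<bar>of_int q * \<theta> (g i) - of_int (p i)\<bar> < 1 / N"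
    using Dirichlet_approx_simult[OF N(1), of "card J" "\<lambda>i. \<theta> (g i)"] by (metis of_int_of_nat_eq)
  have "\<bar>of_int q * \<theta> j - of_int (p (h j))\<bar> < \<epsilon>" if "j \<in> J" for j
  proof -
    have "g (h j) = j" "h j < card J"
      using h that by (auto simp: g_def bij_betw_def the_inv_into_f_f)
    then show ?thesis using qp(2)[of "h j"] N by (auto intro: order.strict_trans)
  qed
  then show ?thesis using that[of q "p \<circ> h"] qp by auto
qed

lemma inner_int_vec: "u \<bullet> int_vec a = (\<Sum>j\<in>UNIV. u $ j * of_int (a $ j))"
  by (simp add: inner_vec_def int_vec_def)

text \<open>
  Gordan's theorem gives a real dependence; a simultaneous approximation whose error is too small
  for a nonzero integer makes it integral.
\<close>

lemma integer_dependence: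
  fixes M :: "(int ^ 'n::finite) set"
  assumes fin: "finite M" and cov: "\<And>u. \<exists>m\<in>M. u \<bullet> int_vec m \<ge> 0"
  obtains l :: "int ^ 'n \<Rightarrow> nat" and m0
  where "m0 \<in> M" "l m0 \<noteq> 0" "\<And>j. (\<Sum>m\<in>M. int (l m) * m $ j) = 0"
proof -
  have "0 \<in> convex hull (int_vec ` M)"
  proof (rule ccontr)
    assume "0 \<notin> convex hull (int_vec ` M)"
    moreover have "closed (convex hull (int_vec ` M) :: (real ^ 'n) set)"
      using fin by (intro compact_imp_closed finite_imp_compact_convex_hull) auto
    ultimately obtain a b where ab: "a \<bullet> (0 :: real ^ 'n) < b" "\<forall>x\<in>convex hull (int_vec ` M). a \<bullet> x > b"
      using separating_hyperplane_closed_point[OF convex_convex_hull] by blast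
    obtain m where m: "m \<in> M" "(- a) \<bullet> int_vec m \<ge> 0" using cov by blast
    have "int_vec m \<in> convex hull (int_vec ` M)" using m by (intro hull_inc) auto
    then show False using ab m by force
  qed
  then obtain c where c: "\<And>m. m \<in> M \<Longrightarrow> 0 \<le> c m" "sum c M = 1" "0 = (\<Sum>m\<in>M. c m *\<^sub>R (int_vec m :: real ^ 'n))"
    using fin by (auto simp: convex_hull_int_vec)
  have c0: "(\<Sum>m\<in>M. c m * of_int (m $ j)) = 0" for j
  proof -
    have "(0 :: real ^ 'n) $ j = (\<Sum>m\<in>M. c m *\<^sub>R (int_vec m :: real ^ 'n)) $ j" using c(3) by simp
    then show ?thesis by (simp add: sum_component int_vec_def)
  qed
  \<comment> \<open>\<open>B\<close> exceeds the sum of absolute values in each coordinate, so an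
    error below \<open>1 / B\<close> cannot produce a nonzero integer; and it exceeds
    \<open>card M\<close>, so the approximating integers cannot all vanish.\<close>
  define B where "B = 1 + real (card M) + (\<Sum>j\<in>UNIV. \<Sum>m\<in>M. \<bar>real_of_int (m $ j)\<bar>)"
  have B: "B > 0" unfolding B_def by (intro add_pos_nonneg sum_nonneg) auto
  have Bj: "(\<Sum>m\<in>M. \<bar>real_of_int (m $ j)\<bar>) < B" for j
  proof -
    have "(\<Sum>m\<in>M. \<bar>real_of_int (m $ j)\<bar>) \<le> (\<Sum>j\<in>UNIV. \<Sum>m\<in>M. \<bar>real_of_int (m $ j)\<bar>)"
      by (rule member_le_sum[of j UNIV "\<lambda>j. \<Sum>m\<in>M. \<bar>real_of_int (m $ j)\<bar>"]) (auto intro: sum_nonneg)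
    then show ?thesis by (simp add: B_def)
  qed
  obtain q p where q: "(q :: int) > 0" and p: "\<And>m. m \<in> M \<Longrightarrow> \<bar>of_int q * c m - of_int (p m)\<bar> < 1 / B"
    using simultaneous_approximation[OF fin, of "1 / B" c] B by auto
  have B1: "1 / B \<le> 1" unfolding B_def
    by (simp add: divide_le_eq add_pos_nonneg sum_nonneg)
  have p0: "p m \<ge> 0" if "m \<in> M" for m
  proof -
    have "of_int q * c m \<ge> 0" using q c(1)[OF that] by simp
    then have "real_of_int (p m) > -1" using p[OF that] B1 by linarith
    then show ?thesis by linarith
  qed
  have zero: "(\<Sum>m\<in>M. p m * m $ j) = 0" for j
  proof -
    have "real_of_int (\<Sum>m\<in>M. p m * m $ j) = (\<Sum>m\<in>M. (of_int (p m) - of_int q * c m) * of_int (m $ j))"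
      using c0[of j] by (simp add: left_diff_distrib sum_subtractf sum_distrib_left[symmetric] mult.assoc)
    also have "\<bar>\<dots>\<bar> \<le> (\<Sum>m\<in>M. 1 / B * \<bar>real_of_int (m $ j)\<bar>)"
    proof (rule order.trans[OF sum_abs sum_mono])
      fix m assume "m \<in> M"
      then show "\<bar>(of_int (p m) - of_int q * c m) * of_int (m $ j)\<bar> \<le> 1 / B * \<bar>real_of_int (m $ j)\<bar>"
        using p[of m] unfolding abs_mult by (intro mult_right_mono) auto
    qed
    also have "\<dots> < 1"
      using Bj[of j] B by (simp add: sum_divide_distrib[symmetric])
    finally have "\<bar>\<Sum>m\<in>M. p m * m $ j\<bar> < 1" by linarith
    then show ?thesis by linarith
  qed
  have "\<exists>m\<in>M. p m \<noteq> 0"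
  proof (rule ccontr)
    assume "\<not> (\<exists>m\<in>M. p m \<noteq> 0)"
    then have *: "c m \<le> 1 / B" if "m \<in> M" for m
    proof -
      have "of_int q * c m < 1 / B" using p[OF that] that \<open>\<not> (\<exists>m\<in>M. p m \<noteq> 0)\<close> by auto
      moreover have "1 * c m \<le> of_int q * c m" using q c(1)[OF that] by (intro mult_right_mono) auto
      ultimately show ?thesis by linarith
    qed
    have "1 \<le> real (card M) * (1 / B)"
      using sum_bounded_above[of M c "1 / B"] * c(2) by simp
    then have "B \<le> real (card M)" using B by (simp add: field_simps)
    moreover have "0 \<le> (\<Sum>j\<in>UNIV. \<Sum>m\<in>M. \<bar>real_of_int (m $ j)\<bar>)" by (intro sum_nonneg) auto
    ultimately show False unfolding B_def by linarith
  qed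
  then obtain m0 where "m0 \<in> M" "p m0 \<noteq> 0" by blast
  moreover have "(\<Sum>m\<in>M. int (nat (p m)) * m $ j) = 0" for j
    using zero[of j] p0 by (simp cong: sum.cong)
  ultimately show ?thesis using that[of m0 "\<lambda>m. nat (p m)"] p0[of m0] by auto
qed

text \<open>A face of a polyhedral cone is exposed by a real functional \<open>v\<close>. An integer
  vector close enough to a positive multiple of \<open>v\<close> has the same sign on every
  generator: where \<open>v\<close> vanishes the value is an integer of absolute value below
  \<open>1\<close>, and elsewhere the error is smaller than the value.\<close>

lemma rational_supporting_functional:
  fixes S :: "(int ^ 'n::finite) set"
  assumes S: "finite S" "\<tau> = convex_cone hull (int_vec ` S)"
    and F: "F face_of \<tau>" "F \<noteq> {}" "F \<noteq> \<tau>"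
  obtains a :: "int ^ 'n" where "\<And>x. x \<in> \<tau> \<Longrightarrow> x \<bullet> int_vec a \<ge> 0" "\<And>x. x \<in> F \<Longrightarrow> x \<bullet> int_vec a = 0"
    "\<exists>x\<in>\<tau>. x \<bullet> int_vec a > 0"
proof -
  have "polyhedron \<tau>" unfolding S(2) by (rule polyhedron_convex_cone_hull) (use S in auto)
  then obtain a b where ab: "\<tau> \<subseteq> {x. a \<bullet> x \<le> b}" "F = \<tau> \<inter> {x. a \<bullet> x = b}"
    using exposed_face_of_polyhedron F(1) unfolding exposed_face_of_def by metis
  have cc: "convex_cone \<tau>" unfolding S(2) by (rule convex_cone_convex_cone_hull)
  \<comment> \<open>A cone is stable under doubling and contains \<open>0\<close>, which forces the
    offset \<open>b\<close> of the hyperplane to be zero.\<close>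
  obtain x0 where x0: "x0 \<in> F" using F(2) by blast
  have "2 *\<^sub>R x0 \<in> \<tau>" using x0 ab by (intro convex_cone_scaleR[OF cc]) auto
  then have "a \<bullet> (2 *\<^sub>R x0) \<le> b" using ab(1) by blast
  moreover have "a \<bullet> 0 \<le> b" using ab(1) convex_cone_contains_0[OF cc] by blast
  moreover have "a \<bullet> x0 = b" using x0 ab(2) by blast
  ultimately have b: "b = 0" by simp
  define v where "v = - a"
  have v: "v \<bullet> x \<ge> 0" if "x \<in> \<tau>" for x using that ab(1) b by (auto simp: v_def)
  have F_eq: "F = \<tau> \<inter> {x. v \<bullet> x = 0}" using ab(2) b by (auto simp: v_def)
  have vS: "v \<bullet> int_vec s \<ge> 0" if "s \<in> S" for s
    using that by (intro v) (auto simp: S(2) intro: hull_inc)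
  define C where "C = 1 + (\<Sum>s\<in>S. \<Sum>j\<in>UNIV. \<bar>real_of_int (s $ j)\<bar>)"
  have C: "C > 0" unfolding C_def by (intro add_pos_nonneg sum_nonneg) auto
  \<comment> \<open>The error has to stay below every positive value of \<open>v\<close> on a
    generator. The entry \<open>1\<close> keeps it below \<open>1\<close> on the other
    generators.\<close>
  define D where "D = insert 1 ((\<lambda>s. v \<bullet> int_vec s) ` {s \<in> S. v \<bullet> int_vec s > 0})"
  have D: "finite D" "D \<noteq> {}" "\<And>d. d \<in> D \<Longrightarrow> d > 0" using S(1) by (auto simp: D_def)
  define \<epsilon> where "\<epsilon> = Min D / C"
  have MD: "Min D > 0" using D by simp
  then have \<epsilon>: "\<epsilon> > 0" using C by (simp add: \<epsilon>_def)
  have \<epsilon>C: "\<epsilon> * C \<le> d" if "d \<in> D" for d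
    using C Min_le[OF D(1) that] by (simp add: \<epsilon>_def)
  obtain q p where q: "(q :: int) > 0" and p: "\<And>j. \<bar>of_int q * v $ j - of_int (p j)\<bar> < \<epsilon>"
    using simultaneous_approximation[of "UNIV :: 'n set" \<epsilon> "\<lambda>j. v $ j"] \<epsilon> by auto
  define w :: "int ^ 'n" where "w = (\<chi> j. p j)"
  have app: "\<bar>of_int q * (v \<bullet> int_vec s) - int_vec s \<bullet> int_vec w\<bar> < \<epsilon> * C" if "s \<in> S" for s
  proof -
    have "of_int q * (v \<bullet> int_vec s) - int_vec s \<bullet> int_vec w
        = (\<Sum>j\<in>UNIV. (of_int q * v $ j - of_int (p j)) * of_int (s $ j))"
      unfolding inner_int_vec
      by (simp add: w_def int_vec_def sum_distrib_left right_diff_distrib left_diff_distrib sum_subtractf mult_ac)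
    also have "\<bar>\<dots>\<bar> \<le> (\<Sum>j\<in>UNIV. \<epsilon> * \<bar>real_of_int (s $ j)\<bar>)"
      by (rule order.trans[OF sum_abs sum_mono]) (auto simp: abs_mult intro!: mult_right_mono less_imp_le[OF p])
    also have "\<dots> = \<epsilon> * (\<Sum>j\<in>UNIV. \<bar>real_of_int (s $ j)\<bar>)" by (simp add: sum_distrib_left)
    also have "\<dots> < \<epsilon> * C"
    proof -
      have "(\<Sum>j\<in>UNIV. \<bar>real_of_int (s $ j)\<bar>) \<le> C - 1"
        using member_le_sum[of s S "\<lambda>s. \<Sum>j\<in>UNIV. \<bar>real_of_int (s $ j)\<bar>"] that S(1)
        by (auto simp: C_def intro: sum_nonneg)
      then show ?thesis using \<epsilon> by simp
    qed
    finally show ?thesis .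
  qed
  have sgn: "(v \<bullet> x = 0 \<and> x \<bullet> int_vec w = 0) \<or> (v \<bullet> x > 0 \<and> x \<bullet> int_vec w > 0)"
    if "x \<in> int_vec ` S" for x
  proof -
    obtain s where s: "s \<in> S" "x = int_vec s" using \<open>x \<in> int_vec ` S\<close> by blast
    show ?thesis
    proof (cases "v \<bullet> x > 0")
      case True
      then have "\<epsilon> * C \<le> v \<bullet> x" using s by (intro \<epsilon>C) (auto simp: D_def)
      moreover have "1 * (v \<bullet> x) \<le> of_int q * (v \<bullet> x)" using True q by (intro mult_right_mono) auto
      ultimately have "x \<bullet> int_vec w > 0" using app[OF s(1)] unfolding s(2) by linarith
      then show ?thesis using True by simp
    next
      case False
      then have 0: "v \<bullet> x = 0" using vS s by force
      have "\<epsilon> * C \<le> 1" by (intro \<epsilon>C) (auto simp: D_def)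
      then have "\<bar>int_vec s \<bullet> int_vec w\<bar> < 1" using app[OF s(1)] 0 s(2) by simp
      moreover have "int_vec s \<bullet> int_vec w = of_int (\<Sum>j\<in>UNIV. s $ j * w $ j)"
        unfolding inner_int_vec by (simp add: int_vec_def)
      ultimately have "\<bar>\<Sum>j\<in>UNIV. s $ j * w $ j\<bar> < 1"
        and *: "int_vec s \<bullet> int_vec w = of_int (\<Sum>j\<in>UNIV. s $ j * w $ j)" by linarith+
      then have "(\<Sum>j\<in>UNIV. s $ j * w $ j) = 0" by linarith
      then have "int_vec s \<bullet> int_vec w = 0" unfolding * by simp
      then show ?thesis using 0 s by simp
    qed
  qed
  \<comment> \<open>Where \<open>v\<close> and \<open>w\<close> are both zero or both positive. This
    set is a convex cone, so agreement of signs passes from the generators to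
    \<open>\<tau>\<close>.\<close>
  define K where "K = {x. (v \<bullet> x = 0 \<and> x \<bullet> int_vec w = 0) \<or> (v \<bullet> x > 0 \<and> x \<bullet> int_vec w > 0)}"
  have "convex_cone K"
    unfolding convex_cone_iff
  proof (intro conjI ballI allI impI)
    show "0 \<in> K" by (simp add: K_def)
    show "x + y \<in> K" if "x \<in> K" "y \<in> K" for x y
      using that by (auto simp: K_def inner_add_right inner_add_left)
    show "c *\<^sub>R x \<in> K" if "x \<in> K" "0 \<le> c" for c x
      using that by (cases "c = 0") (auto simp: K_def)
  qed
  moreover have "int_vec ` S \<subseteq> K" using sgn by (auto simp: K_def)
  ultimately have K: "\<tau> \<subseteq> K" unfolding S(2) by (intro hull_minimal) auto
  show ?thesis
  proof (rule that[of w])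
    show "x \<bullet> int_vec w \<ge> 0" if "x \<in> \<tau>" for x using K that by (auto simp: K_def)
    show "x \<bullet> int_vec w = 0" if "x \<in> F" for x using K that F_eq by (auto simp: K_def)
    obtain x where "x \<in> \<tau>" "x \<notin> F" using F(3) F_eq by blast
    then show "\<exists>x\<in>\<tau>. x \<bullet> int_vec w > 0" using K F_eq v[of x] by (intro bexI[of _ x]) (auto simp: K_def)
  qed
qed

section \<open>Lattice points of real multiples of a polytope\<close>

definition latt :: "(real ^ 'n::finite) set \<Rightarrow> real \<Rightarrow> (int ^ 'n) set"
  where "latt P d = {b. int_vec b \<in> (*\<^sub>R) d ` P}"

lemma latt_add:
  assumes "convex P" "d \<ge> 0" "d' \<ge> 0" "a \<in> latt P d" "b \<in> latt P d'"
  shows "a + b \<in> latt P (d + d')"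
proof (cases "d + d' = 0")
  case True
  then have "d = 0" "d' = 0" using assms by auto
  then show ?thesis using assms by (auto simp: latt_def)
next
  case False
  obtain x y where xy: "x \<in> P" "y \<in> P" "int_vec a = d *\<^sub>R x" "int_vec b = d' *\<^sub>R y"
    using assms by (auto simp: latt_def)
  have "(d / (d + d')) *\<^sub>R x + (d' / (d + d')) *\<^sub>R y \<in> P"
    using False assms xy by (intro convexD[OF assms(1)]) (auto simp: add_divide_distrib[symmetric])
  moreover have "int_vec (a + b) = (d + d') *\<^sub>R ((d / (d + d')) *\<^sub>R x + (d' / (d + d')) *\<^sub>R y)"
    using False xy by (simp add: scaleR_add_right)
  ultimately show ?thesis unfolding latt_def by blast
qed

lemma zero_latt: "0 \<in> P \<Longrightarrow> 0 \<in> latt P d"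
  by (auto simp: latt_def intro: image_eqI[of _ _ 0])

lemma latt_mono:
  assumes "convex P" "0 \<in> P" "0 \<le> d" "d \<le> d'"
  shows "latt P d \<subseteq> latt P d'"
  using latt_add[OF assms(1,3), of "d' - d" _ 0] assms zero_latt[of P "d' - d"] by auto

text \<open>The weights of the points of \<open>S\<close> add up to \<open>d + 1 > card S\<close>,
  so one of them is at least \<open>1\<close>, and the corresponding point can be subtracted. For
  small \<open>d\<close> such a splitting can fail, as lattice polytopes need not be normal.\<close>

lemma latt_step:
  assumes S: "finite S" "P = convex hull (int_vec ` S)" and d: "d \<ge> real (card S)"
    and b: "b \<in> latt P (d + 1)"
  shows "\<exists>s\<in>latt P 1. b - s \<in> latt P d"
proof -
  obtain x where x: "x \<in> P" "int_vec b = (d + 1) *\<^sub>R x" using b by (auto simp: latt_def)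
  obtain c where c: "\<forall>s\<in>S. 0 \<le> c s" "sum c S = 1" "x = (\<Sum>s\<in>S. c s *\<^sub>R int_vec s)"
    using x S by (auto simp: convex_hull_int_vec)
  have "S \<noteq> {}" using c(2) by auto
  then have d1: "d \<ge> 1" using d S(1) by (metis One_nat_def Suc_leI card_gt_0_iff of_nat_1 of_nat_mono order.trans)
  have "\<exists>s\<in>S. (d + 1) * c s \<ge> 1"
  proof (rule ccontr)
    assume "\<not> (\<exists>s\<in>S. (d + 1) * c s \<ge> 1)"
    then have "(\<Sum>s\<in>S. (d + 1) * c s) \<le> real (card S) * 1"
      by (intro sum_bounded_above) (auto simp: not_le intro: less_imp_le)
    then show False using c(2) d by (simp add: sum_distrib_left[symmetric])
  qed
  then obtain s where s: "s \<in> S" "(d + 1) * c s \<ge> 1" by blast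
  define c' where "c' = (\<lambda>t. ((d + 1) * c t - (if t = s then 1 else 0)) / d)"
  have "\<forall>t\<in>S. 0 \<le> c' t" using s c(1) d1 by (auto simp: c'_def)
  moreover have "sum c' S = 1"
    using s S(1) c(2) d1 by (simp add: c'_def sum_divide_distrib[symmetric] sum_subtractf sum_distrib_left[symmetric])
  ultimately have "(\<Sum>t\<in>S. c' t *\<^sub>R int_vec t) \<in> P"
    unfolding S(2) convex_hull_int_vec[OF S(1)] by blast
  moreover have "int_vec (b - s) = d *\<^sub>R (\<Sum>t\<in>S. c' t *\<^sub>R int_vec t)"
  proof -
    have "d *\<^sub>R (\<Sum>t\<in>S. c' t *\<^sub>R int_vec t)
        = (\<Sum>t\<in>S. ((d + 1) * c t) *\<^sub>R int_vec t - (if t = s then int_vec t else 0))"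
      using d1 by (auto simp: scaleR_sum_right c'_def scaleR_left_diff_distrib intro!: sum.cong)
    also have "\<dots> = int_vec b - int_vec s"
      using s S(1) by (simp add: sum_subtractf x(2) c(3) scaleR_sum_right)
    finally show ?thesis by simp
  qed
  moreover have "int_vec s \<in> P" unfolding S(2) using s by (intro hull_inc) auto
  ultimately show ?thesis by (intro bexI[of _ s]) (auto simp: latt_def)
qed

lemma finite_int_box: "finite {b :: int ^ 'n::finite. \<forall>j. L \<le> b $ j \<and> b $ j \<le> U}"
  and card_int_box: "card {b :: int ^ 'n. \<forall>j. L \<le> b $ j \<and> b $ j \<le> U} \<le> nat (U - L + 1) ^ CARD('n)"
proof -
  let ?B = "{b :: int ^ 'n. \<forall>j. L \<le> b $ j \<and> b $ j \<le> U}"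
  have inj: "inj_on vec_nth ?B" by (auto simp: inj_on_def vec_eq_iff)
  have sub: "vec_nth ` ?B \<subseteq> PiE UNIV (\<lambda>_. {L..U})" by auto
  have fin: "finite (PiE (UNIV :: 'n set) (\<lambda>_. {L..U}))" by (intro finite_PiE) auto
  show "finite ?B" using finite_subset[OF sub fin] inj by (rule finite_imageD)
  have "card ?B = card (vec_nth ` ?B)" using inj by (simp add: card_image)
  also have "\<dots> \<le> card (PiE (UNIV :: 'n set) (\<lambda>_. {L..U}))" by (rule card_mono[OF fin sub])
  also have "\<dots> = nat (U - L + 1) ^ CARD('n)" by (simp add: card_PiE)
  finally show "card ?B \<le> nat (U - L + 1) ^ CARD('n)" .
qed

lemma lattice_polytope_props:
  assumes "lattice_polytope P"
  shows "convex P" "compact P"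
proof -
  obtain S where S: "finite S" "P = convex hull (int_vec ` S)"
    using assms by (auto simp: lattice_polytope_def)
  show "convex P" unfolding S(2) by (rule convex_convex_hull)
  show "compact P" unfolding S(2) by (rule finite_imp_compact_convex_hull) (use S in auto)
qed

text \<open>The bound is linear in \<open>d\<close>; hence the number of lattice points grows at
  most like the \<open>n\<close>-th power of \<open>d\<close>, which is what the dimension count
  needs.\<close>

lemma latt_in_box:
  fixes P :: "(real ^ 'n::finite) set"
  assumes "compact P" "P \<subseteq> orthant"
  obtains M :: nat where "\<And>d b j. d \<ge> 0 \<Longrightarrow> b \<in> latt P d \<Longrightarrow> 0 \<le> b $ j \<and> real_of_int (b $ j) \<le> d * M"
proof -
  obtain B where B: "\<And>x. x \<in> P \<Longrightarrow> norm x \<le> B"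
    using compact_imp_bounded[OF assms(1)] by (auto simp: bounded_iff)
  have "0 \<le> b $ j \<and> real_of_int (b $ j) \<le> d * nat \<lceil>B\<rceil>" if d: "d \<ge> 0" and b: "b \<in> latt P d" for d b j
  proof -
    obtain x where x: "x \<in> P" "int_vec b = d *\<^sub>R x" using b by (auto simp: latt_def)
    have e: "real_of_int (b $ j) = d * x $ j"
      using arg_cong[OF x(2), of "\<lambda>y. y $ j"] by (simp add: int_vec_def)
    have "0 \<le> x $ j" using x assms(2) by (auto simp: orthant_def)
    moreover have "x $ j \<le> nat \<lceil>B\<rceil>"
      using B[OF x(1)] component_le_norm_cart[of x j] real_nat_ceiling_ge[of B] by linarith
    ultimately have "0 \<le> real_of_int (b $ j)" "real_of_int (b $ j) \<le> d * nat \<lceil>B\<rceil>"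
      unfolding e using d by (auto intro: mult_left_mono)
    then show ?thesis by simp
  qed
  then show ?thesis using that by blast
qed

section \<open>Maximal ideals of the charts and points at infinity\<close>

lemma ideal_ring_on_iff:
  fixes A :: "'a::comm_ring_1 set"
  assumes A: "subring_set A"
  shows "ideal J (ring_on A) \<longleftrightarrow>
    J \<subseteq> A \<and> 0 \<in> J \<and> (\<forall>x\<in>J. \<forall>y\<in>J. x + y \<in> J) \<and> (\<forall>a\<in>A. \<forall>x\<in>J. a * x \<in> J)"
proof
  assume J: "ideal J (ring_on A)"
  interpret ideal J "ring_on A" by (rule J)
  show "J \<subseteq> A \<and> 0 \<in> J \<and> (\<forall>x\<in>J. \<forall>y\<in>J. x + y \<in> J) \<and> (\<forall>a\<in>A. \<forall>x\<in>J. a * x \<in> J)"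
    using additive_subgroup.a_subset[OF ideal.axioms(1)[OF J]] additive_subgroup.zero_closed[OF ideal.axioms(1)[OF J]]
      additive_subgroup.a_closed[OF ideal.axioms(1)[OF J]] I_l_closed by auto
next
  assume *: "J \<subseteq> A \<and> 0 \<in> J \<and> (\<forall>x\<in>J. \<forall>y\<in>J. x + y \<in> J) \<and> (\<forall>a\<in>A. \<forall>x\<in>J. a * x \<in> J)"
  have R: "cring (ring_on A)" using A by (intro cring_ring_on) (auto intro: subring_setD)
  then interpret cring "ring_on A" .
  show "ideal J (ring_on A)"
  proof (rule idealI)
    show "ring (ring_on A)" ..
    show "subgroup J (add_monoid (ring_on A))"
    proof (rule add.subgroupI)
      show "J \<subseteq> carrier (ring_on A)" "J \<noteq> {}" using * by auto
      show "a \<oplus>\<^bsub>ring_on A\<^esub> b \<in> J" if "a \<in> J" "b \<in> J" for a b using * that by auto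
      show "\<ominus>\<^bsub>ring_on A\<^esub> a \<in> J" if a: "a \<in> J" for a
      proof -
        have "- 1 * a \<in> J" using * a subring_setD(4)[OF A subring_setD(1)[OF A]] by blast
        then have m: "- a \<in> J" by simp
        then have "\<ominus>\<^bsub>ring_on A\<^esub> a = - a"
          using * a by (intro minus_equality) auto
        then show ?thesis using m by simp
      qed
    qed
    show "x \<otimes>\<^bsub>ring_on A\<^esub> a \<in> J" "a \<otimes>\<^bsub>ring_on A\<^esub> x \<in> J"
      if "a \<in> J" "x \<in> carrier (ring_on A)" for a x
      using * that by (auto simp: mult.commute[of a])
  qed
qed

lemma exists_maximalideal:
  fixes A :: "'a::comm_ring_1 set"
  assumes A: "subring_set A" and J: "ideal J (ring_on A)" "1 \<notin> J"
  obtains p where "maximalideal p (ring_on A)" "J \<subseteq> p"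
proof -
  let ?S = "{I. ideal I (ring_on A) \<and> J \<subseteq> I \<and> 1 \<notin> I}"
  have "\<exists>M\<in>?S. \<forall>X\<in>?S. M \<subseteq> X \<longrightarrow> X = M"
  proof (rule subset_Zorn_nonempty)
    show "?S \<noteq> {}" using J by auto
    fix C assume C: "C \<noteq> {}" "subset.chain ?S C"
    then have sub: "C \<subseteq> ?S" and tot: "\<And>X Y. X \<in> C \<Longrightarrow> Y \<in> C \<Longrightarrow> X \<subseteq> Y \<or> Y \<subseteq> X"
      by (auto simp: subset_chain_def)
    have i: "I \<subseteq> A" "0 \<in> I" "\<And>x y. x \<in> I \<Longrightarrow> y \<in> I \<Longrightarrow> x + y \<in> I" "\<And>a x. a \<in> A \<Longrightarrow> x \<in> I \<Longrightarrow> a * x \<in> I"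
      if "I \<in> C" for I
      using that sub by (auto simp: ideal_ring_on_iff[OF A])
    have "ideal (\<Union>C) (ring_on A)"
      unfolding ideal_ring_on_iff[OF A]
    proof (intro conjI ballI)
      show "\<Union>C \<subseteq> A" "0 \<in> \<Union>C" using i C(1) by auto
      show "x + y \<in> \<Union>C" if xy: "x \<in> \<Union>C" "y \<in> \<Union>C" for x y
      proof -
        obtain X Y where XY: "X \<in> C" "Y \<in> C" "x \<in> X" "y \<in> Y" using xy by blast
        then show ?thesis using tot[OF XY(1,2)] i(3)[OF XY(1), of x y] i(3)[OF XY(2), of x y]
          by (metis UnionI subsetD)
      qed
      show "a * x \<in> \<Union>C" if "a \<in> A" "x \<in> \<Union>C" for a x using that i(4) by blast
    qed
    then show "\<Union>C \<in> ?S" using sub C(1) by auto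
  qed
  then obtain p where pS: "p \<in> ?S" and p_max: "\<forall>X\<in>?S. p \<subseteq> X \<longrightarrow> X = p" by (rule bexE)
  have p: "ideal p (ring_on A)" "J \<subseteq> p" "1 \<notin> p" using pS by simp_all
  have "maximalideal p (ring_on A)"
  proof (rule maximalidealI[OF p(1)])
    show "carrier (ring_on A) \<noteq> p" using p(3) subring_setD(1)[OF A] by auto
    fix I assume I: "ideal I (ring_on A)" "p \<subseteq> I" "I \<subseteq> carrier (ring_on A)"
    show "I = p \<or> I = carrier (ring_on A)"
    proof (cases "1 \<in> I")
      case True
      then have "a \<in> I" if "a \<in> A" for a
        using I(1) that unfolding ideal_ring_on_iff[OF A] by (metis mult.right_neutral)
      then show ?thesis using I(3) by auto
    next
      case False
      then show ?thesis using bspec[OF p_max, of I] I p(2) by auto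
    qed
  qed
  then show ?thesis using that p(2) by blast
qed

abbreviation "chart_carrier \<sigma> \<equiv> {f. laurent_supp f \<subseteq> dual_cone \<sigma>}"

lemma keys_dual_cone: "laurent_supp f \<subseteq> dual_cone \<sigma> \<longleftrightarrow> (\<forall>a\<in>Poly_Mapping.keys f. int_vec a \<in> dual_cone \<sigma>)"
  by (auto simp: laurent_supp_def)

lemma subring_chart_carrier: "subring_set (chart_carrier \<sigma>)"
proof -
  interpret cring "chart_ring \<sigma>" by (rule cring_chart_ring)
  have 1: "1 \<in> chart_carrier \<sigma>" using one_closed by (simp add: chart_ring_def)
  moreover have "x * y \<in> chart_carrier \<sigma>" if "x \<in> chart_carrier \<sigma>" "y \<in> chart_carrier \<sigma>" for x y
    using m_closed[of x y] that by (simp add: chart_ring_def)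
  moreover have "x - y \<in> chart_carrier \<sigma>" if "x \<in> chart_carrier \<sigma>" "y \<in> chart_carrier \<sigma>" for x y
    using that keys_diff[of x y] unfolding mem_Collect_eq keys_dual_cone by blast
  ultimately show ?thesis unfolding subring_set_def by blast
qed

text \<open>The elements of \<open>M\<close> form the ideal of the closed orbit in the chart of
  \<open>\<sigma>\<close>, and this orbit lies at infinity when \<open>\<sigma>\<close> is not
  contained in the orthant. The sections have no common zero on it, so together with
  \<open>M\<close> they generate the unit ideal; \<open>h\<close> is the contribution of
  \<open>M\<close>.\<close>

lemma unit_ideal_at_infinity:
  fixes P :: "(real ^ 'n::finite) set" and F :: "nat \<Rightarrow> 'n poly_ring"
  assumes fan: "complete_fan \<Delta>" "compatible \<Delta> P" "orthant \<in> \<Delta>"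
    and inf: "\<not> (\<exists>x\<in>variety_at_infinity \<Delta>. \<forall>G\<in>F ` J. section_vanishes_at P (to_laurent G) x)"
    and J: "finite J" "\<And>j. j \<in> J \<Longrightarrow> laurent_supp (to_laurent (F j)) \<subseteq> P"
    and \<sigma>: "\<sigma> \<in> \<Delta>" "\<not> \<sigma> \<subseteq> orthant"
  obtains g h where "1 = (\<Sum>j\<in>J. local_section P (to_laurent (F j)) \<sigma> * g j) + h"
    "\<And>j. j \<in> J \<Longrightarrow> laurent_supp (g j) \<subseteq> dual_cone \<sigma>" "laurent_supp h \<subseteq> dual_cone \<sigma>"
    "\<And>a. a \<in> Poly_Mapping.keys h \<Longrightarrow> \<exists>u\<in>\<sigma>. u \<bullet> int_vec a > 0"
proof -
  define f where "f j = local_section P (to_laurent (F j)) \<sigma>" for j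
  define M where "M = {h. h \<in> chart_carrier \<sigma> \<and> (\<forall>a\<in>Poly_Mapping.keys h. \<exists>u\<in>\<sigma>. u \<bullet> int_vec a > 0)}"
  define I where "I = {(\<Sum>j\<in>J. f j * g j) + h |g h. (\<forall>j\<in>J. g j \<in> chart_carrier \<sigma>) \<and> h \<in> M}"
  note A = subring_setD[OF subring_chart_carrier[of \<sigma>]]
  have fA: "f j \<in> chart_carrier \<sigma>" if "j \<in> J" for j
    using local_section_in_chart_ring[OF fan(2) \<sigma>(1) J(2)[OF that]]
    by (simp add: f_def carrier_chart_ring)
  have M0: "0 \<in> M" using A(2) by (simp add: M_def)
  have M_add: "x + y \<in> M" if "x \<in> M" "y \<in> M" for x y
    using that keys_add[of x y] A(5)[of x y] unfolding M_def by blast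
  have M_mult: "a * x \<in> M" if "a \<in> chart_carrier \<sigma>" "x \<in> M" for a x
  proof -
    have "\<exists>u\<in>\<sigma>. u \<bullet> int_vec c > 0" if "c \<in> Poly_Mapping.keys (a * x)" for c
    proof -
      obtain d e where de: "c = d + e" "d \<in> Poly_Mapping.keys a" "e \<in> Poly_Mapping.keys x"
        using keys_mult[of a x] \<open>c \<in> Poly_Mapping.keys (a * x)\<close> by blast
      obtain u where "u \<in> \<sigma>" "u \<bullet> int_vec e > 0" using de \<open>x \<in> M\<close> by (auto simp: M_def)
      moreover from this have "u \<bullet> int_vec d \<ge> 0"
        using de \<open>a \<in> chart_carrier \<sigma>\<close> by (auto simp: laurent_supp_def dual_cone_def)
      ultimately show ?thesis using de by (auto simp: inner_add_right intro!: bexI[of _ u])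
    qed
    then show ?thesis using that A(6)[of a x] by (auto simp: M_def)
  qed
  have ideal: "ideal I (ring_on (chart_carrier \<sigma>))"
    unfolding ideal_ring_on_iff[OF subring_chart_carrier]
  proof (intro conjI ballI)
    show "I \<subseteq> chart_carrier \<sigma>"
    proof
      fix x assume "x \<in> I"
      then obtain g h where x: "x = (\<Sum>j\<in>J. f j * g j) + h" "\<forall>j\<in>J. g j \<in> chart_carrier \<sigma>" "h \<in> M"
        unfolding I_def by blast
      show "x \<in> chart_carrier \<sigma>"
        unfolding x(1) using x(2,3) fA by (intro A(5) A(9) A(6)) (auto simp: M_def)
    qed
    show "0 \<in> I" unfolding I_def using M0 A(2) by (auto intro!: exI[of _ "\<lambda>_. 0"] exI[of _ 0])
    show "x + y \<in> I" if "x \<in> I" "y \<in> I" for x y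
    proof -
      obtain g h where x: "x = (\<Sum>j\<in>J. f j * g j) + h" "\<forall>j\<in>J. g j \<in> chart_carrier \<sigma>" "h \<in> M"
        using \<open>x \<in> I\<close> unfolding I_def by blast
      obtain g' h' where y: "y = (\<Sum>j\<in>J. f j * g' j) + h'" "\<forall>j\<in>J. g' j \<in> chart_carrier \<sigma>" "h' \<in> M"
        using \<open>y \<in> I\<close> unfolding I_def by blast
      have "x + y = (\<Sum>j\<in>J. f j * (g j + g' j)) + (h + h')"
        by (simp add: x y distrib_left sum.distrib)
      moreover have "\<forall>j\<in>J. g j + g' j \<in> chart_carrier \<sigma>" using x(2) y(2) A(5) by blast
      ultimately show ?thesis using M_add[OF x(3) y(3)] unfolding I_def
        by (intro CollectI exI[of _ "\<lambda>j. g j + g' j"] exI[of _ "h + h'"]) blast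
    qed
    show "a * x \<in> I" if "a \<in> chart_carrier \<sigma>" "x \<in> I" for a x
    proof -
      obtain g h where x: "x = (\<Sum>j\<in>J. f j * g j) + h" "\<forall>j\<in>J. g j \<in> chart_carrier \<sigma>" "h \<in> M"
        using \<open>x \<in> I\<close> unfolding I_def by blast
      have "a * x = (\<Sum>j\<in>J. f j * (a * g j)) + a * h"
        by (simp add: x distrib_left sum_distrib_left mult_ac)
      moreover have "\<forall>j\<in>J. a * g j \<in> chart_carrier \<sigma>" using x(2) that(1) A(6) by blast
      ultimately show ?thesis using M_mult[OF that(1) x(3)] unfolding I_def
        by (intro CollectI exI[of _ "\<lambda>j. a * g j"] exI[of _ "a * h"]) blast
    qed
  qed
  have MI: "M \<subseteq> I"
  proof
    fix h assume "h \<in> M"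
    then show "h \<in> I" unfolding I_def using A(2)
      by (intro CollectI exI[of _ "\<lambda>_. 0"] exI[of _ h]) auto
  qed
  have fI: "f i \<in> I" if "i \<in> J" for i
  proof -
    have "f i = (\<Sum>j\<in>J. f j * (if j = i then 1 else 0)) + 0"
      using J(1) that by (simp add: if_distrib cong: if_cong)
    then show ?thesis unfolding I_def using M0 A(1,2)
      by (intro CollectI exI[of _ "\<lambda>j. if j = i then 1 else 0"] exI[of _ 0]) auto
  qed
  have "1 \<in> I"
  proof (rule ccontr)
    assume "1 \<notin> I"
    then obtain p where p: "maximalideal p (ring_on (chart_carrier \<sigma>))" "I \<subseteq> p"
      using exists_maximalideal[OF subring_chart_carrier ideal] by blast
    then have pc: "p \<in> chart \<sigma>" by (simp add: chart_def chart_ring_def)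
    define x where "x = glue \<Delta> `` {(\<sigma>, p)}"
    have px: "(\<sigma>, p) \<in> x" using glue_refl[OF \<sigma>(1) pc] by (simp add: x_def)
    have "x \<in> variety_at_infinity \<Delta>"
      unfolding variety_at_infinity_def
    proof
      show "x \<in> toric_variety \<Delta>"
        unfolding toric_variety_def x_def by (intro quotientI) (use \<sigma> pc in auto)
      \<comment> \<open>Otherwise the point lies in the chart of
        \<open>orthant \<inter> \<sigma>\<close>, a proper face of \<open>\<sigma>\<close>. A
        monomial supporting this face lies in \<open>M\<close>, so it vanishes at the point, but it
        is a unit on the chart of the face.\<close>
      show "x \<notin> ({orthant} \<times> chart orthant) // glue \<Delta>"
      proof
        assume "x \<in> ({orthant} \<times> chart orthant) // glue \<Delta>"
        then obtain p' where "x = glue \<Delta> `` {(orthant, p')}" by (auto elim!: quotientE)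
        then have "((orthant, p'), (\<sigma>, p)) \<in> glue \<Delta>" using px by simp
        then obtain q where q: "q \<in> chart (orthant \<inter> \<sigma>)" "contraction \<sigma> q = p"
          by (auto simp: glue_def)
        have cone: "lattice_cone \<sigma>" and face: "(orthant \<inter> \<sigma>) face_of \<sigma>"
          using fan \<sigma> by (auto simp: complete_fan_def)
        obtain S where S: "finite S" "\<sigma> = convex_cone hull (int_vec ` S)"
          using cone by (auto simp: lattice_cone_def)
        have "0 \<in> orthant \<inter> \<sigma>"
          by (auto simp: orthant_def S(2) convex_cone_hull_contains_0)
        then obtain a where a: "\<And>x. x \<in> \<sigma> \<Longrightarrow> x \<bullet> int_vec a \<ge> 0" "\<And>x. x \<in> orthant \<inter> \<sigma> \<Longrightarrow> x \<bullet> int_vec a = 0"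
          "\<exists>x\<in>\<sigma>. x \<bullet> int_vec a > 0"
          using rational_supporting_functional[OF S face] \<sigma>(2) by blast
        have "laurent_monom a \<in> M"
          using a by (auto simp: M_def dual_cone_def laurent_monom_def laurent_supp_def)
        then have aq: "laurent_monom a \<in> q" using MI p(2) q(2) by (auto simp: contraction_def)
        have qm: "maximalideal q (ring_on (chart_carrier (orthant \<inter> \<sigma>)))"
          using q(1) by (simp add: chart_def chart_ring_def)
        then have qi: "ideal q (ring_on (chart_carrier (orthant \<inter> \<sigma>)))"
          by (rule maximalideal.axioms(1))
        have "laurent_monom (- a) \<in> chart_carrier (orthant \<inter> \<sigma>)"
          using a(2) by (simp add: dual_cone_def)
        with aq qi have "laurent_monom (- a) * laurent_monom a \<in> q"
          unfolding ideal_ring_on_iff[OF subring_chart_carrier] by blast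
        then have "1 \<in> q" by (simp add: laurent_monom_add[symmetric])
        then have "a \<in> q" if "a \<in> chart_carrier (orthant \<inter> \<sigma>)" for a
          using qi that unfolding ideal_ring_on_iff[OF subring_chart_carrier] by (metis mult.right_neutral)
        moreover have "q \<subseteq> chart_carrier (orthant \<inter> \<sigma>)"
          using qi unfolding ideal_ring_on_iff[OF subring_chart_carrier] by blast
        ultimately have "q = carrier (ring_on (chart_carrier (orthant \<inter> \<sigma>)))" by auto
        then show False using maximalideal.I_notcarr[OF qm] by auto
      qed
    qed
    moreover have "section_vanishes_at P (to_laurent G) x" if "G \<in> F ` J" for G
    proof -
      obtain j where "j \<in> J" "G = F j" using \<open>G \<in> F ` J\<close> by blast
      then have "local_section P (to_laurent G) \<sigma> \<in> p" using fI p(2) by (auto simp: f_def)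
      then show ?thesis unfolding section_vanishes_at_def using px by blast
    qed
    ultimately show False using inf by blast
  qed
  then obtain g h where "1 = (\<Sum>j\<in>J. f j * g j) + h" "\<forall>j\<in>J. g j \<in> chart_carrier \<sigma>" "h \<in> M"
    unfolding I_def by blast
  then show ?thesis using that[of g h] by (auto simp: f_def M_def)
qed

section \<open>Integral elements and maximal subrings\<close>

text \<open>
  The determinant trick turns this condition into a monic equation for \<open>u\<close> over \<open>B\<close>; the
  equation itself is never needed.
\<close>

definition integ :: "'a::comm_ring_1 \<Rightarrow> 'a asub \<Rightarrow> bool"
  where "integ u B \<longleftrightarrow> (\<exists>M. fg M \<and> 1 \<le> M \<and> gen {u} * M \<le> B * M)"

definition is_ring :: "'a::comm_ring_1 asub \<Rightarrow> bool"
  where "is_ring B \<longleftrightarrow> 1 \<le> B \<and> B * B \<le> B"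

lemma is_ring_mult: "is_ring B \<Longrightarrow> B * B = B"
  using asub_le_mult_one[of B B] by (auto simp: is_ring_def intro: order.antisym)

lemma is_ring_power: "is_ring B \<Longrightarrow> B ^ n \<le> B"
proof (induction n)
  case (Suc n)
  then have "B * B ^ n \<le> B * B" by (intro asub_mult_mono) auto
  then show ?case using is_ring_mult[OF Suc.prems] by simp
qed (simp add: is_ring_def)

text \<open>The powers of \<open>u\<close> below \<open>R\<close>, multiplied with \<open>M\<close>,
  span a module stable under \<open>u\<close>: the only power leaving it, \<open>u ^ R\<close>, is
  brought back by the hypothesis.\<close>

lemma integ_power_in:
  assumes B: "is_ring B" and M: "fg M" "1 \<le> M" and R: "R \<ge> 1"
    and u: "gen {u} ^ R * M \<le> B * ((\<Sum>k<R. gen {u} ^ k) * M)"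
  shows "integ u B"
proof -
  define E where "E = (\<Sum>k<R. gen {u} ^ k)"
  have E1: "1 \<le> E" using asub_le_sum[of "{..<R}" 0 "\<lambda>k. gen {u} ^ k"] R by (simp add: E_def)
  have "gen {u} * E \<le> E + gen {u} ^ R"
    unfolding E_def sum_distrib_left
  proof (subst asub_sum_le_iff, simp, intro ballI)
    fix k assume k: "k \<in> {..<R}"
    show "gen {u} * gen {u} ^ k \<le> (\<Sum>k<R. gen {u} ^ k) + gen {u} ^ R"
    proof (cases "Suc k = R")
      case True
      then show ?thesis by (auto intro: asub_le_plusI2)
    next
      case False
      then show ?thesis using k asub_le_sum[of "{..<R}" "Suc k" "\<lambda>k. gen {u} ^ k"]
        by (auto intro!: asub_le_plusI1)
    qed
  qed
  then have "(gen {u} * E) * M \<le> (E + gen {u} ^ R) * M" by (intro asub_mult_mono) auto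
  also have "\<dots> \<le> E * M + B * (E * M)"
    using u by (simp add: distrib_right asub_plus_mono E_def)
  also have "\<dots> \<le> B * (E * M)"
    using asub_le_mult_one[of B "E * M"] B by (simp add: plus_le_iff is_ring_def mult.commute)
  finally have "gen {u} * (E * M) \<le> B * (E * M)" by (simp add: mult.assoc)
  moreover have "fg (E * M)"
    unfolding E_def by (intro fg_mult fg_sum fg_power fg_gen M) auto
  moreover have "1 \<le> E * M" using asub_mult_mono[OF E1 M(2)] by simp
  ultimately show ?thesis unfolding integ_def by blast
qed

text \<open>A dependence over the union involves finitely many elements and thus holds over one
  member. This provides upper bounds of chains in Zorn's lemma and, for the filtration of
  \<open>B[y]\<close> by degree, a bound on the powers of \<open>y\<close>.\<close>

lemma directed_union:
  fixes \<C> :: "'a::comm_ring_1 asub set"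
  assumes ne: "\<C> \<noteq> {}" and dir: "\<And>A B. A \<in> \<C> \<Longrightarrow> B \<in> \<C> \<Longrightarrow> \<exists>D\<in>\<C>. A \<le> D \<and> B \<le> D"
  obtains U where "els U = \<Union>(els ` \<C>)"
    "\<And>X M. fg X \<Longrightarrow> X \<le> U * M \<Longrightarrow> \<exists>B\<in>\<C>. X \<le> B * M"
proof -
  let ?U = "Asub (\<Union>(els ` \<C>))"
  have U: "els ?U = \<Union>(els ` \<C>)"
  proof (rule els_Asub)
    show "0 \<in> \<Union>(els ` \<C>)" using ne by auto
    fix x y assume "x \<in> \<Union>(els ` \<C>)" "y \<in> \<Union>(els ` \<C>)"
    then obtain A B where AB: "A \<in> \<C>" "B \<in> \<C>" "x \<in> els A" "y \<in> els B" by blast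
    then obtain D where "D \<in> \<C>" "A \<le> D" "B \<le> D" using dir by blast
    then show "x - y \<in> \<Union>(els ` \<C>)"
      using AB diff_els[of x D y] leD_els by blast
  qed
  have mem: "\<exists>B\<in>\<C>. x \<in> els (B * M)" if x: "x \<in> els (?U * M)" for x M
    using x[unfolded times_asub_def els_gen]
  proof induction
    case (base x)
    then obtain b z where "x = b * z" "b \<in> \<Union>(els ` \<C>)" "z \<in> els M" unfolding U by blast
    then show ?case by (auto intro: mult_els)
  next
    case zero
    then show ?case using ne by auto
  next
    case (diff x y)
    then obtain A B where AB: "A \<in> \<C>" "B \<in> \<C>" "x \<in> els (A * M)" "y \<in> els (B * M)" by blast
    then obtain D where D: "D \<in> \<C>" "A \<le> D" "B \<le> D" using dir by blast
    have "A * M \<le> D * M" "B * M \<le> D * M" using D by (auto intro: asub_mult_mono)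
    then show ?case using AB(3,4) D(1) by (meson diff_els leD_els)
  qed
  have fgU: "\<exists>B\<in>\<C>. X \<le> B * M" if X: "fg X" "X \<le> ?U * M" for X M
  proof -
    obtain Y where Y: "finite Y" "X = gen Y" using X by (auto simp: fg_def)
    have sub: "Y \<subseteq> els (?U * M)" using X(2) unfolding Y(2) gen_le_iff .
    from Y(1) sub have "\<exists>B\<in>\<C>. Y \<subseteq> els (B * M)"
    proof (induction Y rule: finite_induct)
      case empty
      then show ?case using ne by auto
    next
      case (insert y Y)
      then obtain A B where AB: "A \<in> \<C>" "B \<in> \<C>" "Y \<subseteq> els (A * M)" "y \<in> els (B * M)"
        using mem[of y M] by auto
      then obtain D where D: "D \<in> \<C>" "A \<le> D" "B \<le> D" using dir by blast
      have "A * M \<le> D * M" "B * M \<le> D * M" using D by (auto intro: asub_mult_mono)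
      then show ?case using AB(3,4) D(1) by (auto intro!: bexI[of _ D] dest: leD_els)
    qed
    then show ?thesis unfolding Y(2) gen_le_iff .
  qed
  show ?thesis by (rule that[OF U fgU])
qed

lemma is_ring_directed_union:
  assumes "els U = \<Union>(els ` \<C>)" "\<C> \<noteq> {}" "\<And>B. B \<in> \<C> \<Longrightarrow> 1 \<le> B"
    and "\<And>A B. A \<in> \<C> \<Longrightarrow> B \<in> \<C> \<Longrightarrow> \<exists>D\<in>\<C>. A * B \<le> D"
  shows "is_ring U"
  unfolding is_ring_def one_le_iff times_le_iff
proof (intro conjI ballI)
  show "1 \<in> els U" using assms(1,2,3) by (auto simp: one_le_iff)
  fix x y assume "x \<in> els U" "y \<in> els U"
  then obtain A B where AB: "A \<in> \<C>" "B \<in> \<C>" "x \<in> els A" "y \<in> els B" unfolding assms(1) by blast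
  then obtain D where D: "D \<in> \<C>" "A * B \<le> D" using assms(4) by blast
  have "x * y \<in> els D" by (rule leD_els[OF D(2) mult_els[OF AB(3,4)]])
  then show "x * y \<in> els U" using D(1) unfolding assms(1) by blast
qed

definition max_non_integ :: "'a::comm_ring_1 \<Rightarrow> 'a asub \<Rightarrow> bool"
  where "max_non_integ u B \<longleftrightarrow> is_ring B \<and> \<not> integ u B \<and>
    (\<forall>B'. is_ring B' \<and> B \<le> B' \<and> \<not> integ u B' \<longrightarrow> B' = B)"

lemma exists_max_non_integ:
  assumes A: "is_ring A" "\<not> integ u A"
  obtains B where "A \<le> B" "max_non_integ u B"
proof -
  let ?S = "els ` {B. is_ring B \<and> A \<le> B \<and> \<not> integ u B}"
  have "\<exists>M\<in>?S. \<forall>X\<in>?S. M \<subseteq> X \<longrightarrow> X = M"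
  proof (rule subset_Zorn_nonempty)
    show "?S \<noteq> {}" using A by auto
    fix C assume C: "C \<noteq> {}" "subset.chain ?S C"
    define \<C> where "\<C> = {B. els B \<in> C}"
    have Csub: "C \<subseteq> ?S" using C(2) by (auto simp: subset_chain_def)
    have CC: "C = els ` \<C>"
      using Csub by (auto simp: \<C>_def image_iff)
    have mem: "is_ring B" "A \<le> B" "\<not> integ u B" if B: "B \<in> \<C>" for B
      using B Csub by (auto simp: \<C>_def els_inject)
    have tot: "B \<le> D \<or> D \<le> B" if "B \<in> \<C>" "D \<in> \<C>" for B D
      using C(2) that by (auto simp: \<C>_def subset_chain_def less_eq_asub_def)
    have ne: "\<C> \<noteq> {}" using C(1) CC by auto
    obtain U where U: "els U = \<Union>(els ` \<C>)" "\<And>X M. fg X \<Longrightarrow> X \<le> U * M \<Longrightarrow> \<exists>B\<in>\<C>. X \<le> B * M"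
      using directed_union[OF ne] tot by (metis order.refl)
    have "is_ring U"
    proof (rule is_ring_directed_union[OF U(1) ne])
      show "1 \<le> B" if "B \<in> \<C>" for B using mem(1)[OF that] by (simp add: is_ring_def)
      show "\<exists>E\<in>\<C>. B * D \<le> E" if "B \<in> \<C>" "D \<in> \<C>" for B D
      proof (rule disjE[OF tot[OF that]])
        assume "B \<le> D"
        then have "B * D \<le> D * D" by (intro asub_mult_mono) auto
        then show ?thesis using is_ring_mult[OF mem(1)[OF that(2)]] that(2) by auto
      next
        assume "D \<le> B"
        then have "B * D \<le> B * B" by (intro asub_mult_mono) auto
        then show ?thesis using is_ring_mult[OF mem(1)[OF that(1)]] that(1) by auto
      qed
    qed
    moreover have "A \<le> U"
    proof -
      obtain B where "B \<in> \<C>" using ne by blast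
      then show ?thesis using mem(2) U(1) by (auto simp: less_eq_asub_def)
    qed
    moreover have "\<not> integ u U"
    proof
      assume "integ u U"
      then obtain M where M: "fg M" "1 \<le> M" "gen {u} * M \<le> U * M" by (auto simp: integ_def)
      have "fg (gen {u} * M)" by (intro fg_mult fg_gen M) auto
      then obtain B where "B \<in> \<C>" "gen {u} * M \<le> B * M" using U(2)[OF _ M(3)] by blast
      then show False using mem(3) M unfolding integ_def by blast
    qed
    ultimately have "els U \<in> ?S" by blast
    then show "\<Union>C \<in> ?S" unfolding CC U(1) .
  qed
  then obtain X where X: "X \<in> ?S" "\<forall>Y\<in>?S. X \<subseteq> Y \<longrightarrow> Y = X" by (rule bexE)
  then obtain B where B: "X = els B" "is_ring B" "A \<le> B" "\<not> integ u B" by blast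
  have "max_non_integ u B"
    unfolding max_non_integ_def
  proof (intro conjI allI impI)
    fix B' assume B': "is_ring B' \<and> B \<le> B' \<and> \<not> integ u B'"
    then have "els B' \<in> ?S" using B(3) by (auto intro: order.trans)
    then have "els B' = els B" using X(2) B(1) B' by (auto simp: less_eq_asub_def)
    then show "B' = B" by (simp add: els_inject)
  qed (use B in auto)
  then show ?thesis using that B(3) by blast
qed

text \<open>By maximality \<open>u\<close> is integral over the larger ring \<open>B[y]\<close>.
  This ring is the union of the subgroups \<open>C n\<close> of polynomials of degree at most
  \<open>n\<close> in \<open>y\<close>, and one of them suffices for a given module.\<close>

lemma max_non_integ_adjoin:
  assumes B: "max_non_integ u B" and y: "y \<notin> els B"
  obtains N M where "fg M" "1 \<le> M" "gen {u} * M \<le> B * (1 + gen {y}) ^ N * M"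
proof -
  have BR: "is_ring B" using B by (simp add: max_non_integ_def)
  define C where "C n = B * (1 + gen {y}) ^ n" for n
  have mono: "C n \<le> C m" if "n \<le> m" for n m
    unfolding C_def by (intro asub_mult_mono order.refl asub_power_increasing asub_le_plus that)
  have CC: "C n * C m = C (n + m)" for n m
    using is_ring_mult[OF BR] by (simp add: C_def power_add mult_ac) (metis mult.assoc)
  have C1: "1 \<le> C n" for n
    using mono[of 0 n] BR by (auto simp: C_def is_ring_def intro: order.trans)
  have dir: "\<exists>D\<in>range C. A \<le> D \<and> A' \<le> D" if AA': "A \<in> range C" "A' \<in> range C" for A A'
  proof -
    obtain n m where "A = C n" "A' = C m" using AA' by blast
    then show ?thesis using mono[of n "max n m"] mono[of m "max n m"] by auto
  qed
  obtain U where U: "els U = \<Union>(els ` range C)" "\<And>X M. fg X \<Longrightarrow> X \<le> U * M \<Longrightarrow> \<exists>B\<in>range C. X \<le> B * M"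
    using directed_union[of "range C"] dir by blast
  have "is_ring U"
    using C1 by (intro is_ring_directed_union[OF U(1)]) (auto simp: CC)
  moreover have CU: "C n \<le> U" for n using U(1) by (auto simp: less_eq_asub_def)
  then have "B \<le> U" using CU[of 0] by (simp add: C_def)
  moreover have "U \<noteq> B"
  proof
    assume "U = B"
    have "y \<in> els (1 + gen {y})" by (rule leD_els[OF asub_le_plus(2)]) (auto intro: gen_base)
    then have "1 * y \<in> els (C 1)" using BR unfolding C_def power_one_right
      by (intro mult_els) (auto simp: is_ring_def one_le_iff)
    then show False using CU[of 1] y \<open>U = B\<close> by (auto dest: leD_els)
  qed
  ultimately have "integ u U" using B by (auto simp: max_non_integ_def)
  then obtain M where M: "fg M" "1 \<le> M" "gen {u} * M \<le> U * M" by (auto simp: integ_def)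
  have "fg (gen {u} * M)" by (intro fg_mult fg_gen M) auto
  then obtain n where "gen {u} * M \<le> C n * M" using U(2)[OF _ M(3)] by blast
  then show ?thesis using that M unfolding C_def by blast
qed

text \<open>Maximal subrings over which \<open>u\<close> is not integral behave like valuation rings.\<close>

lemma max_non_integ_dichotomy:
  assumes B: "max_non_integ u B" and yz: "y * z = 1"
  shows "y \<in> els B \<or> z \<in> els B"
proof (rule ccontr)
  assume "\<not> (y \<in> els B \<or> z \<in> els B)"
  then have "y \<notin> els B" "z \<notin> els B" by auto
  let ?y = "gen {y}" and ?z = "gen {z}"
  have BR: "is_ring B" using B by (simp add: max_non_integ_def)
  obtain N1 M1 where M1: "fg M1" "1 \<le> M1" "gen {u} * M1 \<le> B * (1 + ?y) ^ N1 * M1"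
    using max_non_integ_adjoin[OF B \<open>y \<notin> els B\<close>] .
  obtain N2 M2 where M2: "fg M2" "1 \<le> M2" "gen {u} * M2 \<le> B * (1 + ?z) ^ N2 * M2"
    using max_non_integ_adjoin[OF B \<open>z \<notin> els B\<close>] .
  define N where "N = max N1 N2"
  \<comment> \<open>On the summand \<open>(1 + y) ^ N\<close> of \<open>Z\<close> the estimate by
    powers of \<open>z\<close> is applied, on the other summand the estimate by powers of
    \<open>y\<close>. Both produce the mixed product, which lies in \<open>Z\<close> again, so
    \<open>Z * E\<close> witnesses integrality over \<open>B\<close> itself.\<close>
  define Z where "Z = (1 + ?y) ^ N + (1 + ?z) ^ N"
  define E where "E = M1 * M2"
  have yz1: "?y * ?z = 1" using yz by (simp add: gen_singleton_mult gen_one)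
  have le: "(1 + ?y) ^ N * (1 + ?z) ^ N \<le> Z" unfolding Z_def by (rule asub_laurent_power_le[OF yz1])
  have uy: "gen {u} * E \<le> B * (1 + ?y) ^ N * E"
  proof -
    have "gen {u} * E = gen {u} * M1 * M2" by (simp add: E_def mult.assoc)
    also have "\<dots> \<le> B * (1 + ?y) ^ N1 * M1 * M2" by (intro asub_mult_mono M1(3) order.refl)
    also have "\<dots> \<le> B * (1 + ?y) ^ N * M1 * M2"
      by (intro asub_mult_mono asub_power_increasing order.refl) (auto simp: N_def)
    finally show ?thesis by (simp add: E_def mult.assoc)
  qed
  have uz: "gen {u} * E \<le> B * (1 + ?z) ^ N * E"
  proof -
    have "gen {u} * E = gen {u} * M2 * M1" by (simp add: E_def mult_ac)
    also have "\<dots> \<le> B * (1 + ?z) ^ N2 * M2 * M1" by (intro asub_mult_mono M2(3) order.refl)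
    also have "\<dots> \<le> B * (1 + ?z) ^ N * M2 * M1"
      by (intro asub_mult_mono asub_power_increasing order.refl) (auto simp: N_def)
    finally show ?thesis by (simp add: E_def mult_ac)
  qed
  have "gen {u} * (Z * E) = (1 + ?y) ^ N * (gen {u} * E) + (1 + ?z) ^ N * (gen {u} * E)"
    by (simp add: Z_def algebra_simps)
  also have "\<dots> \<le> (1 + ?y) ^ N * (B * (1 + ?z) ^ N * E) + (1 + ?z) ^ N * (B * (1 + ?y) ^ N * E)"
    by (intro asub_plus_mono asub_mult_mono order.refl uy uz)
  also have "\<dots> = B * ((1 + ?y) ^ N * (1 + ?z) ^ N * E)"
    by (simp add: mult_ac)
  also have "\<dots> \<le> B * (Z * E)" by (intro asub_mult_mono order.refl le)
  finally have "gen {u} * (Z * E) \<le> B * (Z * E)" .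
  moreover have "fg (Z * E)"
    unfolding Z_def E_def by (intro fg_mult fg_add fg_power fg_1 fg_gen M1 M2) auto
  moreover have "1 \<le> Z * E"
  proof -
    have "1 \<le> Z" unfolding Z_def by (intro asub_le_plusI1 asub_one_le_power asub_le_plus)
    moreover have "1 \<le> E" using asub_mult_mono[OF M1(2) M2(2)] by (simp add: E_def)
    ultimately show ?thesis using asub_mult_mono[of 1 Z 1 E] by simp
  qed
  ultimately show False using B unfolding max_non_integ_def integ_def by blast
qed

text \<open>
  If \<open>1 = h + i\<close> where \<open>h\<close> is a combination of non-units \<open>y a\<close> of \<open>B\<close> whose inverses lie
  outside \<open>B\<close>, and \<open>i u\<close> has a power in \<open>B\<close>, then \<open>u\<close> is integral: some power of \<open>h\<close> times \<open>u\<close>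
  preserves a finitely generated module.
\<close>

lemma max_non_integ_local:
  assumes B: "max_non_integ u B" and T: "finite T"
    and y: "\<And>a. a \<in> T \<Longrightarrow> y a \<in> els B" "\<And>a. a \<in> T \<Longrightarrow> y a * z a = 1" "\<And>a. a \<in> T \<Longrightarrow> z a \<notin> els B"
    and hi: "1 = h + i" "i \<in> els B" "h \<in> els (B * (\<Sum>a\<in>T. gen {y a}))"
    and R: "R \<ge> 1" "i ^ R * u ^ R \<in> els B"
  shows False
proof -
  have BR: "is_ring B" using B by (simp add: max_non_integ_def)
  have "\<exists>N M. fg M \<and> 1 \<le> M \<and> gen {u} * M \<le> B * (1 + gen {z a}) ^ N * M" if "a \<in> T" for a
    using max_non_integ_adjoin[OF B y(3)[OF that]] by metis
  then obtain N M where M: "\<And>a. a \<in> T \<Longrightarrow> fg (M a)" "\<And>a. a \<in> T \<Longrightarrow> 1 \<le> M a"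
    "\<And>a. a \<in> T \<Longrightarrow> gen {u} * M a \<le> B * (1 + gen {z a}) ^ N a * M a"
    by metis
  define N' where "N' = (\<Sum>a\<in>T. N a)"
  define M' where "M' = (\<Prod>a\<in>T. M a)"
  define U where "U = gen {u}"
  define Y where "Y a = gen {y a}" for a
  have M1: "1 \<le> (\<Prod>a\<in>T'. M a)" if "T' \<subseteq> T" for T'
    using finite_subset[OF that T] that
  proof (induction T' rule: finite_induct)
    case (insert a T')
    then show ?case using asub_mult_mono[of 1 "M a" 1 "\<Prod>a\<in>T'. M a"] M(2)[of a] by auto
  qed simp
  \<comment> \<open>Multiplication with \<open>y a\<close> clears the denominators
    \<open>z a\<close>: the product of \<open>Y a\<close> and \<open>1 + gen {z a}\<close> is
    \<open>Y a + 1\<close>, which is contained in \<open>B\<close>.\<close>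
  have YN: "Y a ^ N' * (U * M') \<le> B * M'" if a: "a \<in> T" for a
  proof -
    have Y1: "Y a \<le> B" using y(1)[OF a] by (simp add: Y_def gen_le_iff)
    have yz: "Y a * gen {z a} = 1" using y(2)[OF a] by (simp add: Y_def gen_singleton_mult gen_one)
    have NN: "N a \<le> N'" unfolding N'_def using T a by (intro member_le_sum) auto
    have Meq: "M' = M a * (\<Prod>a\<in>T - {a}. M a)" unfolding M'_def using T a by (simp add: prod.remove)
    have "Y a ^ N' * (U * M') \<le> Y a ^ N' * ((B * (1 + gen {z a}) ^ N a * M a) * (\<Prod>a\<in>T - {a}. M a))"
      unfolding Meq U_def mult.assoc[symmetric, of "gen {u}"]
      by (intro asub_mult_mono order.refl M(3) a)
    also have "\<dots> \<le> Y a ^ N' * (B * (1 + gen {z a}) ^ N' * M a * (\<Prod>a\<in>T - {a}. M a))"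
      by (intro asub_mult_mono asub_power_increasing order.refl NN) auto
    also have "\<dots> = B * (Y a * (1 + gen {z a})) ^ N' * M'"
      by (simp add: Meq power_mult_distrib mult_ac)
    also have "Y a * (1 + gen {z a}) = Y a + 1" using yz by (simp add: distrib_left)
    also have "B * (Y a + 1) ^ N' * M' \<le> B * B ^ N' * M'"
      using BR Y1 by (intro asub_mult_mono asub_power_mono order.refl) (auto simp: plus_le_iff is_ring_def)
    also have "\<dots> \<le> B * M'"
      using is_ring_power[OF BR, of N'] asub_mult_mono[of B B "B ^ N'" B] is_ring_mult[OF BR]
      by (intro asub_mult_mono) auto
    finally show ?thesis .
  qed
  define H where "H = gen {h}"
  define I where "I = gen {i}"
  \<comment> \<open>Among \<open>card T * N'\<close> factors some \<open>y a\<close> occurs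
    \<open>N'\<close> times. The additional factor makes the power of \<open>h\<close> vanish when
    \<open>T\<close> is empty, since then \<open>h = 0\<close>; otherwise it is absorbed by
    \<open>B\<close>.\<close>
  define K where "K = card T * N' + 1"
  have "h = 1 - i" using hi(1) by (simp add: eq_diff_eq)
  then have hB: "h \<in> els B" using hi(2) BR diff_els[of 1 B i] by (simp add: is_ring_def one_le_iff)
  have HB: "H \<le> B" and IB: "I \<le> B" using hB hi(2) by (auto simp: H_def I_def gen_le_iff)
  have HY: "H \<le> B * sum Y T" using hi(3) by (simp add: H_def gen_le_iff Y_def)
  have HK: "H ^ K * (U * M') \<le> B * M'"
  proof (cases "T = {}")
    case True
    then have "H \<le> 0" using HY by simp
    then have "H = 0" by (simp add: order.antisym)
    then show ?thesis by (simp add: K_def)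
  next
    case False
    have "H ^ K = H * H ^ (card T * N')" by (simp add: K_def)
    also have "\<dots> \<le> B * (B * sum Y T) ^ (card T * N')"
      by (intro asub_mult_mono asub_power_mono HY HB)
    also have "\<dots> = B * B ^ (card T * N') * sum Y T ^ (card T * N')"
      by (simp add: power_mult_distrib mult_ac)
    also have "\<dots> \<le> B * sum Y T ^ (card T * N')"
      using asub_mult_mono[OF order.refl is_ring_power[OF BR], of B] is_ring_mult[OF BR]
      by (intro asub_mult_mono) auto
    also have "\<dots> \<le> B * (\<Sum>a\<in>T. Y a ^ N' * sum Y T ^ ((card T - 1) * N'))"
      by (intro asub_mult_mono order.refl asub_sum_power_le T False)
    also have "\<dots> \<le> B * (\<Sum>a\<in>T. Y a ^ N' * B)"
    proof (intro asub_mult_mono order.refl asub_sum_mono)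
      have "sum Y T \<le> B" using y(1) T by (auto simp: asub_sum_le_iff Y_def gen_le_iff)
      then show "sum Y T ^ ((card T - 1) * N') \<le> B"
        using is_ring_power[OF BR] asub_power_mono order.trans by blast
    qed
    finally have "H ^ K * (U * M') \<le> B * (\<Sum>a\<in>T. Y a ^ N' * B) * (U * M')"
      by (rule asub_mult_mono) simp
    also have "\<dots> = (\<Sum>a\<in>T. B * B * (Y a ^ N' * (U * M')))"
      by (simp add: sum_distrib_left sum_distrib_right mult_ac)
    also have "\<dots> \<le> B * M'"
      unfolding asub_sum_le_iff[OF T]
    proof
      fix a assume "a \<in> T"
      have "B * B * (Y a ^ N' * (U * M')) \<le> B * (B * M')"
        unfolding is_ring_mult[OF BR] by (intro asub_mult_mono order.refl YN \<open>a \<in> T\<close>)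
      then show "B * B * (Y a ^ N' * (U * M')) \<le> B * M'"
        by (simp add: mult.assoc[symmetric] is_ring_mult[OF BR])
    qed
    finally show ?thesis .
  qed
  have HKn: "(H ^ K * U) ^ n * M' \<le> B * M'" for n
  proof (induction n)
    case 0
    show ?case using asub_mult_mono[of 1 B M' M'] BR by (simp add: is_ring_def)
  next
    case (Suc n)
    have "(H ^ K * U) ^ Suc n * M' = (H ^ K * U) * ((H ^ K * U) ^ n * M')" by (simp add: mult_ac)
    also have "\<dots> \<le> (H ^ K * U) * (B * M')" by (intro asub_mult_mono order.refl Suc.IH)
    also have "\<dots> = B * (H ^ K * (U * M'))" by (simp add: mult_ac)
    also have "\<dots> \<le> B * (B * M')" by (intro asub_mult_mono order.refl HK)
    finally show ?case by (simp add: mult.assoc[symmetric] is_ring_mult[OF BR])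
  qed
  have IU: "I ^ R * U ^ R \<le> B"
    using R(2) by (simp add: I_def U_def gen_singleton_power gen_singleton_mult gen_le_iff)
  have "h + i \<in> els (H + I)"
    using gen_base[of h "{h}"] gen_base[of i "{i}"] leD_els[OF asub_le_plus(1), of h H I]
      leD_els[OF asub_le_plus(2), of i I H] by (auto simp: H_def I_def intro: add_els)
  then have "1 \<le> H + I" using hi(1) by (simp add: one_le_iff)
  \<comment> \<open>Every term of the expansion of \<open>(h + i) ^ (K * R + R)\<close> contains
    \<open>h ^ (K * R)\<close> or \<open>i ^ R\<close>, and the product of either with
    \<open>u ^ R\<close> maps \<open>M'\<close> into \<open>B * M'\<close>.\<close>
  then have "1 \<le> (H + I) ^ (K * R + R)" by (rule asub_one_le_power)
  also have "\<dots> \<le> H ^ (K * R) * (H + I) ^ R + I ^ R * (H + I) ^ (K * R)"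
    by (rule asub_power_add_le)
  also have "\<dots> \<le> H ^ (K * R) * B + I ^ R * B"
    using HB IB
    by (intro asub_plus_mono asub_mult_mono order.refl order.trans[OF asub_power_mono is_ring_power[OF BR]])
      (auto simp: plus_le_iff)
  finally have "1 * (U ^ R * M') \<le> (H ^ (K * R) * B + I ^ R * B) * (U ^ R * M')"
    by (rule asub_mult_mono) simp
  also have "\<dots> = B * ((H ^ K * U) ^ R * M') + B * (I ^ R * U ^ R) * M'"
    by (simp add: power_mult_distrib power_mult algebra_simps)
  also have "\<dots> \<le> B * (B * M') + B * B * M'"
    by (intro asub_plus_mono asub_mult_mono order.refl HKn IU)
  also have "\<dots> = B * M'" by (simp add: mult.assoc[symmetric] is_ring_mult[OF BR])
  finally have "gen {u} ^ R * M' \<le> B * (1 * M')" by (simp add: U_def)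
  also have "\<dots> \<le> B * ((\<Sum>k<R. gen {u} ^ k) * M')"
    using R(1) asub_le_sum[of "{..<R}" 0 "\<lambda>k. gen {u} ^ k"] by (intro asub_mult_mono order.refl) simp
  finally have "gen {u} ^ R * M' \<le> B * ((\<Sum>k<R. gen {u} ^ k) * M')" .
  moreover have "fg M'" unfolding M'_def by (intro fg_prod M(1)) auto
  moreover have "1 \<le> M'" unfolding M'_def by (rule M1) auto
  ultimately have "integ u B" using integ_power_in[OF BR _ _ R(1)] by blast
  then show False using B by (simp add: max_non_integ_def)
qed

section \<open>Integrality over the graded ring of the polytope\<close>

abbreviation pcst :: "complex \<Rightarrow> 'n::finite laurent_ring poly"
  where "pcst c \<equiv> [:cst c:]"

interpretation laurent_poly: scalars "pcst :: complex \<Rightarrow> 'n::finite laurent_ring poly"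
  by standard (simp_all add: single_diff mult_single one_pCons mult.commute)

abbreviation pmon :: "int ^ 'n::finite \<Rightarrow> 'n laurent_ring poly"
  where "pmon a \<equiv> [:laurent_monom a:]"

definition nsc :: "nat \<Rightarrow> int ^ 'n \<Rightarrow> int ^ 'n::finite"
  where "nsc k a = (\<chi> j. int k * a $ j)"

lemma int_vec_nsc [simp]: "int_vec (nsc k a) = real k *\<^sub>R int_vec a"
  by (simp add: nsc_def int_vec_def vec_eq_iff)

lemma laurent_monom_nsc: "laurent_monom (nsc k a) = laurent_monom a ^ k"
proof (induction k)
  case 0
  have "nsc 0 a = 0" by (simp add: nsc_def vec_eq_iff)
  then show ?case by simp
next
  case (Suc k)
  have "nsc (Suc k) a = a + nsc k a" by (simp add: nsc_def vec_eq_iff algebra_simps)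
  then show ?case using Suc by (simp add: laurent_monom_add)
qed

lemma pmon_add: "pmon (a + b) = pmon a * pmon b"
  by (simp add: laurent_monom_add)

lemma const_poly_prod: "[:\<Prod>i\<in>I. x i:] = (\<Prod>i\<in>I. [:x i :: 'a::comm_ring_1:])"
proof (induction I rule: infinite_finite_induct)
  case (insert i I)
  have "[:x i * (\<Prod>i\<in>I. x i):] = [:x i:] * [:\<Prod>i\<in>I. x i:]" by simp
  then show ?case using insert by simp
qed (simp_all add: one_pCons)

definition graded_piece :: "'a::comm_ring_1 poly asub \<Rightarrow> nat \<Rightarrow> 'a asub"
  where "graded_piece B k = Asub {x. monom x k \<in> els B}"

lemma els_graded_piece: "els (graded_piece B k) = {x. monom x k \<in> els B}"
  unfolding graded_piece_def by (rule els_Asub) (auto simp: diff_monom[symmetric] intro: diff_els)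

lemma graded_piece_mult:
  assumes "is_ring B" shows "graded_piece B k * graded_piece B l \<le> graded_piece B (k + l)"
  unfolding times_le_iff els_graded_piece
  using assms by (auto simp: mult_monom[symmetric] is_ring_def intro: leD_els mult_els)

lemma graded_piece_power:
  assumes "is_ring B" "X \<le> graded_piece B k" shows "X ^ n \<le> graded_piece B (k * n)"
proof (induction n)
  case 0
  show ?case using assms(1) by (simp add: one_le_iff els_graded_piece is_ring_def)
next
  case (Suc n)
  have "X * X ^ n \<le> graded_piece B k * graded_piece B (k * n)"
    by (intro asub_mult_mono assms Suc)
  then show ?case using graded_piece_mult[OF assms(1), of k "k * n"] by simp
qed

lemma graded_piece_multI:
  assumes "is_ring B" "X \<le> graded_piece B k" "Y \<le> graded_piece B l"
  shows "X * Y \<le> graded_piece B (k + l)"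
  using asub_mult_mono[OF assms(2,3)] graded_piece_mult[OF assms(1)] order.trans by blast

lemma const_poly_sum: "[:\<Sum>i\<in>I. x i:] = (\<Sum>i\<in>I. [:x i :: 'a::comm_ring_1:])"
proof (induction I rule: infinite_finite_induct)
  case (insert i I)
  have "[:x i + (\<Sum>i\<in>I. x i):] = [:x i:] + [:\<Sum>i\<in>I. x i:]" by simp
  then show ?case using insert by simp
qed simp_all

text \<open>Here \<open>e\<close> is the enlarged factor. By \<open>e_rat\<close> some
  \<open>(e - 1) * R\<close> is an integer \<open>K\<close>, so \<open>K\<close> times a vertex is a
  lattice point of that multiple of \<open>P\<close>. Laurent polynomials are used throughout since
  every monomial needs an inverse.\<close>

locale toric_data =
  fixes P :: "(real ^ 'n::finite) set" and J :: "nat set" and f :: "nat \<Rightarrow> 'n laurent_ring"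
    and \<phi> :: "'n laurent_ring" and e :: real
  assumes P: "lattice_polytope P" and P_orthant: "P \<subseteq> orthant" and P_0: "0 \<in> P"
    and J: "finite J" and f: "\<And>j. j \<in> J \<Longrightarrow> Poly_Mapping.keys (f j) \<subseteq> latt P 1"
    and \<phi>: "Poly_Mapping.keys \<phi> \<subseteq> latt P e" and e: "e > 1"
    and e_rat: "\<exists>R K :: nat. R \<ge> 1 \<and> real K = real R * (e - 1)"
begin

abbreviation "C0 \<equiv> laurent.sca (UNIV :: complex set) :: 'n laurent_ring asub"
abbreviation "C1 \<equiv> laurent_poly.sca (UNIV :: complex set) :: 'n laurent_ring poly asub"

text \<open>
  \<open>A0\<close> consists of the polynomials \<open>\<Sum>k. g\<^sub>k y\<^sup>k\<close> with \<open>g\<^sub>k\<close> in the \<open>k\<close>-th power of the ideal and of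
  support degree \<open>e k\<close>. Integrality of \<open>u = \<phi> y\<close> over \<open>A0\<close> is integral dependence of \<open>\<phi>\<close> on the
  ideal with the optimal supports.
\<close>

definition "V0 = gen (f ` J)"
definition "S0 d = mon (latt P d)"
text \<open>Only integer combinations of products of the \<open>f j\<close> with monomials. The
  constants form a separate factor of \<open>A0\<close>, which is later replaced by a finitely
  generated ring.\<close>

definition "A00 = Asub {g. \<forall>k. coeff g k \<in> els (V0 ^ k * S0 ((e - 1) * k))}"
definition "A0 = C1 * A00"
definition "u = monom \<phi> 1"

lemmas convex_P = lattice_polytope_props(1)[OF P] and compact_P = lattice_polytope_props(2)[OF P]

lemma S0_mult: "d \<ge> 0 \<Longrightarrow> d' \<ge> 0 \<Longrightarrow> S0 d * S0 d' \<le> S0 (d + d')"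
  unfolding S0_def mon_times using latt_add[OF convex_P] by (intro mon_mono) auto

lemma one_le_S0: "1 \<le> S0 d"
  unfolding S0_def by (intro one_le_mon zero_latt P_0)

lemma S0_mono: "0 \<le> d \<Longrightarrow> d \<le> d' \<Longrightarrow> S0 d \<le> S0 d'"
  unfolding S0_def by (intro mon_mono latt_mono convex_P P_0)

lemma S0_power: "d \<ge> 0 \<Longrightarrow> S0 d ^ k \<le> S0 (d * real k)"
proof (induction k)
  case (Suc k)
  have "S0 d * S0 d ^ k \<le> S0 d * S0 (d * k)" using Suc by (intro asub_mult_mono) auto
  also have "\<dots> \<le> S0 (d + d * k)" using Suc by (intro S0_mult) auto
  finally show ?case by (simp add: algebra_simps)
qed (use one_le_S0 in auto)

lemma els_A00: "els A00 = {g. \<forall>k. coeff g k \<in> els (V0 ^ k * S0 ((e - 1) * k))}"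
  unfolding A00_def by (rule els_Asub) (auto intro: diff_els)

lemma is_ring_A00: "is_ring A00"
  unfolding is_ring_def one_le_iff times_le_iff els_A00
proof (intro conjI ballI CollectI allI)
  show "coeff 1 k \<in> els (V0 ^ k * S0 ((e - 1) * k))" for k
    using one_le_S0[of 0] by (cases k) (auto simp: one_le_iff)
  fix g h :: "'n laurent_ring poly" and k
  assume gh: "g \<in> {g. \<forall>k. coeff g k \<in> els (V0 ^ k * S0 ((e - 1) * k))}"
    "h \<in> {g. \<forall>k. coeff g k \<in> els (V0 ^ k * S0 ((e - 1) * k))}"
  show "coeff (g * h) k \<in> els (V0 ^ k * S0 ((e - 1) * k))"
    unfolding coeff_mult
  proof (rule sum_els)
    fix i assume i: "i \<in> {..k}"
    have Vk: "V0 ^ k = V0 ^ i * V0 ^ (k - i)" using i by (simp add: power_add[symmetric])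
    have "(V0 ^ i * S0 ((e - 1) * i)) * (V0 ^ (k - i) * S0 ((e - 1) * real (k - i)))
        = V0 ^ k * (S0 ((e - 1) * i) * S0 ((e - 1) * real (k - i)))"
      unfolding Vk by (simp add: mult_ac)
    also have "\<dots> \<le> V0 ^ k * S0 ((e - 1) * i + (e - 1) * real (k - i))"
      using e by (intro asub_mult_mono order.refl S0_mult) auto
    also have "(e - 1) * i + (e - 1) * real (k - i) = (e - 1) * k"
      using i by (simp add: of_nat_diff algebra_simps)
    finally show "coeff g i * coeff h (k - i) \<in> els (V0 ^ k * S0 ((e - 1) * k))"
      using gh by (intro leD_els[OF _ mult_els]) auto
  qed
qed

lemma is_ring_C1: "is_ring C1"
  by (simp add: is_ring_def laurent_poly.one_le_sca laurent_poly.sca_mult[OF subring_UNIV])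

lemma is_ring_A0: "is_ring A0"
proof -
  have "A0 * A0 = (C1 * C1) * (A00 * A00)" by (simp add: A0_def mult_ac)
  then have "A0 * A0 = A0" by (simp add: is_ring_mult[OF is_ring_C1] is_ring_mult[OF is_ring_A00] A0_def)
  moreover have "1 \<le> A0"
    using is_ring_C1 is_ring_A00 asub_mult_mono[of 1 C1 1 A00] by (simp add: A0_def is_ring_def)
  ultimately show ?thesis by (simp add: is_ring_def)
qed

lemma A0_pieces:
  assumes B: "A0 \<le> B"
  shows "V0 ^ k * S0 ((e - 1) * k) \<le> graded_piece B k" "C0 \<le> graded_piece B 0" "V0 \<le> graded_piece B 1"
proof -
  have A00: "A00 \<le> A0" using is_ring_C1 asub_le_mult_one[of C1 A00] by (simp add: A0_def is_ring_def mult.commute)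
  have C1: "C1 \<le> A0" using is_ring_A00 asub_le_mult_one[of A00 C1] by (simp add: A0_def is_ring_def)
  show *: "V0 ^ k * S0 ((e - 1) * k) \<le> graded_piece B k" for k
  proof (rule leI_els)
    fix x assume "x \<in> els (V0 ^ k * S0 ((e - 1) * k))"
    then have "monom x k \<in> els A00" by (auto simp: els_A00)
    then show "x \<in> els (graded_piece B k)"
      using leD_els[OF order.trans[OF A00 B]] by (simp add: els_graded_piece)
  qed
  show "C0 \<le> graded_piece B 0"
    unfolding laurent.sca_def gen_le_iff els_graded_piece
  proof
    fix x :: "'n laurent_ring" assume "x \<in> cst ` UNIV"
    then obtain c where "x = cst c" by blast
    moreover have "pcst c \<in> els C1" by (rule laurent_poly.s_in_sca) simp
    ultimately show "x \<in> {x. monom x 0 \<in> els B}" using leD_els[OF order.trans[OF C1 B]] by (simp add: monom_0)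
  qed
  show "V0 \<le> graded_piece B 1"
    using *[of 1] asub_le_mult_one[OF one_le_S0, of V0 "(e - 1) * 1"] by (auto intro: order.trans)
qed

definition exps :: "'n laurent_ring poly asub \<Rightarrow> (int ^ 'n) set"
  where "exps B = {m. pmon m \<in> els B}"

lemma mon_exps: "mon (exps B) \<le> graded_piece B 0"
  by (auto simp: mon_def gen_le_iff els_graded_piece exps_def monom_0)

text \<open>A valuative criterion. A cone belongs to \<open>Q\<close> when \<open>B\<close> contains
  its chart ring. Completeness of the fan provides such a cone, and for a minimal one the monomials
  in \<open>h\<close>, which vanish on its closed orbit, are non-units of \<open>B\<close>.\<close>

lemma integ_u:
  assumes fan: "complete_fan \<Delta>"
    and at_infinity: "\<And>\<sigma>. \<sigma> \<in> \<Delta> \<Longrightarrow> \<not> \<sigma> \<subseteq> orthant \<Longrightarrow> \<exists>v g h. cone_vertex P \<sigma> v \<and>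
      1 = (\<Sum>j\<in>J. laurent_monom (- v) * f j * g j) + h \<and>
      (\<forall>j\<in>J. laurent_supp (g j) \<subseteq> dual_cone \<sigma>) \<and> laurent_supp h \<subseteq> dual_cone \<sigma> \<and>
      (\<forall>a\<in>Poly_Mapping.keys h. \<exists>x\<in>\<sigma>. x \<bullet> int_vec a > 0)"
    and affine: "r \<ge> 1" "\<phi> ^ r + (\<Sum>k=1..r. H k * \<phi> ^ (r - k)) = 0"
      "\<And>k. k \<in> {1..r} \<Longrightarrow> H k \<in> els (C0 * V0 ^ k * mon {\<alpha>. \<forall>j. 0 \<le> \<alpha> $ j})"
  shows "integ u A0"
proof (rule ccontr)
  assume "\<not> integ u A0"
  then obtain B where B: "A0 \<le> B" "max_non_integ u B"
    using exists_max_non_integ[OF is_ring_A0] by blast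
  have BR: "is_ring B" using B(2) by (simp add: max_non_integ_def)
  note pieces = A0_pieces[OF B(1)]
  have B_mult: "x * y \<in> els B" if "x \<in> els B" "y \<in> els B" for x y
    using that mult_els[of x B y B] is_ring_mult[OF BR] by simp
  have B1: "1 \<in> els B" using BR by (simp add: is_ring_def one_le_iff)
  have B_pow: "x ^ k \<in> els B" if "x \<in> els B" for x k
    using that by (induction k) (auto intro: B_mult B1)
  let ?D = "exps B"
  have D_add: "a + b \<in> ?D" if "a \<in> ?D" "b \<in> ?D" for a b
    using that B_mult unfolding exps_def by (simp only: pmon_add mem_Collect_eq)
  have D_nsc: "nsc k a \<in> ?D" if "a \<in> ?D" for k a
    using B_pow[of "pmon a" k] that by (simp add: exps_def laurent_monom_nsc poly_const_pow)
  have pinv: "pmon a * pmon (- a) = 1" for a :: "int ^ 'n"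
    by (simp only: pmon_add[symmetric]) (simp add: one_pCons)
  have D_total: "a \<in> ?D \<or> - a \<in> ?D" for a
    using max_non_integ_dichotomy[OF B(2) pinv[of a]] by (simp add: exps_def)
  have fin\<Delta>: "finite \<Delta>" and cov: "\<Union>\<Delta> = UNIV" and cones: "\<And>\<sigma>. \<sigma> \<in> \<Delta> \<Longrightarrow> lattice_cone \<sigma>"
    and faces: "\<And>\<sigma> \<tau>. \<sigma> \<in> \<Delta> \<Longrightarrow> \<tau> face_of \<sigma> \<Longrightarrow> \<tau> \<noteq> {} \<Longrightarrow> \<tau> \<in> \<Delta>"
    using fan by (auto simp: complete_fan_def)
  define Q where "Q = {\<sigma>\<in>\<Delta>. \<forall>m. int_vec m \<in> dual_cone \<sigma> \<longrightarrow> m \<in> ?D}"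
  have finQ: "finite Q" using fin\<Delta> by (simp add: Q_def)
  \<comment> \<open>If every cone failed, each would have an exponent in its dual cone but outside
    \<open>?D\<close>. As the cones cover the space, these exponents satisfy the hypothesis of
    \<open>integer_dependence\<close>.\<close>
  have "Q \<noteq> {}"
  proof
    assume "Q = {}"
    then have "\<forall>\<sigma>\<in>\<Delta>. \<exists>m. int_vec m \<in> dual_cone \<sigma> \<and> m \<notin> ?D" by (auto simp: Q_def)
    then obtain m where m: "\<And>\<sigma>. \<sigma> \<in> \<Delta> \<Longrightarrow> int_vec (m \<sigma>) \<in> dual_cone \<sigma>" "\<And>\<sigma>. \<sigma> \<in> \<Delta> \<Longrightarrow> m \<sigma> \<notin> ?D"
      by metis
    let ?M = "m ` \<Delta>"
    have cov': "\<exists>a\<in>?M. x \<bullet> int_vec a \<ge> 0" for x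
    proof -
      obtain \<sigma> where "\<sigma> \<in> \<Delta>" "x \<in> \<sigma>" using cov by blast
      then show ?thesis using m(1)[of \<sigma>] by (auto simp: dual_cone_def)
    qed
    obtain l m0 where l: "m0 \<in> ?M" "l m0 \<noteq> 0" "\<And>j. (\<Sum>a\<in>?M. int (l a) * a $ j) = 0"
      by (rule integer_dependence[OF finite_imageI[OF fin\<Delta>] cov']) (rule that)
    have neg: "pmon (- a) \<in> els B" if "a \<in> ?M" for a
      using D_total[of a] m(2) that by (auto simp: exps_def)
    \<comment> \<open>The dependence solved for \<open>m0\<close>: the negatives of all these
      exponents lie in \<open>?D\<close>, and \<open>m0\<close> is a sum of \<open>l m0 - 1\<close>
      copies of \<open>- m0\<close> and of negatives of the others.\<close>
    define X where "X = pmon (- m0) ^ (l m0 - 1) * (\<Prod>a\<in>?M - {m0}. pmon (- a) ^ l a)"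
    have "X \<in> els B"
    proof -
      have "(\<Prod>a\<in>T. pmon (- a) ^ l a) \<in> els B" if "T \<subseteq> ?M" for T
        using finite_subset[OF that finite_imageI[OF fin\<Delta>]] that
        by (induction T rule: finite_induct) (auto intro!: B_mult B_pow B1 neg)
      then show ?thesis unfolding X_def by (intro B_mult B_pow neg l) auto
    qed
    have "(\<Sum>a\<in>?M. nsc (l a) (- a)) = 0"
      using l(3) by (simp add: vec_eq_iff nsc_def sum_negf)
    then have "1 = laurent_monom (\<Sum>a\<in>?M. nsc (l a) (- a))" by simp
    also have "\<dots> = (\<Prod>a\<in>?M. laurent_monom (- a) ^ l a)" by (simp add: laurent_monom_sum laurent_monom_nsc)
    finally have "[:1:] = [:\<Prod>a\<in>?M. laurent_monom (- a) ^ l a:]" by simp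
    also have "\<dots> = (\<Prod>a\<in>?M. pmon (- a) ^ l a)" by (simp add: const_poly_prod poly_const_pow)
    also have "\<dots> = pmon (- m0) ^ l m0 * (\<Prod>a\<in>?M - {m0}. pmon (- a) ^ l a)"
      using l(1) fin\<Delta> by (intro prod.remove) auto
    also have "\<dots> = pmon (- m0) * X"
      using l(2) unfolding X_def by (cases "l m0") (auto simp: mult.assoc)
    finally have "pmon m0 * (pmon (- m0) * X) = pmon m0" by (simp add: one_pCons[symmetric])
    then have "pmon m0 = X" unfolding mult.assoc[symmetric] pinv by simp
    then have "m0 \<in> ?D" using \<open>X \<in> els B\<close> by (simp add: exps_def)
    then show False using l(1) m(2) by auto
  qed
  then obtain \<sigma> where \<sigma>: "\<sigma> \<in> Q" "\<And>\<rho>. \<rho> \<in> Q \<Longrightarrow> \<rho> \<subseteq> \<sigma> \<Longrightarrow> \<rho> = \<sigma>"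
    using finite_has_minimal[of Q] finQ by metis
  have \<sigma>\<Delta>: "\<sigma> \<in> \<Delta>" and \<sigma>D: "\<And>m. int_vec m \<in> dual_cone \<sigma> \<Longrightarrow> m \<in> ?D" using \<sigma>(1) by (auto simp: Q_def)
  have u_pow: "gen {u} ^ k = gen {monom (\<phi> ^ k) k}" for k
    by (simp add: u_def gen_singleton_power monom_power)
  show False
  proof (cases "\<sigma> \<subseteq> orthant")
    case True
    \<comment> \<open>Over a cone inside the orthant \<open>B\<close> contains all polynomials, and
      the equation for \<open>\<phi>\<close>, homogenized with powers of \<open>y\<close>, is an
      equation for \<open>u\<close> over \<open>B\<close>.\<close>
    let ?N = "{\<alpha> :: int ^ 'n. \<forall>j. 0 \<le> \<alpha> $ j}"
    have "?N \<subseteq> ?D"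
    proof
      fix a assume a: "a \<in> ?N"
      have "x \<bullet> int_vec a \<ge> 0" if "x \<in> \<sigma>" for x
        using a True that by (auto simp: inner_int_vec orthant_def intro!: sum_nonneg)
      then show "a \<in> ?D" by (intro \<sigma>D) (auto simp: dual_cone_def)
    qed
    then have N: "mon ?N \<le> graded_piece B 0" using mon_mono mon_exps order.trans by blast
    have Hk: "monom (H k) k \<in> els B" if "k \<in> {1..r}" for k
    proof -
      have "C0 * V0 ^ k * mon ?N \<le> graded_piece B (0 + 1 * k + 0)"
        by (intro graded_piece_multI graded_piece_power pieces N BR)
      from leD_els[OF this affine(3)[OF that]] show ?thesis by (simp add: els_graded_piece)
    qed
    have "\<phi> ^ r = - (\<Sum>k=1..r. H k * \<phi> ^ (r - k))" using affine(2) by (simp add: eq_neg_iff_add_eq_0)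
    then have "monom (\<phi> ^ r) r = - (\<Sum>k=1..r. monom (H k * \<phi> ^ (r - k)) r)"
      by (simp add: minus_monom[symmetric] monom_sum)
    also have "\<dots> = - (\<Sum>k=1..r. monom (H k) k * monom (\<phi> ^ (r - k)) (r - k))"
      by (simp add: mult_monom)
    finally have eq: "monom (\<phi> ^ r) r = - (\<Sum>k=1..r. monom (H k) k * monom (\<phi> ^ (r - k)) (r - k))" .
    have "monom (\<phi> ^ r) r \<in> els (B * (\<Sum>k<r. gen {u} ^ k))"
      unfolding eq
    proof (intro uminus_els sum_els mult_els Hk)
      fix k assume k: "k \<in> {1..r}"
      have "gen {u} ^ (r - k) \<le> (\<Sum>k<r. gen {u} ^ k)" using k by (intro asub_le_sum) auto
      then show "monom (\<phi> ^ (r - k)) (r - k) \<in> els (\<Sum>k<r. gen {u} ^ k)"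
        unfolding u_pow gen_le_iff by auto
    qed
    then have "gen {u} ^ r * 1 \<le> B * ((\<Sum>k<r. gen {u} ^ k) * 1)" by (simp add: u_pow gen_le_iff)
    then have "integ u B" by (intro integ_power_in[OF BR fg_1 order.refl affine(1)])
    then show False using B(2) by (simp add: max_non_integ_def)
  next
    case False
    obtain v g h where v: "cone_vertex P \<sigma> v" and one: "1 = (\<Sum>j\<in>J. laurent_monom (- v) * f j * g j) + h"
      and g: "\<And>j. j \<in> J \<Longrightarrow> laurent_supp (g j) \<subseteq> dual_cone \<sigma>" and h: "laurent_supp h \<subseteq> dual_cone \<sigma>"
      and hpos: "\<And>a. a \<in> Poly_Mapping.keys h \<Longrightarrow> \<exists>x\<in>\<sigma>. x \<bullet> int_vec a > 0"
      using at_infinity[OF \<sigma>\<Delta> False]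
      by (elim exE conjE) (rule that, assumption, assumption, erule (1) bspec, assumption, erule (1) bspec)
    define T where "T = Poly_Mapping.keys h"
    define i where "i = (\<Sum>j\<in>J. laurent_monom (- v) * f j * g j)"
    have TD: "a \<in> ?D" if "a \<in> T" for a
      using that h by (intro \<sigma>D) (auto simp: T_def laurent_supp_def)
    \<comment> \<open>If \<open>- a\<close> were an exponent of \<open>B\<close> as well, the face
      \<open>\<rho>\<close> of \<open>\<sigma>\<close> where \<open>a\<close> vanishes would belong
      to \<open>Q\<close>: points of its dual cone enter the dual cone of \<open>\<sigma>\<close>
      after adding a multiple of \<open>a\<close>. Minimality gives
      \<open>\<rho> = \<sigma>\<close>, although \<open>a\<close> is positive somewhere on
      \<open>\<sigma>\<close>.\<close>
    have TnD: "- a \<notin> ?D" if a: "a \<in> T" for a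
    proof
      assume aD: "- a \<in> ?D"
      have a0: "x \<bullet> int_vec a \<ge> 0" if "x \<in> \<sigma>" for x
        using that h a by (auto simp: T_def laurent_supp_def dual_cone_def)
      obtain S where S: "finite S" "\<sigma> = convex_cone hull (int_vec ` S)"
        using cones[OF \<sigma>\<Delta>] by (auto simp: lattice_cone_def)
      define \<rho> where "\<rho> = \<sigma> \<inter> {x. int_vec a \<bullet> x = 0}"
      have "convex \<sigma>" unfolding S(2) by (rule convex_convex_cone_hull)
      then have "\<rho> face_of \<sigma>"
        unfolding \<rho>_def using a0 by (intro face_of_Int_supporting_hyperplane_ge) (auto simp: inner_commute)
      moreover have "0 \<in> \<rho>" by (auto simp: \<rho>_def S(2) convex_cone_hull_contains_0)
      ultimately have "\<rho> \<in> \<Delta>" using faces[OF \<sigma>\<Delta>] by blast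
      moreover have "m \<in> ?D" if m: "int_vec m \<in> dual_cone \<rho>" for m
      proof -
        \<comment> \<open>On an integral generator where \<open>a\<close> is positive it is at least
          \<open>1\<close>, so \<open>k\<close> copies outweigh the value of \<open>m\<close>. A
          generator where \<open>a\<close> is zero lies in \<open>\<rho>\<close>.\<close>
        define k where "k = nat \<lceil>\<Sum>s\<in>S. \<bar>int_vec s \<bullet> (int_vec m :: real ^ 'n)\<bar>\<rceil>"
        have "int_vec s \<bullet> (int_vec (m + nsc k a) :: real ^ 'n) \<ge> 0" if s: "s \<in> S" for s
        proof -
          have s\<sigma>: "int_vec s \<in> \<sigma>" unfolding S(2) using s by (intro hull_inc) auto
          show ?thesis
          proof (cases "int_vec s \<bullet> (int_vec a :: real ^ 'n) = 0")
            case True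
            then have "int_vec s \<in> \<rho>" using s\<sigma> by (simp add: \<rho>_def inner_commute)
            then show ?thesis using m True by (auto simp: dual_cone_def inner_add_right)
          next
            case False
            have "int_vec s \<bullet> (int_vec a :: real ^ 'n) = of_int (\<Sum>j\<in>UNIV. s $ j * a $ j)"
              unfolding inner_int_vec by (simp add: int_vec_def)
            moreover have "int_vec s \<bullet> (int_vec a :: real ^ 'n) > 0" using False a0[OF s\<sigma>] by linarith
            ultimately have "(\<Sum>j\<in>UNIV. s $ j * a $ j) \<ge> 1"
              and eq: "int_vec s \<bullet> (int_vec a :: real ^ 'n) = of_int (\<Sum>j\<in>UNIV. s $ j * a $ j)" by linarith+
            then have sa: "int_vec s \<bullet> (int_vec a :: real ^ 'n) \<ge> 1" unfolding eq by linarith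
            have "\<bar>int_vec s \<bullet> (int_vec m :: real ^ 'n)\<bar> \<le> (\<Sum>s\<in>S. \<bar>int_vec s \<bullet> (int_vec m :: real ^ 'n)\<bar>)"
              using S(1) s by (intro member_le_sum) auto
            then have "\<bar>int_vec s \<bullet> (int_vec m :: real ^ 'n)\<bar> \<le> real k" unfolding k_def by linarith
            moreover have "real k * 1 \<le> real k * (int_vec s \<bullet> (int_vec a :: real ^ 'n))"
              using sa by (intro mult_left_mono) auto
            ultimately show ?thesis by (simp add: inner_add_right)
          qed
        qed
        then have "int_vec ` S \<subseteq> {x. int_vec (m + nsc k a) \<bullet> x \<ge> 0}"
          by (auto simp: inner_commute simp del: int_vec_simps int_vec_nsc)
        then have "\<sigma> \<subseteq> {x. int_vec (m + nsc k a) \<bullet> x \<ge> 0}"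
          unfolding S(2) by (intro hull_minimal convex_cone_halfspace_ge)
        then have "m + nsc k a \<in> ?D"
          by (intro \<sigma>D) (auto simp: dual_cone_def inner_commute simp del: int_vec_simps int_vec_nsc)
        moreover have "nsc k (- a) \<in> ?D" by (rule D_nsc[OF aD])
        moreover have "m = (m + nsc k a) + nsc k (- a)" by (simp add: nsc_def vec_eq_iff)
        ultimately show ?thesis using D_add by metis
      qed
      ultimately have "\<rho> \<in> Q" by (simp add: Q_def)
      then have "\<rho> = \<sigma>" using \<sigma>(2) by (simp add: \<rho>_def)
      then have "x \<bullet> int_vec a = 0" if "x \<in> \<sigma>" for x
        using that unfolding \<rho>_def by (auto simp: inner_commute)
      then show False using hpos[of a] a by (fastforce simp: T_def)
    qed
    have h_sum: "h = (\<Sum>a\<in>T. cst (coef h a) * laurent_monom a)"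
      unfolding T_def by (rule laurent_sum_monom) auto
    have hB: "[:h:] \<in> els (B * (\<Sum>a\<in>T. gen {pmon a}))"
    proof -
      have "[:h:] = [:\<Sum>a\<in>T. cst (coef h a) * laurent_monom a:]" using h_sum by simp
      also have "\<dots> = (\<Sum>a\<in>T. pcst (coef h a) * pmon a)"
        unfolding const_poly_sum by (intro sum.cong refl) (simp add: mult.commute)
      finally have "[:h:] = (\<Sum>a\<in>T. pcst (coef h a) * pmon a)" .
      also have "\<dots> \<in> els (B * (\<Sum>a\<in>T. gen {pmon a}))"
      proof (intro sum_els mult_els)
        fix a assume a: "a \<in> T"
        have "cst (coef h a) \<in> els C0" by (rule laurent.s_in_sca) simp
        then have "cst (coef h a) \<in> els (graded_piece B 0)" by (rule leD_els[OF pieces(2)])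
        then show "pcst (coef h a) \<in> els B" by (simp add: els_graded_piece monom_0)
        have "gen {pmon a} \<le> (\<Sum>a\<in>T. gen {pmon a})" using a by (intro asub_le_sum) (auto simp: T_def)
        then show "pmon a \<in> els (\<Sum>a\<in>T. gen {pmon a})" by (simp add: gen_le_iff)
      qed
      finally show ?thesis .
    qed
    have iB: "[:i:] \<in> els B"
    proof -
      have "(\<Sum>a\<in>T. gen {pmon a}) \<le> B"
        using TD by (auto simp: asub_sum_le_iff T_def gen_le_iff exps_def)
      then have "B * (\<Sum>a\<in>T. gen {pmon a}) \<le> B * B" by (intro asub_mult_mono order.refl)
      then have "[:h:] \<in> els B" using hB is_ring_mult[OF BR] by (auto dest: leD_els)
      then have "1 - [:h:] \<in> els B" by (intro diff_els B1)
      moreover have "1 - [:h:] = [:i:]" using one by (simp add: one_pCons i_def diff_eq_eq)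
      ultimately show ?thesis by simp
    qed
    obtain R K where RK: "(R :: nat) \<ge> 1" "real K = real R * (e - 1)" using e_rat by blast
    define E where "E = {m :: int ^ 'n. int_vec m \<in> dual_cone \<sigma>}"
    have ED: "mon E \<le> graded_piece B 0"
      using \<sigma>D mon_exps[of B] mon_mono[of E ?D] by (auto simp: E_def intro: order.trans)
    have vP: "int_vec v \<in> P" using v by (simp add: cone_vertex_def extreme_point_of_def)
    \<comment> \<open>A point of the larger multiple is \<open>b = e * R * x\<close> with
      \<open>x \<in> P\<close>. Splitting \<open>K * v\<close> off from \<open>b - R * v\<close>
      leaves \<open>e * R * (x - v)\<close>, because \<open>R + K = e * R\<close>, and this lies in
      the dual cone.\<close>
    have "mon {- nsc R v} * S0 (e * R) \<le> S0 ((e - 1) * R) * mon E"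
      unfolding S0_def mon_times
    proof (intro mon_mono subsetI)
      fix w assume "w \<in> {x + y |x y. x \<in> {- nsc R v} \<and> y \<in> latt P (e * R)}"
      then obtain b where b: "w = - nsc R v + b" "b \<in> latt P (e * R)" by blast
      then obtain x where x: "x \<in> P" "int_vec b = (e * R) *\<^sub>R x" by (auto simp: latt_def)
      have "nsc K v \<in> latt P ((e - 1) * R)"
        using vP RK(2) by (auto simp: latt_def mult.commute)
      moreover have "w - nsc K v \<in> E"
      proof -
        have "int_vec (w - nsc K v) = (e * R) *\<^sub>R (x - int_vec v)"
        proof -
          have "int_vec (w - nsc K v) = (e * R) *\<^sub>R x - (real R + real K) *\<^sub>R int_vec v"
            unfolding b(1) using x(2) by (simp add: scaleR_add_left)
          also have "real R + real K = e * R" using RK(2) by (simp add: algebra_simps)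
          finally show ?thesis by (simp only: scaleR_diff_right)
        qed
        moreover have "x - int_vec v \<in> dual_cone \<sigma>" using cone_vertex_diff[OF v x(1)] .
        ultimately show ?thesis using e by (auto simp: E_def dual_cone_def simp del: int_vec_simps)
      qed
      ultimately show "w \<in> {x + y |x y. x \<in> latt P ((e - 1) * R) \<and> y \<in> E}"
        by (intro CollectI exI[of _ "nsc K v"] exI[of _ "w - nsc K v"]) auto
    qed
    then have vS: "gen {laurent_monom (- v)} ^ R * S0 (e * R) \<le> S0 ((e - 1) * R) * mon E"
      by (simp add: mon_singleton gen_singleton_power laurent_monom_nsc[symmetric])
        (simp add: nsc_def mon_singleton[symmetric] uminus_vec_def)
    have i_in: "i \<in> els (gen {laurent_monom (- v)} * V0 * (C0 * mon E))"
      unfolding i_def V0_def using g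
      by (intro sum_els mult_els gen_base) (auto simp: mem_sca_UNIV_mon E_def laurent_supp_def)
    have \<phi>_in: "\<phi> \<in> els (C0 * S0 e)" using \<phi> by (simp add: S0_def mem_sca_UNIV_mon)
    have "gen {i} ^ R * gen {\<phi>} ^ R \<le> (gen {laurent_monom (- v)} * V0 * (C0 * mon E)) ^ R * (C0 * S0 e) ^ R"
      using i_in \<phi>_in by (intro asub_mult_mono asub_power_mono) (auto simp: gen_le_iff)
    also have "\<dots> = V0 ^ R * ((C0 * mon E) ^ R * C0 ^ R) * (gen {laurent_monom (- v)} ^ R * S0 e ^ R)"
      by (simp add: power_mult_distrib mult_ac)
    also have "\<dots> \<le> V0 ^ R * ((C0 * mon E) ^ R * C0 ^ R) * (S0 ((e - 1) * R) * mon E)"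
      using e by (intro asub_mult_mono order.refl order.trans[OF asub_mult_mono[OF order.refl S0_power] vS]) auto
    also have "\<dots> = (V0 ^ R * S0 ((e - 1) * R)) * ((C0 * mon E) ^ R * C0 ^ R) * mon E"
      by (simp add: mult_ac)
    also have "\<dots> \<le> graded_piece B (R + ((0 + 0) * R + 0 * R) + 0)"
      by (intro graded_piece_multI graded_piece_power pieces ED BR)
    finally have "i ^ R * \<phi> ^ R \<in> els (graded_piece B R)"
      by (simp add: gen_singleton_power gen_singleton_mult gen_le_iff)
    then have iu: "[:i:] ^ R * u ^ R \<in> els B"
      by (simp add: els_graded_piece u_def monom_power poly_const_pow smult_monom)
    have "1 = [:h:] + [:i:]" using one by (simp add: i_def add.commute one_pCons)
    then show False
      using max_non_integ_local[OF B(2), of T pmon "\<lambda>a. pmon (- a)" "[:h:]" "[:i:]" R] TD TnD pinv iB hB RK(1) iu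
      by (auto simp: exps_def T_def)
  qed
qed

end

section \<open>A uniform multiplier for the powers of an integral element\<close>

lemma coef_times: "coef (s * g) w = (\<Sum>b\<in>Poly_Mapping.keys s. coef s b * coef g (w - b))"
  for s g :: "('a::ab_group_add) \<Rightarrow>\<^sub>0 ('b::comm_ring_1)"
  by (subst poly_mapping_sum_single[OF finite_keys order.refl, of s])
    (simp add: sum_distrib_right lookup_sum coef_single_times)

text \<open>When \<open>H\<close> is a subgroup, this projection is linear over the Laurent
  polynomials supported in \<open>H\<close>; the hypothesis of \<open>restrict_exps_mult\<close>
  expresses just that.\<close>

definition restrict_exps :: "(int ^ 'n) set \<Rightarrow> 'n::finite laurent_ring \<Rightarrow> 'n laurent_ring"
  where "restrict_exps H g = (\<Sum>a\<in>Poly_Mapping.keys g \<inter> H. Poly_Mapping.single a (coef g a))"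

lemma coef_restrict_exps: "coef (restrict_exps H g) a = (if a \<in> H then coef g a else 0)"
  by (auto simp: restrict_exps_def lookup_sum lookup_single when_def in_keys_iff)

lemma restrict_exps_diff: "restrict_exps H (g - h) = restrict_exps H g - restrict_exps H h"
  by (rule poly_mapping_eqI) (simp add: coef_restrict_exps lookup_minus)

lemma restrict_exps_mult:
  assumes "\<And>b w. b \<in> Poly_Mapping.keys s \<Longrightarrow> w - b \<in> H \<longleftrightarrow> w \<in> H"
  shows "restrict_exps H (s * g) = s * restrict_exps H g"
  by (rule poly_mapping_eqI) (auto simp: coef_restrict_exps coef_times assms intro!: sum.cong sum.neutral)

lemma restrict_exps_id: "Poly_Mapping.keys g \<subseteq> H \<Longrightarrow> restrict_exps H g = g"
  by (rule poly_mapping_eqI) (auto simp: coef_restrict_exps in_keys_iff)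

lemma keys_restrict_exps: "Poly_Mapping.keys (restrict_exps H g) \<subseteq> H"
  by (auto simp: in_keys_iff coef_restrict_exps split: if_splits)

lemma mem_sca_coefs:
  assumes "coef g ` Poly_Mapping.keys g \<subseteq> K" "Poly_Mapping.keys g \<subseteq> X"
  shows "g \<in> els (laurent.sca (ring_gen K) * mon X)"
  unfolding mem_sca_mon[OF subring_ring_gen]
proof (intro conjI allI)
  show "coef g a \<in> ring_gen K" for a
  proof (cases "a \<in> Poly_Mapping.keys g")
    case True
    then show ?thesis using assms(1) by (intro ring_gen.base) blast
  next
    case False
    then show ?thesis using subring_setD(2)[OF subring_ring_gen, of K] by (simp add: in_keys_iff)
  qed
qed (rule assms)

text \<open>Adding a large multiple of the sum of the points of \<open>S\<close> makes all weights
  of a linear combination nonnegative, and one multiple serves for all of the finitely many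
  \<open>g\<close>. When \<open>P\<close> is not full-dimensional this reaches only exponents in its
  span.\<close>

lemma translate_into_multiple:
  fixes P :: "(real ^ 'n::finite) set"
  assumes P: "lattice_polytope P" "0 \<in> P" and G: "finite G" "\<And>g. g \<in> G \<Longrightarrow> int_vec g \<in> span P"
  shows "\<exists>b D. D \<ge> 0 \<and> (\<forall>g\<in>G. g + b \<in> latt P D)"
proof -
  obtain S where S: "finite S" "P = convex hull (int_vec ` S)"
    using P(1) by (auto simp: lattice_polytope_def)
  have inj: "inj_on int_vec S" using inj_int_vec by (rule inj_on_subset) auto
  have "\<exists>c. int_vec g = (\<Sum>s\<in>S. c s *\<^sub>R int_vec s)" if g: "g \<in> G" for g
  proof -
    have "span P \<subseteq> span (int_vec ` S)"
      unfolding S(2) by (rule span_minimal[OF convex_hull_subset_span subspace_span])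
    then have "int_vec g \<in> range (\<lambda>u. \<Sum>v\<in>int_vec ` S. u v *\<^sub>R v)"
      using G(2)[OF g] span_finite[OF finite_imageI[OF S(1)], of int_vec] by blast
    then obtain u where "int_vec g = (\<Sum>v\<in>int_vec ` S. u v *\<^sub>R v)" by blast
    then show ?thesis by (intro exI[of _ "u \<circ> int_vec"]) (simp add: sum.reindex[OF inj])
  qed
  then obtain c where c: "\<And>g. g \<in> G \<Longrightarrow> int_vec g = (\<Sum>s\<in>S. c g s *\<^sub>R int_vec s)" by metis
  define k where "k = nat \<lceil>\<Sum>g\<in>G. \<Sum>s\<in>S. \<bar>c g s\<bar>\<rceil>"
  have kc: "\<bar>c g s\<bar> \<le> real k" if "g \<in> G" "s \<in> S" for g s
  proof -
    have "\<bar>c g s\<bar> \<le> (\<Sum>s\<in>S. \<bar>c g s\<bar>)" using S(1) that by (intro member_le_sum) auto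
    also have "\<dots> \<le> (\<Sum>g\<in>G. \<Sum>s\<in>S. \<bar>c g s\<bar>)"
      using G(1) that by (intro member_le_sum[of g G "\<lambda>g. \<Sum>s\<in>S. \<bar>c g s\<bar>"]) (auto intro: sum_nonneg)
    finally show ?thesis unfolding k_def by linarith
  qed
  define b where "b = nsc k (\<Sum>s\<in>S. s)"
  define D where "D = (\<Sum>s\<in>S. 2 * real k)"
  have D: "D \<ge> 0" unfolding D_def by (intro sum_nonneg) auto
  have iv_sum: "int_vec (\<Sum>s\<in>S. s) = (\<Sum>s\<in>S. (int_vec s :: real ^ 'n))"
    by (simp add: vec_eq_iff int_vec_def)
  have "g + b \<in> latt P D" if g: "g \<in> G" for g
  proof -
    define w where "w s = c g s + real k" for s
    have w: "0 \<le> w s" "w s \<le> 2 * real k" if "s \<in> S" for s using kc[OF g that] by (auto simp: w_def)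
    have e: "int_vec (g + b) = (\<Sum>s\<in>S. w s *\<^sub>R int_vec s)"
      by (simp add: b_def iv_sum c[OF g] w_def scaleR_add_left sum.distrib scaleR_sum_right)
    have sw: "0 \<le> sum w S" using w(1) by (rule sum_nonneg)
    have sD: "sum w S \<le> D" unfolding D_def using w(2) by (rule sum_mono)
    show ?thesis
    proof (cases "sum w S = 0")
      case True
      then have "\<forall>s\<in>S. w s = 0" using w S(1) by (simp add: sum_nonneg_eq_0_iff)
      then have "int_vec (g + b) = (0 :: real ^ 'n)" using e by simp
      then show ?thesis unfolding latt_def using P(2) by (auto intro!: image_eqI[of _ _ 0])
    next
      case False
      have "(\<Sum>s\<in>S. (w s / sum w S) *\<^sub>R int_vec s) \<in> P"
        unfolding S(2) convex_hull_int_vec[OF S(1)]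
        using w sw False by (intro exI[of _ "\<lambda>s. w s / sum w S"]) (auto simp: sum_divide_distrib[symmetric])
      moreover have "int_vec (g + b) = sum w S *\<^sub>R (\<Sum>s\<in>S. (w s / sum w S) *\<^sub>R int_vec s)"
        unfolding e using False by (simp add: scaleR_sum_right)
      ultimately have "g + b \<in> latt P (sum w S)" by (auto simp: latt_def)
      then show ?thesis using latt_mono[OF lattice_polytope_props(1)[OF P(1)] P(2) sw sD] by blast
    qed
  qed
  then show ?thesis using D by blast
qed

context toric_data
begin

lemma V0_coefs:
  obtains K where "finite K" "V0 \<le> laurent.sca (ring_gen K) * S0 1"
proof -
  define K where "K = (\<Union>j\<in>J. coef (f j) ` Poly_Mapping.keys (f j))"
  have "V0 \<le> laurent.sca (ring_gen K) * S0 1"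
    unfolding V0_def gen_le_iff S0_def using f by (auto intro!: mem_sca_coefs simp: K_def)
  moreover have "finite K" using J by (auto simp: K_def)
  ultimately show ?thesis using that by blast
qed

definition exps_span :: "(int ^ 'n) set"
  where "exps_span = {a. int_vec a \<in> span P}"

lemma latt_exps_span: "latt P d \<subseteq> exps_span"
  by (auto simp: latt_def exps_span_def intro!: span_scale intro: span_base)

lemma V0_S0_exps_span: "C0 * V0 ^ k * S0 d \<le> C0 * mon exps_span"
proof -
  have "V0 \<le> C0 * mon exps_span"
    unfolding V0_def gen_le_iff using f latt_exps_span by (fastforce simp: mem_sca_UNIV_mon)
  then have "C0 * V0 ^ k * S0 d \<le> C0 * (C0 * mon exps_span) ^ k * mon exps_span"
    unfolding S0_def by (intro asub_mult_mono asub_power_mono mon_mono order.refl latt_exps_span)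
  also have "\<dots> = (C0 * C0 ^ k) * (mon exps_span ^ k * mon exps_span)"
    by (simp add: power_mult_distrib mult_ac)
  also have "C0 * C0 ^ k = C0" using laurent.sca_power[OF subring_UNIV, of "Suc k"] by simp
  also have "mon exps_span ^ k * mon exps_span \<le> mon exps_span"
  proof (induction k)
    case (Suc k)
    have "mon exps_span * mon exps_span \<le> mon exps_span"
      unfolding mon_times by (intro mon_mono) (auto simp: exps_span_def intro: span_add)
    then have "mon exps_span * (mon exps_span ^ k * mon exps_span) \<le> mon exps_span"
      using asub_mult_mono[OF order.refl Suc, of "mon exps_span"] order.trans by blast
    then show ?case by (simp add: mult.assoc)
  qed simp
  finally show ?thesis by (simp add: asub_mult_mono)
qed

text \<open>One finitely generated module serves for all powers \<open>u ^ q\<close>. Comparing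
  coefficients of \<open>y ^ q\<close> leaves only the coefficients of its generators outside the
  desired form, and \<open>c\<close> repairs them: a monomial moves their exponents into a multiple
  of \<open>P\<close>, and a power of \<open>f j0\<close> makes up for the powers of the ideal lost
  to the degrees of the generators.\<close>

lemma uniform_multiplier:
  assumes int: "integ u A0" and j0: "j0 \<in> J" "f j0 \<noteq> 0"
  shows "\<exists>K c D. finite K \<and> c \<noteq> 0 \<and> D \<ge> 0 \<and>
    (\<forall>q. gen {c} * gen {\<phi>} ^ q \<le> laurent.sca (ring_gen K) * (V0 ^ q * S0 ((e - 1) * real q + D)))"
proof -
  obtain M where M: "fg M" "1 \<le> M" "gen {u} * M \<le> A0 * M" using int by (auto simp: integ_def)
  obtain Y where Y: "finite Y" "M = gen Y" using M(1) by (auto simp: fg_def)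
  have "fg (gen {u} * M)" by (intro fg_mult fg_gen M) auto
  moreover have "gen {u} * M \<le> C1 * (A00 * M)" using M(3) by (simp add: A0_def mult.assoc)
  ultimately obtain K1 where K1: "finite K1" "gen {u} * M \<le> laurent_poly.sca (ring_gen K1) * (A00 * M)"
    using laurent_poly.fg_sca_descent by blast
  let ?A = "ring_gen K1" and ?R = "laurent_poly.sca (ring_gen K1) :: 'n laurent_ring poly asub"
  let ?s = "laurent.sca (ring_gen K1) :: 'n laurent_ring asub"
  have RR: "(?R * A00) * (?R * A00) = ?R * A00"
  proof -
    have "(?R * A00) * (?R * A00) = (?R * ?R) * (A00 * A00)" by (simp add: mult_ac)
    then show ?thesis by (simp add: laurent_poly.sca_mult[OF subring_ring_gen] is_ring_mult[OF is_ring_A00])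
  qed
  have R1: "1 \<le> ?R * A00"
    using asub_mult_mono[OF laurent_poly.one_le_sca[OF ring_gen.one], of 1 A00] is_ring_A00
    by (simp add: is_ring_def)
  have uq: "gen {u} ^ q * M \<le> (?R * A00) * M" for q
  proof (induction q)
    case 0
    show ?case using asub_mult_mono[OF R1 order.refl, of M] by simp
  next
    case (Suc q)
    have "gen {u} ^ Suc q * M = gen {u} * (gen {u} ^ q * M)" by (simp add: mult.assoc)
    also have "\<dots> \<le> gen {u} * ((?R * A00) * M)" by (intro asub_mult_mono order.refl Suc)
    also have "\<dots> = (?R * A00) * (gen {u} * M)" by (simp add: mult_ac)
    also have "\<dots> \<le> (?R * A00) * (?R * (A00 * M))" by (intro asub_mult_mono order.refl K1(2))
    also have "\<dots> = ((?R * A00) * (?R * A00)) * M" by (simp add: mult_ac)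
    finally show ?case unfolding RR .
  qed
  define X where "X l = ?s * V0 ^ l * S0 ((e - 1) * real l)" for l
  have RA: "coeff b l \<in> els (X l)" if b: "b \<in> els (?R * A00)" for b l
  proof -
    have e1: "els (Asub {b. \<forall>l. coeff b l \<in> els (X l)}) = {b. \<forall>l. coeff b l \<in> els (X l)}"
      by (rule els_Asub) (auto intro: diff_els)
    have "?R * A00 \<le> Asub {b. \<forall>l. coeff b l \<in> els (X l)}"
      unfolding laurent_poly.sca_def gen_times_le_iff e1
      by (auto simp: els_A00 X_def mult.assoc intro!: mult_els laurent.s_in_sca)
    then show ?thesis using b e1 by (auto dest: leD_els)
  qed
  define N where "N = Max (insert 0 (degree ` Y))"
  have N: "degree y \<le> N" if "y \<in> Y" for y using that Y(1) by (simp add: N_def)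
  define Z where "Z q = (\<Sum>y\<in>Y. \<Sum>k\<le>min q N. gen {coeff y k} * X (q - k))" for q
  have Zq: "coeff g q \<in> els (Z q)" if g: "g \<in> els ((?R * A00) * M)" for g q
  proof -
    have e1: "els (Asub {g. coeff g q \<in> els (Z q)}) = {g. coeff g q \<in> els (Z q)}"
      by (rule els_Asub) (auto intro: diff_els)
    have "M * (?R * A00) \<le> Asub {g. coeff g q \<in> els (Z q)}"
      unfolding Y(2) gen_times_le_iff e1
    proof (intro ballI CollectI)
      fix y b assume y: "y \<in> Y" and b: "b \<in> els (?R * A00)"
      have "coeff (y * b) q = (\<Sum>k\<le>min q N. coeff y k * coeff b (q - k))"
        unfolding coeff_mult using N[OF y]
        by (intro sum.mono_neutral_right) (auto, metis coeff_eq_0 le_less_trans mult_zero_left not_le)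
      also have "\<dots> \<in> els (Z q)"
      proof (rule sum_els)
        fix k assume k: "k \<in> {..min q N}"
        have "gen {coeff y k} * X (q - k) \<le> (\<Sum>k\<le>min q N. gen {coeff y k} * X (q - k))"
          using k by (intro asub_le_sum) auto
        also have "\<dots> \<le> Z q" unfolding Z_def
          by (rule asub_le_sum[OF Y(1) y, of "\<lambda>y. \<Sum>k\<le>min q N. gen {coeff y k} * X (q - k)"])
        finally show "coeff y k * coeff b (q - k) \<in> els (Z q)"
          by (rule leD_els) (intro mult_els gen_base RA[OF b] singletonI)
      qed
      finally show "coeff (y * b) q \<in> els (Z q)" .
    qed
    then show ?thesis using g e1 by (auto dest: leD_els simp: mult.commute)
  qed
  have \<phi>Z: "\<phi> ^ q \<in> els (Z q)" for q
  proof -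
    have "gen {u} ^ q \<le> gen {u} ^ q * M" using asub_le_mult_one[OF M(2)] .
    then have "gen {u} ^ q \<le> (?R * A00) * M" using uq order.trans by blast
    then have "u ^ q \<in> els ((?R * A00) * M)" by (simp add: gen_singleton_power gen_le_iff)
    from Zq[OF this, of q] show ?thesis by (simp add: u_def monom_power)
  qed
  \<comment> \<open>Exponents of the generators outside the span of \<open>P\<close> cannot be
    repaired by a translation. They may be discarded, since \<open>\<phi> ^ q\<close> is supported
    in the span and the projection is linear over the \<open>X l\<close>, which are supported there
    too.\<close>
  define \<pi> where "\<pi> = restrict_exps exps_span"
  define Z' where "Z' q = (\<Sum>y\<in>Y. \<Sum>k\<le>min q N. gen {\<pi> (coeff y k)} * X (q - k))" for q
  have \<phi>_span: "Poly_Mapping.keys (\<phi> ^ q) \<subseteq> exps_span" for q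
  proof -
    have "\<phi> \<in> els (C0 * mon (latt P e))" using \<phi> by (simp add: mem_sca_UNIV_mon)
    then have "gen {\<phi>} ^ q \<le> (C0 * S0 e) ^ q" by (intro asub_power_mono) (simp add: gen_le_iff S0_def)
    also have "\<dots> \<le> C0 ^ q * S0 (e * q)"
      unfolding power_mult_distrib using e by (intro asub_mult_mono order.refl S0_power) auto
    also have "\<dots> \<le> C0 * V0 ^ 0 * S0 (e * q)"
    proof -
      have "is_ring C0" by (simp add: is_ring_def laurent.one_le_sca laurent.sca_mult[OF subring_UNIV])
      then show ?thesis by (simp add: asub_mult_mono is_ring_power)
    qed
    also have "\<dots> \<le> C0 * mon exps_span" by (rule V0_S0_exps_span)
    finally show ?thesis by (simp add: gen_singleton_power gen_le_iff mem_sca_UNIV_mon)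
  qed
  have Xspan: "Poly_Mapping.keys s \<subseteq> exps_span" if "s \<in> els (X l)" for s l
  proof -
    have "X l \<le> C0 * V0 ^ l * S0 ((e - 1) * real l)"
      unfolding X_def by (intro asub_mult_mono order.refl laurent.sca_mono) auto
    then have "X l \<le> C0 * mon exps_span" using V0_S0_exps_span order.trans by blast
    then show ?thesis using that by (auto dest!: leD_els simp: mem_sca_UNIV_mon)
  qed
  have Z'q: "\<pi> g \<in> els (Z' q)" if g: "g \<in> els (Z q)" for g q
  proof -
    have e1: "els (Asub {g. \<pi> g \<in> els (Z' q)}) = {g. \<pi> g \<in> els (Z' q)}"
    proof (rule els_Asub)
      have "\<pi> 0 = 0" by (simp add: \<pi>_def restrict_exps_def)
      then show "0 \<in> {g. \<pi> g \<in> els (Z' q)}" by simp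
    qed (auto simp: \<pi>_def restrict_exps_diff intro: diff_els)
    have "Z q \<le> Asub {g. \<pi> g \<in> els (Z' q)}"
      unfolding Z_def
    proof (subst asub_sum_le_iff[OF Y(1)], intro ballI, subst asub_sum_le_iff, simp, intro ballI)
      fix y k assume y: "y \<in> Y" and k: "k \<in> {..min q N}"
      have le: "gen {\<pi> (coeff y k)} * X (q - k) \<le> Z' q"
      proof -
        have "gen {\<pi> (coeff y k)} * X (q - k) \<le> (\<Sum>k\<le>min q N. gen {\<pi> (coeff y k)} * X (q - k))"
          using k by (intro asub_le_sum) auto
        also have "\<dots> \<le> Z' q" unfolding Z'_def
          by (rule asub_le_sum[OF Y(1) y, of "\<lambda>y. \<Sum>k\<le>min q N. gen {\<pi> (coeff y k)} * X (q - k)"])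
        finally show ?thesis .
      qed
      show "gen {coeff y k} * X (q - k) \<le> Asub {g. \<pi> g \<in> els (Z' q)}"
        unfolding gen_times_le_iff e1
      proof (intro ballI CollectI)
        fix x s assume x: "x \<in> {coeff y k}" and s: "s \<in> els (X (q - k))"
        have "w - b \<in> exps_span \<longleftrightarrow> w \<in> exps_span" if "b \<in> Poly_Mapping.keys s" for b w
        proof -
          have "int_vec b \<in> span P" using Xspan[OF s] that by (auto simp: exps_span_def)
          then show ?thesis
            using span_diff[of "int_vec w" P "int_vec b"] span_add[of "int_vec w - int_vec b" P "int_vec b"]
            by (auto simp: exps_span_def)
        qed
        then have "\<pi> (s * x) = s * \<pi> x"
          unfolding \<pi>_def by (rule restrict_exps_mult)
        then have "\<pi> (x * s) = \<pi> x * s" by (simp add: mult.commute)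
        moreover have "\<pi> x * s \<in> els (gen {\<pi> (coeff y k)} * X (q - k))"
          using x s by (intro mult_els gen_base) auto
        ultimately show "\<pi> (x * s) \<in> els (Z' q)" using le by (auto dest: leD_els)
      qed
    qed
    then show ?thesis using g e1 by (auto dest: leD_els)
  qed
  have \<phi>Z': "\<phi> ^ q \<in> els (Z' q)" for q
    using Z'q[OF \<phi>Z[of q]] restrict_exps_id[OF \<phi>_span[of q]] by (simp add: \<pi>_def)
  define G where "G = (\<Union>y\<in>Y. \<Union>k\<le>N. Poly_Mapping.keys (\<pi> (coeff y k)))"
  have "finite G" using Y(1) by (auto simp: G_def)
  moreover have "int_vec g \<in> span P" if "g \<in> G" for g
    using that keys_restrict_exps by (fastforce simp: G_def \<pi>_def exps_span_def)
  ultimately obtain b D0 where D0: "D0 \<ge> 0" "\<And>g. g \<in> G \<Longrightarrow> g + b \<in> latt P D0"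
    using translate_into_multiple[OF P P_0] by metis
  obtain K2 where K2: "finite K2" "V0 \<le> laurent.sca (ring_gen K2) * S0 1" by (rule V0_coefs)
  define K where "K = K1 \<union> K2 \<union> (\<Union>y\<in>Y. \<Union>k\<le>N. coef (\<pi> (coeff y k)) ` Poly_Mapping.keys (\<pi> (coeff y k)))"
  have "finite K" using K1(1) K2(1) Y(1) by (auto simp: K_def)
  let ?t = "laurent.sca (ring_gen K) :: 'n laurent_ring asub"
  have st: "?s \<le> ?t" by (intro laurent.sca_mono ring_gen_mono) (auto simp: K_def)
  have Vt: "V0 \<le> ?t * S0 1" by (rule laurent.sca_descent_mono[OF K2(2)]) (auto simp: K_def)
  have tR: "is_ring ?t"
    by (simp add: is_ring_def laurent.one_le_sca ring_gen.one laurent.sca_mult[OF subring_ring_gen])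
  note tt = is_ring_mult[OF tR] and tp = is_ring_power[OF tR]
  \<comment> \<open>\<open>N\<close> bounds the degrees of the generators, hence the number
    \<open>k\<close> of missing factors from \<open>V0\<close>. The surplus \<open>N - k\<close>
    factors are counted as support.\<close>
  define c where "c = f j0 ^ N * laurent_monom b"
  have "c \<noteq> 0"
    unfolding c_def by (intro laurent_no_zero_divisors laurent_power_nonzero j0 laurent_monom_nonzero)
  have mono_term: "gen {c} * (gen {\<pi> (coeff y k)} * X (q - k)) \<le> ?t * (V0 ^ q * S0 ((e - 1) * real q + (real N + D0)))"
    if y: "y \<in> Y" and k: "k \<le> min q N" for y k q
  proof -
    have kN: "k \<le> N" "k \<le> q" using k by auto
    have bg: "gen {laurent_monom b} * gen {\<pi> (coeff y k)} \<le> ?t * S0 D0"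
    proof -
      have "\<pi> (coeff y k) \<in> els (laurent.sca (ring_gen K) * mon (Poly_Mapping.keys (\<pi> (coeff y k))))"
        using y kN by (intro mem_sca_coefs) (auto simp: K_def)
      then have "gen {laurent_monom b} * gen {\<pi> (coeff y k)} \<le> mon {b} * (?t * mon (Poly_Mapping.keys (\<pi> (coeff y k))))"
        by (intro asub_mult_mono) (auto simp: mon_singleton gen_le_iff)
      also have "\<dots> = ?t * mon {x + z |x z. x \<in> {b} \<and> z \<in> Poly_Mapping.keys (\<pi> (coeff y k))}"
        by (simp only: mon_times[symmetric] mult_ac)
      also have "\<dots> \<le> ?t * S0 D0"
        unfolding S0_def using D0(2) y kN
        by (intro asub_mult_mono order.refl mon_mono) (auto simp: G_def add.commute[of b])
      finally show ?thesis .
    qed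
    have fV: "gen {f j0} ^ N \<le> V0 ^ k * (?t * S0 (real N))"
    proof -
      have "gen {f j0} \<le> V0" using j0 by (auto simp: V0_def intro: gen_mono)
      then have "gen {f j0} ^ N \<le> V0 ^ N" by (rule asub_power_mono)
      also have "V0 ^ N = V0 ^ k * V0 ^ (N - k)" using kN by (simp add: power_add[symmetric])
      also have "\<dots> \<le> V0 ^ k * (?t * S0 1) ^ (N - k)"
        by (intro asub_mult_mono order.refl asub_power_mono Vt)
      also have "\<dots> \<le> V0 ^ k * (?t * S0 (1 * real (N - k)))"
        unfolding power_mult_distrib by (intro asub_mult_mono order.refl tp S0_power) auto
      also have "\<dots> \<le> V0 ^ k * (?t * S0 (real N))"
        by (intro asub_mult_mono order.refl S0_mono) auto
      finally show ?thesis .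
    qed
    have "gen {c} * (gen {\<pi> (coeff y k)} * X (q - k))
        = gen {f j0} ^ N * (gen {laurent_monom b} * gen {\<pi> (coeff y k)}) * X (q - k)"
      by (simp add: c_def gen_singleton_mult[symmetric] gen_singleton_power mult_ac)
    also have "\<dots> \<le> (V0 ^ k * (?t * S0 (real N))) * (?t * S0 D0) * (?t * V0 ^ (q - k) * S0 ((e - 1) * real (q - k)))"
      unfolding X_def by (intro asub_mult_mono order.refl fV bg st)
    also have "\<dots> = (?t * ?t * ?t) * ((V0 ^ k * V0 ^ (q - k)) * (S0 (real N) * S0 D0 * S0 ((e - 1) * real (q - k))))"
      by (simp add: mult_ac)
    also have "V0 ^ k * V0 ^ (q - k) = V0 ^ q" using kN by (simp add: power_add[symmetric])
    also have "?t * ?t * ?t = ?t" by (simp add: tt)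
    also have "?t * (V0 ^ q * (S0 (real N) * S0 D0 * S0 ((e - 1) * real (q - k))))
        \<le> ?t * (V0 ^ q * S0 ((e - 1) * real q + (real N + D0)))"
    proof (intro asub_mult_mono order.refl)
      have "S0 (real N) * S0 D0 * S0 ((e - 1) * real (q - k)) \<le> S0 (real N + D0) * S0 ((e - 1) * real q)"
        using D0(1) e by (intro asub_mult_mono S0_mult S0_mono mult_left_mono) auto
      also have "\<dots> \<le> S0 (real N + D0 + (e - 1) * real q)" using D0(1) e by (intro S0_mult) auto
      finally show "S0 (real N) * S0 D0 * S0 ((e - 1) * real (q - k)) \<le> S0 ((e - 1) * real q + (real N + D0))"
        by (simp add: algebra_simps)
    qed
    finally show ?thesis .
  qed
  have "gen {c} * gen {\<phi>} ^ q \<le> ?t * (V0 ^ q * S0 ((e - 1) * real q + (real N + D0)))" for q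
  proof -
    have "gen {c} * gen {\<phi>} ^ q \<le> gen {c} * Z' q"
      using \<phi>Z'[of q] by (intro asub_mult_mono order.refl) (simp add: gen_singleton_power gen_le_iff)
    also have "\<dots> = (\<Sum>y\<in>Y. \<Sum>k\<le>min q N. gen {c} * (gen {\<pi> (coeff y k)} * X (q - k)))"
      by (simp add: Z'_def sum_distrib_left)
    also have "\<dots> \<le> ?t * (V0 ^ q * S0 ((e - 1) * real q + (real N + D0)))"
      by (subst asub_sum_le_iff[OF Y(1)], intro ballI, subst asub_sum_le_iff, simp, intro ballI mono_term) auto
    finally show ?thesis .
  qed
  then show ?thesis using \<open>finite K\<close> \<open>c \<noteq> 0\<close> D0(1)
    by (intro exI[of _ K] exI[of _ c] exI[of _ "real N + D0"]) auto
qed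

end

section \<open>Noether normalization relative to a section\<close>

text \<open>In the expansion either \<open>x\<close> occurs or the term is a pure power of
  \<open>y\<close>.\<close>

lemma asub_power_plus_le:
  fixes x y :: "'a::comm_ring_1 asub"
  shows "(x + y) ^ Suc s \<le> x * (x + y) ^ s + y ^ Suc s"
proof (induction s)
  case (Suc s)
  have "(x + y) ^ Suc (Suc s) = x * (x + y) ^ Suc s + y * (x + y) ^ Suc s" by (simp add: distrib_right)
  also have "\<dots> \<le> x * (x + y) ^ Suc s + y * (x * (x + y) ^ s + y ^ Suc s)"
    by (intro asub_plus_mono asub_mult_mono order.refl Suc)
  also have "\<dots> = x * (x + y) ^ Suc s + (x * (y * (x + y) ^ s) + y ^ Suc (Suc s))"
    by (simp add: algebra_simps)
  also have "\<dots> \<le> x * (x + y) ^ Suc s + (x * (x + y) ^ Suc s + y ^ Suc (Suc s))"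
  proof (intro asub_plus_mono asub_mult_mono order.refl)
    have "y * (x + y) ^ s \<le> (x + y) * (x + y) ^ s" by (intro asub_mult_mono) auto
    then show "y * (x + y) ^ s \<le> (x + y) ^ Suc s" by simp
  qed
  finally show ?case by (simp add: add.assoc[symmetric])
qed simp

text \<open>Kronecker substitution: exponent tuples with entries below the base become distinct
  exponents of one variable. So a nonzero polynomial in several variables stays nonzero at the point
  with coordinates \<open>x ^ (B ^ l)\<close>, for all but finitely many \<open>x\<close>.\<close>

definition digits :: "nat \<Rightarrow> nat \<Rightarrow> (nat \<Rightarrow> nat) \<Rightarrow> nat"
  where "digits B n \<beta> = (\<Sum>l<n. \<beta> l * B ^ l)"

lemma inj_on_digits: "inj_on (digits (Suc X) n) (PiE {..<n} (\<lambda>_. {..X}))"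
proof (rule inj_onI)
  show "\<beta> = \<gamma>" if "\<beta> \<in> PiE {..<n} (\<lambda>_. {..X})" "\<gamma> \<in> PiE {..<n} (\<lambda>_. {..X})"
    "digits (Suc X) n \<beta> = digits (Suc X) n \<gamma>" for \<beta> \<gamma>
  proof (rule PiE_ext[OF that(1,2)])
    have *: "\<forall>l<k. \<beta> l = \<gamma> l" if "\<forall>l<k. \<beta> l \<le> X \<and> \<gamma> l \<le> X" "digits (Suc X) k \<beta> = digits (Suc X) k \<gamma>"
      for k \<beta> \<gamma>
      using that
    proof (induction k arbitrary: \<beta> \<gamma>)
      case (Suc k)
      have d: "digits (Suc X) (Suc k) \<beta> = \<beta> 0 + Suc X * digits (Suc X) k (\<lambda>l. \<beta> (Suc l))" for \<beta>
        unfolding digits_def sum.lessThan_Suc_shift by (simp add: sum_distrib_left algebra_simps)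
      have e: "\<beta> 0 + Suc X * digits (Suc X) k (\<lambda>l. \<beta> (Suc l)) = \<gamma> 0 + Suc X * digits (Suc X) k (\<lambda>l. \<gamma> (Suc l))"
        using Suc.prems(2) d by simp
      have "\<beta> 0 < Suc X" "\<gamma> 0 < Suc X" using Suc.prems(1) by (auto simp: less_Suc_eq_le)
      then have "\<beta> 0 = \<gamma> 0" using arg_cong[OF e, of "\<lambda>x. x mod Suc X"] by (simp del: mult_Suc)
      moreover from this e have "digits (Suc X) k (\<lambda>l. \<beta> (Suc l)) = digits (Suc X) k (\<lambda>l. \<gamma> (Suc l))"
        by (simp del: mult_Suc)
      then have "\<forall>l<k. \<beta> (Suc l) = \<gamma> (Suc l)" using Suc.prems(1) by (intro Suc.IH) auto
      ultimately show ?case using less_Suc_eq_0_disj by auto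
    qed simp
    show "\<beta> l = \<gamma> l" if "l \<in> {..<n}" for l
      using *[of n \<beta> \<gamma>] \<open>\<beta> \<in> _\<close> \<open>\<gamma> \<in> _\<close> \<open>digits (Suc X) n \<beta> = digits (Suc X) n \<gamma>\<close> that
      by (auto simp: PiE_iff)
  qed
qed

context toric_data
begin

definition "W = C0 * S0 1"
definition "V = C0 * V0"
definition "lin us (k :: nat) = (\<Sum>i<k. C0 * gen {us i :: 'n laurent_ring})"
text \<open>Modulo \<open>b\<close>, the elements \<open>us 0, \<dots>, us (k - 1)\<close> form a reduction of \<open>V\<close>, bihomogeneously in \<open>W\<close> and \<open>V\<close>.\<close>

definition "good b us k r s \<longleftrightarrow>
  W ^ Suc r * V ^ Suc s \<le> lin us k * (W ^ Suc r * V ^ s) + gen {b} * (W ^ r * V ^ Suc s)"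

lemma is_ring_C0: "is_ring C0"
  by (simp add: is_ring_def laurent.one_le_sca laurent.sca_mult[OF subring_UNIV])

lemmas C0_idem = is_ring_mult[OF is_ring_C0] and C0_power = is_ring_power[OF is_ring_C0]

lemma C0_one: "1 \<le> C0"
  using is_ring_C0 by (simp add: is_ring_def)

lemma C0_W: "C0 * W = W" and C0_V: "C0 * V = V" and C0_lin: "C0 * lin us k = lin us k"
  by (simp_all add: W_def V_def lin_def sum_distrib_left mult.assoc[symmetric] C0_idem)

lemma C0_power_absorb: "C0 * T = T \<Longrightarrow> k > 0 \<Longrightarrow> C0 * T ^ k = T ^ k"
  by (cases k) (simp_all add: mult.assoc[symmetric])

lemma V_le_W: "V \<le> W"
proof -
  have "V0 \<le> C0 * S0 1" unfolding V0_def gen_le_iff S0_def using f by (auto simp: mem_sca_UNIV_mon)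
  then have "C0 * V0 \<le> C0 * (C0 * S0 1)" by (intro asub_mult_mono order.refl)
  then show ?thesis by (simp add: V_def W_def mult.assoc[symmetric] C0_idem)
qed

lemma lin_le_V:
  assumes "\<And>i. i < k \<Longrightarrow> us i \<in> els V"
  shows "lin us k \<le> V"
proof -
  have *: "C0 * gen {us i} \<le> V" if "i < k" for i
    using asub_mult_mono[OF order.refl, of "gen {us i}" V C0] assms[OF that] by (simp add: C0_V gen_le_iff)
  show ?thesis
    unfolding lin_def asub_sum_le_iff[OF finite_lessThan] using * by blast
qed

lemma W_power_le: "W ^ d \<le> C0 * S0 (real d)"
proof -
  have "W ^ d \<le> C0 ^ d * S0 (1 * real d)"
    unfolding W_def power_mult_distrib by (intro asub_mult_mono S0_power order.refl) auto
  also have "\<dots> \<le> C0 * S0 (real d)" by (intro asub_mult_mono C0_power) auto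
  finally show ?thesis .
qed

lemma finite_latt: "finite (latt P d)"
proof -
  obtain M :: nat where M: "\<And>d b j. d \<ge> 0 \<Longrightarrow> b \<in> latt P d \<Longrightarrow> 0 \<le> b $ j \<and> real_of_int (b $ j) \<le> d * M"
    using latt_in_box[OF compact_P P_orthant] by blast
  have sub: "latt P d \<subseteq> latt P \<bar>d\<bar> \<union> uminus ` latt P \<bar>d\<bar>"
  proof (cases "d \<ge> 0")
    case False
    have "b \<in> uminus ` latt P (- d)" if bd: "b \<in> latt P d" for b
    proof -
      obtain x where "x \<in> P" "int_vec b = d *\<^sub>R x" using bd by (auto simp: latt_def)
      then have "int_vec (- b) = (- d) *\<^sub>R x" "x \<in> P" by auto
      then have "- b \<in> latt P (- d)" unfolding latt_def by blast
      then show ?thesis by (metis image_eqI minus_minus)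
    qed
    then show ?thesis using False by auto
  qed auto
  have "latt P \<bar>d\<bar> \<subseteq> {b. \<forall>j. 0 \<le> b $ j \<and> b $ j \<le> \<lceil>\<bar>d\<bar> * M\<rceil>}"
    using M[of "\<bar>d\<bar>"] by (auto simp: le_ceiling_iff) (smt (verit) M abs_ge_zero of_int_1)
  then have "finite (latt P \<bar>d\<bar>)" by (rule finite_subset[OF _ finite_int_box])
  then have "finite (latt P \<bar>d\<bar> \<union> uminus ` latt P \<bar>d\<bar>)" by simp
  then show ?thesis by (rule finite_subset[OF sub])
qed

lemma card_latt_bound:
  obtains M :: nat where "\<And>d. card (latt P (real d)) \<le> (d * M + 1) ^ CARD('n)"
proof -
  obtain M :: nat where M: "\<And>d b j. d \<ge> 0 \<Longrightarrow> b \<in> latt P d \<Longrightarrow> 0 \<le> b $ j \<and> real_of_int (b $ j) \<le> d * M"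
    using latt_in_box[OF compact_P P_orthant] by blast
  have "card (latt P (real d)) \<le> (d * M + 1) ^ CARD('n)" for d
  proof -
    have sub: "latt P (real d) \<subseteq> {b. \<forall>j. 0 \<le> b $ j \<and> b $ j \<le> int (d * M)}"
    proof (intro subsetI CollectI allI)
      fix b j assume "b \<in> latt P (real d)"
      then have "0 \<le> b $ j \<and> real_of_int (b $ j) \<le> real d * M" by (intro M) auto
      then show "0 \<le> b $ j \<and> b $ j \<le> int (d * M)" by (metis of_int_le_iff of_int_of_nat_eq of_nat_mult)
    qed
    have "card (latt P (real d)) \<le> card {b :: int ^ 'n. \<forall>j. 0 \<le> b $ j \<and> b $ j \<le> int (d * M)}"
      by (rule card_mono[OF finite_int_box sub])
    also have "\<dots> \<le> nat (int (d * M) - 0 + 1) ^ CARD('n)" by (rule card_int_box)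
    also have "nat (int (d * M) - 0 + 1) = d * M + 1" by (simp add: nat_add_distrib nat_mult_distrib)
    finally show ?thesis .
  qed
  then show ?thesis using that by blast
qed

definition monom_at :: "nat \<Rightarrow> (nat \<Rightarrow> 'n laurent_ring) \<Rightarrow> 'n laurent_ring \<Rightarrow> (nat \<Rightarrow> nat) \<Rightarrow> 'n laurent_ring"
  where "monom_at X us z \<beta> = (\<Prod>l<CARD('n). us l ^ \<beta> l) * z ^ (CARD('n) * X - (\<Sum>l<CARD('n). \<beta> l))"

lemma sum_exponents_le: "\<beta> \<in> PiE {..<CARD('n)} (\<lambda>_. {..X}) \<Longrightarrow> (\<Sum>l<CARD('n). \<beta> l) \<le> CARD('n) * X"
  using sum_bounded_above[of "{..<CARD('n)}" \<beta> X] by (auto simp: PiE_iff)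

lemma monom_at_in_power:
  assumes "\<And>l. l < CARD('n) \<Longrightarrow> gen {us l} \<le> U" "gen {z} \<le> U" "\<beta> \<in> PiE {..<CARD('n)} (\<lambda>_. {..X})"
  shows "monom_at X us z \<beta> \<in> els (U ^ (CARD('n) * X))"
proof -
  have "(\<Prod>l<k. us l ^ \<beta> l) \<in> els (U ^ (\<Sum>l<k. \<beta> l))" if "k \<le> CARD('n)" for k
    using that
  proof (induction k)
    case 0
    then show ?case by (simp add: one_le_iff[symmetric])
  next
    case (Suc k)
    have "gen {us k} ^ \<beta> k \<le> U ^ \<beta> k" using Suc.prems by (intro asub_power_mono assms) auto
    then have "us k ^ \<beta> k \<in> els (U ^ \<beta> k)" by (simp add: gen_singleton_power gen_le_iff)
    then have "(\<Prod>l<k. us l ^ \<beta> l) * us k ^ \<beta> k \<in> els (U ^ (\<Sum>l<k. \<beta> l) * U ^ \<beta> k)"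
      using Suc by (intro mult_els) auto
    then show ?case by (simp add: power_add)
  qed
  from this[of "CARD('n)"] have 1: "(\<Prod>l<CARD('n). us l ^ \<beta> l) \<in> els (U ^ (\<Sum>l<CARD('n). \<beta> l))" by simp
  let ?r = "CARD('n) * X - (\<Sum>l<CARD('n). \<beta> l)"
  have "gen {z} ^ ?r \<le> U ^ ?r" by (intro asub_power_mono assms)
  then have "z ^ ?r \<in> els (U ^ ?r)" by (simp add: gen_singleton_power gen_le_iff)
  then have "monom_at X us z \<beta> \<in> els (U ^ (\<Sum>l<CARD('n). \<beta> l) * U ^ ?r)"
    unfolding monom_at_def by (intro mult_els 1)
  also have "U ^ (\<Sum>l<CARD('n). \<beta> l) * U ^ ?r = U ^ (CARD('n) * X)"
    using sum_exponents_le[OF assms(3)] by (simp add: power_add[symmetric])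
  finally show ?thesis .
qed

text \<open>
  The relation comes from counting: there are more products of degree \<open>X + n X\<close> than lattice
  points in the corresponding multiple of \<open>P\<close>, so the products are dependent; cancelling the
  lowest power of \<open>b\<close> gives the relation.
\<close>

lemma relation_mod_section:
  assumes b: "b \<noteq> 0" "b \<in> els V" and us: "\<And>l. l < CARD('n) \<Longrightarrow> us l \<in> els V" "z \<in> els V"
  obtains X where "X \<ge> 1" "\<And>\<omega>. \<omega> \<in> latt P 1 \<Longrightarrow>
    \<exists>q. (\<exists>\<beta>\<in>PiE {..<CARD('n)} (\<lambda>_. {..X}). q \<beta> \<noteq> 0) \<and>
      laurent_monom \<omega> ^ Suc X * (\<Sum>\<beta>\<in>PiE {..<CARD('n)} (\<lambda>_. {..X}). cst (q \<beta>) * monom_at X us z \<beta>)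
        \<in> els (gen {b} * (W ^ X * V ^ (CARD('n) * X)))"
proof -
  obtain M where M: "\<And>d. card (latt P (real d)) \<le> (d * M + 1) ^ CARD('n)" using card_latt_bound by blast
  \<comment> \<open>There are \<open>(X + 1) ^ (n + 1)\<close> products, and by this choice at most
    \<open>(X + 1) ^ n * X\<close> lattice points, where \<open>n\<close> is
    \<open>CARD('n)\<close>.\<close>
  define X where "X = ((CARD('n) + 1) * M + 1) ^ CARD('n)"
  let ?B = "PiE {..<CARD('n)} (\<lambda>_. {..X})"
  let ?d = "X + CARD('n) * X"
  have X: "X \<ge> 1" by (simp add: X_def)
  have finB: "finite ?B" by (intro finite_PiE) auto
  have cardI: "card ({..X} \<times> ?B) = Suc X * Suc X ^ CARD('n)" by (simp add: card_cartesian_product card_PiE)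
  have "?d * M + 1 \<le> Suc X * ((CARD('n) + 1) * M + 1)" by (simp add: algebra_simps)
  then have "(?d * M + 1) ^ CARD('n) \<le> (Suc X * ((CARD('n) + 1) * M + 1)) ^ CARD('n)" by (rule power_mono) simp
  also have "\<dots> = Suc X ^ CARD('n) * X" by (simp only: power_mult_distrib X_def)
  also have "\<dots> < Suc X * Suc X ^ CARD('n)" by simp
  finally have card_lt: "card (latt P (real ?d)) < card ({..X} \<times> ?B)"
    using M[of ?d] unfolding cardI by linarith
  have gV: "gen {x} \<le> V" if "x \<in> els V" for x using that by (simp add: gen_le_iff)
  have in_power: "x ^ k \<in> els (T ^ k)" if "x \<in> els T" for x k and T :: "'n laurent_ring asub"
    using asub_power_mono[of "gen {x}" T k] that by (simp add: gen_singleton_power gen_le_iff)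
  have "\<exists>q. (\<exists>\<beta>\<in>?B. q \<beta> \<noteq> 0) \<and> laurent_monom \<omega> ^ Suc X * (\<Sum>\<beta>\<in>?B. cst (q \<beta>) * monom_at X us z \<beta>)
      \<in> els (gen {b} * (W ^ X * V ^ (CARD('n) * X)))" if \<omega>: "\<omega> \<in> latt P 1" for \<omega>
  proof -
    let ?w = "laurent_monom \<omega>"
    have wW: "?w \<in> els W"
    proof -
      have "1 * ?w \<in> els (C0 * S0 1)" using C0_one \<omega> unfolding S0_def
        by (intro mult_els monom_in_mon) (auto simp: one_le_iff)
      then show ?thesis by (simp add: W_def)
    qed
    have bW: "b \<in> els W" using leD_els[OF V_le_W b(2)] .
    have mV: "monom_at X us z \<beta> \<in> els (V ^ (CARD('n) * X))" if "\<beta> \<in> ?B" for \<beta>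
      using that us by (intro monom_at_in_power gV) auto
    \<comment> \<open>The powers of \<open>b\<close> and of the monomial \<open>?w\<close> have
      total degree \<open>X\<close>, so that all products are homogeneous of degree
      \<open>?d\<close>.\<close>
    define el where "el p = b ^ fst p * ?w ^ (X - fst p) * monom_at X us z (snd p)" for p
    have el_keys: "Poly_Mapping.keys (el p) \<subseteq> latt P (real ?d)" if p: "p \<in> {..X} \<times> ?B" for p
    proof -
      have sp: "snd p \<in> ?B" "fst p \<le> X" using p by (simp_all add: mem_Times_iff)
      have "el p \<in> els (W ^ fst p * W ^ (X - fst p) * V ^ (CARD('n) * X))"
        unfolding el_def by (intro mult_els in_power bW wW mV sp)
      also have "W ^ fst p * W ^ (X - fst p) = W ^ X" using sp by (simp add: power_add[symmetric])
      finally have "el p \<in> els (W ^ X * V ^ (CARD('n) * X))" .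
      moreover have "W ^ X * V ^ (CARD('n) * X) \<le> W ^ X * W ^ (CARD('n) * X)"
        by (intro asub_mult_mono asub_power_mono V_le_W order.refl)
      moreover have "W ^ X * W ^ (CARD('n) * X) \<le> C0 * S0 (real ?d)"
        using W_power_le[of ?d] by (simp add: power_add)
      ultimately have "el p \<in> els (C0 * S0 (real ?d))" by (meson leD_els)
      then show ?thesis by (simp add: S0_def mem_sca_UNIV_mon)
    qed
    obtain c where c: "\<exists>p\<in>{..X} \<times> ?B. c p \<noteq> 0"
      "\<forall>k\<in>latt P (real ?d). (\<Sum>p\<in>{..X} \<times> ?B. c p * coef (el p) k) = 0"
      using nontrivial_solution[OF finite_latt _ card_lt, of "\<lambda>p k. coef (el p) k"] finB by auto
    have zero: "(\<Sum>p\<in>{..X} \<times> ?B. cst (c p) * el p) = 0"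
    proof (rule poly_mapping_eqI)
      fix k
      show "coef (\<Sum>p\<in>{..X} \<times> ?B. cst (c p) * el p) k = coef 0 k"
      proof (cases "k \<in> latt P (real ?d)")
        case True
        then show ?thesis using c(2) by (simp add: lookup_sum coef_cst_times)
      next
        case False
        then have "coef (el p) k = 0" if "p \<in> {..X} \<times> ?B" for p
          using el_keys[OF that] by (auto simp: in_keys_iff)
        then show ?thesis by (simp add: lookup_sum coef_cst_times)
      qed
    qed
    define Qi where "Qi i = (\<Sum>\<beta>\<in>?B. cst (c (i, \<beta>)) * monom_at X us z \<beta>)" for i
    have QV: "Qi i \<in> els (V ^ (CARD('n) * X))" for i
    proof -
      have "C0 * V ^ (CARD('n) * X) = V ^ (CARD('n) * X)" using X by (intro C0_power_absorb C0_V) simp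
      moreover have "Qi i \<in> els (C0 * V ^ (CARD('n) * X))"
        unfolding Qi_def by (intro sum_els mult_els mV laurent.s_in_sca) auto
      ultimately show ?thesis by simp
    qed
    have zero': "(\<Sum>i\<le>X. b ^ i * ?w ^ (X - i) * Qi i) = 0"
      using zero unfolding Qi_def el_def sum.cartesian_product[symmetric]
      by (simp add: sum_distrib_left mult_ac case_prod_beta sum.cartesian_product)
    \<comment> \<open>Minimality refers to the coefficients \<open>c\<close> and not to the value
      \<open>Qi i0\<close>, which may vanish: a relation with some nonzero coefficient is all that
      is needed.\<close>
    define i0 where "i0 = (LEAST i. \<exists>\<beta>\<in>?B. c (i, \<beta>) \<noteq> 0)"
    have ex: "\<exists>i. \<exists>\<beta>\<in>?B. c (i, \<beta>) \<noteq> 0" using c(1) by auto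
    have i0: "\<exists>\<beta>\<in>?B. c (i0, \<beta>) \<noteq> 0" unfolding i0_def by (rule LeastI_ex[OF ex])
    have i0X: "i0 \<le> X"
    proof -
      obtain i \<beta> where "i \<le> X" "\<beta> \<in> ?B" "c (i, \<beta>) \<noteq> 0" using c(1) by auto
      then have "i0 \<le> i" unfolding i0_def by (intro Least_le) auto
      then show ?thesis using \<open>i \<le> X\<close> by simp
    qed
    have below: "Qi i = 0" if "i < i0" for i
      using not_less_Least[of i "\<lambda>i. \<exists>\<beta>\<in>?B. c (i, \<beta>) \<noteq> 0"] that by (simp add: Qi_def i0_def)
    define Y where "Y = (\<Sum>i\<in>{i0<..X}. b ^ (i - i0 - 1) * ?w ^ (X - i) * Qi i)"
    have "0 = (\<Sum>i\<in>{i0..X}. b ^ i * ?w ^ (X - i) * Qi i)"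
      unfolding zero'[symmetric] using below by (intro sum.mono_neutral_right) auto
    also have "{i0..X} = insert i0 {i0<..X}" using i0X by auto
    also have "(\<Sum>i\<in>insert i0 {i0<..X}. b ^ i * ?w ^ (X - i) * Qi i)
        = b ^ i0 * (?w ^ (X - i0) * Qi i0) + (\<Sum>i\<in>{i0<..X}. b ^ i * ?w ^ (X - i) * Qi i)"
      by (simp add: mult.assoc)
    also have "(\<Sum>i\<in>{i0<..X}. b ^ i * ?w ^ (X - i) * Qi i) = b ^ i0 * (b * Y)"
      unfolding Y_def sum_distrib_left
    proof (rule sum.cong[OF refl])
      fix i assume "i \<in> {i0<..X}"
      then have "i = i0 + Suc (i - i0 - 1)" by auto
      then have "b ^ i = b ^ i0 * (b * b ^ (i - i0 - 1))" by (metis power_Suc power_add)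
      then show "b ^ i * ?w ^ (X - i) * Qi i = b ^ i0 * (b * (b ^ (i - i0 - 1) * ?w ^ (X - i) * Qi i))"
        by (simp add: mult_ac)
    qed
    finally have "b ^ i0 * (?w ^ (X - i0) * Qi i0 + b * Y) = b ^ i0 * 0" by (simp add: distrib_left)
    then have "?w ^ (X - i0) * Qi i0 + b * Y = 0"
      using laurent_cancel[OF laurent_power_nonzero[OF b(1)]] by blast
    then have eq: "?w ^ (X - i0) * Qi i0 = b * (- Y)" by (simp add: eq_neg_iff_add_eq_0)
    have YV: "?w ^ Suc i0 * Y \<in> els (W ^ X * V ^ (CARD('n) * X))"
      unfolding Y_def sum_distrib_left
    proof (rule sum_els)
      fix i assume i: "i \<in> {i0<..X}"
      have "?w ^ Suc i0 * (b ^ (i - i0 - 1) * ?w ^ (X - i) * Qi i)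
          \<in> els (W ^ Suc i0 * (W ^ (i - i0 - 1) * W ^ (X - i) * V ^ (CARD('n) * X)))"
        by (intro mult_els in_power wW bW QV)
      also have "W ^ Suc i0 * (W ^ (i - i0 - 1) * W ^ (X - i) * V ^ (CARD('n) * X))
          = W ^ (Suc i0 + (i - i0 - 1) + (X - i)) * V ^ (CARD('n) * X)"
        by (simp add: power_add mult_ac)
      also have "Suc i0 + (i - i0 - 1) + (X - i) = X" using i by auto
      finally show "?w ^ Suc i0 * (b ^ (i - i0 - 1) * ?w ^ (X - i) * Qi i) \<in> els (W ^ X * V ^ (CARD('n) * X))" .
    qed
    \<comment> \<open>The factor \<open>?w ^ Suc i0\<close> makes the exponent of \<open>?w\<close>
      independent of \<open>i0\<close> and brings the other side up to degree \<open>X\<close> in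
      \<open>W\<close>.\<close>
    have "?w ^ Suc X * Qi i0 = ?w ^ Suc i0 * (?w ^ (X - i0) * Qi i0)"
    proof -
      have "Suc X = Suc i0 + (X - i0)" using i0X by simp
      then have "?w ^ Suc X = ?w ^ Suc i0 * ?w ^ (X - i0)" by (simp only: power_add)
      then show ?thesis by (simp only: mult.assoc)
    qed
    also have "\<dots> = b * (- (?w ^ Suc i0 * Y))" unfolding eq by (simp add: mult_ac)
    also have "\<dots> \<in> els (gen {b} * (W ^ X * V ^ (CARD('n) * X)))"
      by (intro mult_els gen_base uminus_els YV) auto
    finally show ?thesis
      using i0 unfolding Qi_def by (intro exI[of _ "\<lambda>\<beta>. c (i0, \<beta>)"]) blast
  qed
  then show ?thesis using that X by blast
qed

end

lemma mon_eq_sum: "finite X \<Longrightarrow> mon X = (\<Sum>\<omega>\<in>X. gen {laurent_monom \<omega>})"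
  using gen_UN[of X "\<lambda>\<omega>. {laurent_monom \<omega>}"] by (simp add: mon_def UNION_singleton_eq_range)

context toric_data
begin

lemma noether_step:
  assumes b: "b \<noteq> 0" "b \<in> els V" and us: "\<And>i. i < Suc k \<Longrightarrow> us i \<in> els V" and k: "k \<ge> CARD('n)"
    and good: "good b us (Suc k) r s"
  shows "\<exists>us' r' s'. (\<forall>i<k. us' i \<in> els V) \<and> good b us' k r' s'"
proof -
  define z where "z = us k"
  have zV: "z \<in> els V" using us[of k] by (simp add: z_def)
  obtain X where X: "X \<ge> 1" and rel: "\<And>\<omega>. \<omega> \<in> latt P 1 \<Longrightarrow>
    \<exists>q. (\<exists>\<beta>\<in>PiE {..<CARD('n)} (\<lambda>_. {..X}). q \<beta> \<noteq> 0) \<and>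
      laurent_monom \<omega> ^ Suc X * (\<Sum>\<beta>\<in>PiE {..<CARD('n)} (\<lambda>_. {..X}). cst (q \<beta>) * monom_at X us z \<beta>)
        \<in> els (gen {b} * (W ^ X * V ^ (CARD('n) * X)))"
    using relation_mod_section[OF b, of us z] us k zV by auto
  let ?B = "PiE {..<CARD('n)} (\<lambda>_. {..X})" and ?s1 = "CARD('n) * X"
  have finB: "finite ?B" by (intro finite_PiE) auto
  define Rel where "Rel \<omega> q \<longleftrightarrow> (\<exists>\<beta>\<in>?B. q \<beta> \<noteq> 0) \<and>
    laurent_monom \<omega> ^ Suc X * (\<Sum>\<beta>\<in>?B. cst (q \<beta>) * monom_at X us z \<beta>) \<in> els (gen {b} * (W ^ X * V ^ ?s1))"
    for \<omega> q
  have "\<forall>\<omega>\<in>latt P 1. \<exists>q. Rel \<omega> q" unfolding Rel_def using rel by (rule ballI)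
  from bchoice[OF this] obtain q where Rel: "\<forall>\<omega>\<in>latt P 1. Rel \<omega> (q \<omega>)" by (rule exE)
  have q: "\<exists>\<beta>\<in>?B. q \<omega> \<beta> \<noteq> 0"
    "laurent_monom \<omega> ^ Suc X * (\<Sum>\<beta>\<in>?B. cst (q \<omega> \<beta>) * monom_at X us z \<beta>)
        \<in> els (gen {b} * (W ^ X * V ^ ?s1))" if "\<omega> \<in> latt P 1" for \<omega>
    using bspec[OF Rel that] unfolding Rel_def by (rule conjunct1, rule conjunct2)
  let ?dig = "digits (Suc X) CARD('n)"
  define pp where "pp \<omega> = (\<Sum>\<beta>\<in>?B. monom (q \<omega> \<beta>) (?dig \<beta>))" for \<omega>
  have pp_nz: "pp \<omega> \<noteq> 0" if \<omega>: "\<omega> \<in> latt P 1" for \<omega>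
  proof -
    obtain \<beta> where \<beta>: "\<beta> \<in> ?B" "q \<omega> \<beta> \<noteq> 0" using q(1)[OF \<omega>] by blast
    have "coeff (pp \<omega>) (?dig \<beta>) = (\<Sum>\<gamma>\<in>?B. if \<gamma> = \<beta> then q \<omega> \<beta> else 0)"
      unfolding pp_def coeff_sum coeff_monom
      using inj_onD[OF inj_on_digits _ _ \<beta>(1)] by (intro sum.cong refl) auto
    also have "\<dots> = q \<omega> \<beta>" using \<beta>(1) finB by simp
    finally show ?thesis using \<beta>(2) by auto
  qed
  have "finite (\<Union>\<omega>\<in>latt P 1. {x. poly (pp \<omega>) x = 0})"
    using finite_latt pp_nz by (auto intro: poly_roots_finite)
  then obtain x where x: "x \<notin> (\<Union>\<omega>\<in>latt P 1. {x. poly (pp \<omega>) x = 0})"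
    using ex_new_if_finite[OF infinite_UNIV_char_0[where 'a = complex]] by blast
  \<comment> \<open>Substituting \<open>lam l * z\<close> for \<open>us l\<close> in the relation of
    \<open>\<omega>\<close> yields \<open>poly (pp \<omega>) x\<close> times a power of
    \<open>z\<close>, and \<open>x\<close> is not a root for any of the finitely many
    \<open>\<omega>\<close>.\<close>
  define lam where "lam l = x ^ (Suc X ^ l)" for l
  define us' where "us' i = (if i < CARD('n) then us i - cst (lam i) * z else us i)" for i
  define U' where "U' = lin us' k"
  define Uz where "Uz = U' + C0 * gen {z}"
  have C0U': "C0 * U' = U'" by (simp add: U'_def C0_lin)
  have cz: "cst c * z \<in> els V" for c
  proof -
    have "cst c * z \<in> els (C0 * V)" by (intro mult_els laurent.s_in_sca zV) simp
    then show ?thesis by (simp add: C0_V)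
  qed
  have us'V: "us' i \<in> els V" if "i < k" for i
    using us[of i] that cz by (auto simp: us'_def intro: diff_els)
  have U'V: "U' \<le> V" unfolding U'_def by (rule lin_le_V[OF us'V])
  have gz: "C0 * gen {z} \<le> V"
    using asub_mult_mono[OF order.refl, of "gen {z}" V C0] zV by (simp add: C0_V gen_le_iff)
  have UzV: "Uz \<le> V" using U'V gz by (simp add: Uz_def plus_le_iff)
  have us'U: "us' i \<in> els U'" if "i < k" for i
  proof -
    have "gen {us' i} \<le> C0 * gen {us' i}" using asub_mult_mono[OF C0_one order.refl, of "gen {us' i}"] by simp
    also have "\<dots> \<le> U'" unfolding U'_def lin_def
      by (rule asub_le_sum[of _ _ "\<lambda>i. C0 * gen {us' i}"]) (use that in auto)
    finally show ?thesis by (simp add: gen_le_iff)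
  qed
  have cstz: "cst c * z \<in> els Uz" for c
    unfolding Uz_def by (rule leD_els[OF asub_le_plus(2)]) (intro mult_els laurent.s_in_sca gen_base; simp)
  have zUz: "z \<in> els Uz" using cstz[of 1] by simp
  have U'Uz: "U' \<le> Uz" by (simp add: Uz_def)
  have usUz: "us i \<in> els Uz" if "i < k" for i
  proof (cases "i < CARD('n)")
    case True
    then have "us i = us' i + cst (lam i) * z" by (simp add: us'_def)
    then show ?thesis using add_els[OF leD_els[OF U'Uz us'U[OF that]] cstz] by simp
  next
    case False
    then show ?thesis using leD_els[OF U'Uz us'U[OF that]] by (simp add: us'_def)
  qed
  have C0Uz: "C0 * Uz = Uz"
    by (simp add: Uz_def distrib_left C0U' mult.assoc[symmetric] C0_idem)
  have ULe: "lin us (Suc k) \<le> Uz"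
  proof -
    have "C0 * gen {us i} \<le> Uz" if "i < Suc k" for i
    proof -
      have "us i \<in> els Uz" using usUz[of i] zUz that by (cases "i = k") (auto simp: z_def)
      then show ?thesis using asub_mult_mono[OF order.refl, of "gen {us i}" Uz C0] by (simp add: C0Uz gen_le_iff)
    qed
    then show ?thesis unfolding lin_def asub_sum_le_iff[OF finite_lessThan] by blast
  qed
  \<comment> \<open>The part of degree \<open>d\<close> of the ideal generated by \<open>U'\<close>,
    and \<open>eqv d\<close> is congruence modulo it. Degree \<open>0\<close> is separate since this
    ideal has no elements but \<open>0\<close> there, whereas \<open>d - 1\<close> would be
    truncated.\<close>
  define Kd where "Kd d = (if d = 0 then 0 else U' * Uz ^ (d - 1))" for d
  have Kd_mult: "Kd d * Uz ^ d' \<le> Kd (d + d')" for d d'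
    by (cases d) (auto simp: Kd_def power_add mult_ac)
  define eqv where "eqv d x y \<longleftrightarrow> x \<in> els (Uz ^ d) \<and> y \<in> els (Uz ^ d) \<and> x - y \<in> els (Kd d)" for d x y
  have eqv_mult: "eqv (d + d') (x * x') (y * y')" if "eqv d x y" "eqv d' x' y'" for d d' x y x' y'
  proof -
    have 1: "(x - y) * x' \<in> els (Kd (d + d'))"
      by (rule leD_els[OF Kd_mult mult_els]) (use that in \<open>auto simp: eqv_def\<close>)
    have "(x' - y') * y \<in> els (Kd (d' + d))"
      by (rule leD_els[OF Kd_mult mult_els]) (use that in \<open>auto simp: eqv_def\<close>)
    then have "(x - y) * x' + (x' - y') * y \<in> els (Kd (d + d'))" using 1 by (simp add: add_els add.commute[of d])
    moreover have "(x - y) * x' + (x' - y') * y = x * x' - y * y'" by (simp add: algebra_simps)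
    moreover have "x * x' \<in> els (Uz ^ (d + d'))" "y * y' \<in> els (Uz ^ (d + d'))"
      unfolding power_add using that by (auto simp: eqv_def intro: mult_els)
    ultimately show ?thesis unfolding eqv_def by simp
  qed
  have eqv_1: "eqv 0 1 1" using one_le_iff[of "1 :: 'n laurent_ring asub"] by (simp add: eqv_def Kd_def)
  have eqv_power: "eqv (d * m) (x ^ m) (y ^ m)" if "eqv d x y" for d m x y
  proof (induction m)
    case (Suc m)
    then show ?case using eqv_mult[OF that Suc.IH] by simp
  qed (simp add: eqv_1)
  have eqv_refl: "eqv d x x" if "x \<in> els (Uz ^ d)" for d x using that by (simp add: eqv_def)
  have eqv_us: "eqv 1 (us l) (cst (lam l) * z)" if "l < CARD('n)" for l
  proof -
    have "us l - cst (lam l) * z \<in> els (Kd 1)" using us'U[of l] that k by (simp add: us'_def Kd_def)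
    then show ?thesis using usUz[of l] that k cstz by (simp add: eqv_def)
  qed
  have cst_pow: "cst a ^ m = cst (a ^ m)" for a and m :: nat
    by (induction m) (simp_all add: mult_single)
  have eqv_prod: "eqv (\<Sum>l<j. \<beta> l) (\<Prod>l<j. us l ^ \<beta> l) (cst (\<Prod>l<j. lam l ^ \<beta> l) * z ^ (\<Sum>l<j. \<beta> l))"
    if "j \<le> CARD('n)" for j \<beta>
    using that
  proof (induction j)
    case 0
    show ?case using eqv_1 by simp
  next
    case (Suc j)
    have "eqv (1 * \<beta> j) (us j ^ \<beta> j) ((cst (lam j) * z) ^ \<beta> j)"
      using Suc.prems by (intro eqv_power eqv_us) simp
    then have "eqv (\<beta> j) (us j ^ \<beta> j) (cst (lam j ^ \<beta> j) * z ^ \<beta> j)"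
      by (simp add: power_mult_distrib cst_pow)
    moreover have "eqv (\<Sum>l<j. \<beta> l) (\<Prod>l<j. us l ^ \<beta> l) (cst (\<Prod>l<j. lam l ^ \<beta> l) * z ^ (\<Sum>l<j. \<beta> l))"
      using Suc by simp
    ultimately have "eqv ((\<Sum>l<j. \<beta> l) + \<beta> j) ((\<Prod>l<j. us l ^ \<beta> l) * us j ^ \<beta> j)
      ((cst (\<Prod>l<j. lam l ^ \<beta> l) * z ^ (\<Sum>l<j. \<beta> l)) * (cst (lam j ^ \<beta> j) * z ^ \<beta> j))"
      by (intro eqv_mult)
    moreover have "(cst (\<Prod>l<j. lam l ^ \<beta> l) * z ^ (\<Sum>l<j. \<beta> l)) * (cst (lam j ^ \<beta> j) * z ^ \<beta> j)
      = cst (\<Prod>l<Suc j. lam l ^ \<beta> l) * z ^ (\<Sum>l<Suc j. \<beta> l)"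
    proof -
      have "cst (\<Prod>l<Suc j. lam l ^ \<beta> l) = cst (\<Prod>l<j. lam l ^ \<beta> l) * (cst (lam j ^ \<beta> j) :: 'n laurent_ring)"
        by (simp add: mult_single)
      then show ?thesis by (simp only: sum.lessThan_Suc power_add mult_ac)
    qed
    ultimately show ?case by simp
  qed
  have lam_dig: "(\<Prod>l<CARD('n). lam l ^ \<beta> l) = x ^ ?dig \<beta>" for \<beta>
    by (simp add: lam_def digits_def power_sum power_mult[symmetric] mult.commute)
  have zW: "gen {z} ^ ?s1 * gen {laurent_monom \<omega>} ^ Suc X \<le> U' * (Uz ^ (?s1 - 1) * W ^ Suc X) + gen {b} * (W ^ X * V ^ ?s1)"
    if \<omega>: "\<omega> \<in> latt P 1" for \<omega>
  proof -
    let ?w = "laurent_monom \<omega>"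
    define Q where "Q = (\<Sum>\<beta>\<in>?B. cst (q \<omega> \<beta>) * monom_at X us z \<beta>)"
    define \<kappa> where "\<kappa> = poly (pp \<omega>) x"
    have \<kappa>0: "\<kappa> \<noteq> 0" using x \<omega> by (auto simp: \<kappa>_def)
    have s1: "?s1 > 0" using X by simp
    have C0Kd: "C0 * Kd ?s1 = Kd ?s1" using s1 by (simp add: Kd_def mult.assoc[symmetric] C0U')
    have mon_eqv: "monom_at X us z \<beta> - cst (x ^ ?dig \<beta>) * z ^ ?s1 \<in> els (Kd ?s1)" if \<beta>: "\<beta> \<in> ?B" for \<beta>
    proof -
      let ?r = "?s1 - (\<Sum>l<CARD('n). \<beta> l)"
      have "z ^ ?r \<in> els (Uz ^ ?r)"
        using asub_power_mono[of "gen {z}" Uz ?r] zUz by (simp add: gen_singleton_power gen_le_iff)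
      then have "eqv ((\<Sum>l<CARD('n). \<beta> l) + ?r) ((\<Prod>l<CARD('n). us l ^ \<beta> l) * z ^ ?r)
          ((cst (\<Prod>l<CARD('n). lam l ^ \<beta> l) * z ^ (\<Sum>l<CARD('n). \<beta> l)) * z ^ ?r)"
        by (intro eqv_mult eqv_prod eqv_refl order.refl)
      then show ?thesis using sum_exponents_le[OF \<beta>]
        by (simp add: eqv_def monom_at_def lam_dig mult.assoc power_add[symmetric])
    qed
    have "Q - cst \<kappa> * z ^ ?s1 = (\<Sum>\<beta>\<in>?B. cst (q \<omega> \<beta>) * (monom_at X us z \<beta> - cst (x ^ ?dig \<beta>) * z ^ ?s1))"
    proof -
      have "\<kappa> = (\<Sum>\<beta>\<in>?B. q \<omega> \<beta> * x ^ ?dig \<beta>)" by (simp add: \<kappa>_def pp_def poly_sum poly_monom)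
      moreover have "cst (\<Sum>\<beta>\<in>T. h \<beta>) = (\<Sum>\<beta>\<in>T. cst (h \<beta>) :: 'n laurent_ring)" for h and T :: "(nat \<Rightarrow> nat) set"
        by (induction T rule: infinite_finite_induct) (simp_all add: single_add)
      ultimately have "cst \<kappa> * z ^ ?s1 = (\<Sum>\<beta>\<in>?B. cst (q \<omega> \<beta>) * (cst (x ^ ?dig \<beta>) * z ^ ?s1))"
        by (simp add: sum_distrib_right mult_single mult.assoc[symmetric])
      then show ?thesis by (simp add: Q_def right_diff_distrib sum_subtractf)
    qed
    also have "\<dots> \<in> els (C0 * Kd ?s1)"
      by (intro sum_els mult_els laurent.s_in_sca mon_eqv) auto
    finally have d1: "Q - cst \<kappa> * z ^ ?s1 \<in> els (Kd ?s1)" unfolding C0Kd .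
    let ?R = "U' * (Uz ^ (?s1 - 1) * W ^ Suc X) + gen {b} * (W ^ X * V ^ ?s1)"
    have wW: "?w ^ Suc X \<in> els (W ^ Suc X)"
    proof -
      have "1 * ?w \<in> els (C0 * S0 1)" using C0_one \<omega> unfolding S0_def
        by (intro mult_els monom_in_mon) (auto simp: one_le_iff)
      then have "gen {?w} ^ Suc X \<le> W ^ Suc X" by (intro asub_power_mono) (simp add: W_def gen_le_iff)
      then show ?thesis by (simp only: gen_singleton_power gen_le_iff) simp
    qed
    have "(Q - cst \<kappa> * z ^ ?s1) * ?w ^ Suc X \<in> els (Kd ?s1 * W ^ Suc X)" by (intro mult_els d1 wW)
    then have "(Q - cst \<kappa> * z ^ ?s1) * ?w ^ Suc X \<in> els ?R"
      using s1 by (intro leD_els[OF asub_le_plus(1)]) (simp add: Kd_def mult.assoc)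
    moreover have "?w ^ Suc X * Q \<in> els ?R"
      using q(2)[OF \<omega>] unfolding Q_def by (rule leD_els[OF asub_le_plus(2)])
    ultimately have "?w ^ Suc X * Q - (Q - cst \<kappa> * z ^ ?s1) * ?w ^ Suc X \<in> els ?R" by (rule diff_els[rotated])
    moreover have "?w ^ Suc X * Q - (Q - cst \<kappa> * z ^ ?s1) * ?w ^ Suc X = cst \<kappa> * (z ^ ?s1 * ?w ^ Suc X)"
      by (simp add: algebra_simps)
    ultimately have "cst (1 / \<kappa>) * (cst \<kappa> * (z ^ ?s1 * ?w ^ Suc X)) \<in> els (C0 * ?R)"
      by (intro mult_els laurent.s_in_sca) auto
    moreover have "cst (1 / \<kappa>) * (cst \<kappa> * (z ^ ?s1 * ?w ^ Suc X)) = z ^ ?s1 * ?w ^ Suc X"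
      using \<kappa>0 by (simp add: mult.assoc[symmetric] mult_single)
    moreover have "C0 * ?R = ?R"
    proof -
      have "C0 * (gen {b} * (W ^ X * V ^ ?s1)) = gen {b} * (W ^ X * (C0 * V ^ ?s1))" by (simp only: mult_ac)
      also have "C0 * V ^ ?s1 = V ^ ?s1" by (intro C0_power_absorb C0_V s1)
      finally show ?thesis by (simp only: distrib_left mult.assoc[symmetric] C0U')
    qed
    ultimately have "z ^ ?s1 * ?w ^ Suc X \<in> els ?R" by simp
    then show ?thesis by (simp only: gen_singleton_power gen_singleton_mult gen_le_iff) simp
  qed
  define N where "N = card (latt P 1)"
  \<comment> \<open>By pigeonhole \<open>N * Suc X\<close> factors from \<open>W\<close> contain
    some monomial \<open>Suc X\<close> times, and the relation of that monomial applies.\<close>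
  define T where "T = N * Suc X"
  have ne: "latt P 1 \<noteq> {}" using zero_latt[OF P_0] by blast
  then have N0: "N > 0" using finite_latt by (simp add: N_def card_gt_0_iff)
  have T_eq: "T = Suc X + (N - 1) * Suc X" using N0 by (cases N) (auto simp: T_def)
  have s1: "?s1 > 0" using X by simp
  let ?R' = "U' * (Uz ^ (?s1 - 1) * W ^ T) + gen {b} * (W ^ (T - 1) * V ^ ?s1)"
  have W_sum: "W = (\<Sum>\<omega>\<in>latt P 1. C0 * gen {laurent_monom \<omega>})"
    by (simp add: W_def S0_def mon_eq_sum[OF finite_latt] sum_distrib_left)
  have zT: "(C0 * gen {z}) ^ ?s1 * W ^ T \<le> ?R'"
  proof -
    have "W ^ T \<le> (\<Sum>\<omega>\<in>latt P 1. (C0 * gen {laurent_monom \<omega>}) ^ Suc X * W ^ ((N - 1) * Suc X))"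
      unfolding T_def N_def W_sum by (rule asub_sum_power_le[OF finite_latt ne])
    then have "(C0 * gen {z}) ^ ?s1 * W ^ T
        \<le> (C0 * gen {z}) ^ ?s1 * (\<Sum>\<omega>\<in>latt P 1. (C0 * gen {laurent_monom \<omega>}) ^ Suc X * W ^ ((N - 1) * Suc X))"
      by (intro asub_mult_mono order.refl)
    also have "\<dots> \<le> ?R'"
      unfolding sum_distrib_left asub_sum_le_iff[OF finite_latt]
    proof
      fix \<omega> assume \<omega>: "\<omega> \<in> latt P 1"
      have "(C0 * gen {z}) ^ ?s1 * ((C0 * gen {laurent_monom \<omega>}) ^ Suc X * W ^ ((N - 1) * Suc X))
          = (C0 ^ ?s1 * C0 ^ Suc X) * ((gen {z} ^ ?s1 * gen {laurent_monom \<omega>} ^ Suc X) * W ^ ((N - 1) * Suc X))"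
        by (simp only: power_mult_distrib mult_ac)
      also have "\<dots> \<le> C0 * ((U' * (Uz ^ (?s1 - 1) * W ^ Suc X) + gen {b} * (W ^ X * V ^ ?s1)) * W ^ ((N - 1) * Suc X))"
        unfolding power_add[symmetric] by (intro asub_mult_mono C0_power zW[OF \<omega>] order.refl)
      also have "\<dots> = (C0 * U') * (Uz ^ (?s1 - 1) * (W ^ Suc X * W ^ ((N - 1) * Suc X)))
          + gen {b} * ((W ^ X * W ^ ((N - 1) * Suc X)) * (C0 * V ^ ?s1))"
        by (simp only: distrib_left distrib_right mult_ac)
      also have "\<dots> = ?R'"
      proof -
        have "W ^ Suc X * W ^ ((N - 1) * Suc X) = W ^ T" by (simp only: power_add[symmetric] T_eq)
        moreover have "W ^ X * W ^ ((N - 1) * Suc X) = W ^ (T - 1)" using T_eq by (simp add: power_add[symmetric])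
        moreover have "C0 * V ^ ?s1 = V ^ ?s1" by (intro C0_power_absorb C0_V s1)
        ultimately show ?thesis by (simp only: C0U')
      qed
      finally show "(C0 * gen {z}) ^ ?s1 * ((C0 * gen {laurent_monom \<omega>}) ^ Suc X * W ^ ((N - 1) * Suc X)) \<le> ?R'" .
    qed
    finally show ?thesis .
  qed
  have UzT: "Uz ^ ?s1 * W ^ T \<le> ?R'"
  proof -
    obtain m where m: "?s1 = Suc m" using s1 by (metis gr0_implies_Suc)
    have "Uz ^ ?s1 * W ^ T \<le> (U' * Uz ^ m + (C0 * gen {z}) ^ ?s1) * W ^ T"
      unfolding m Uz_def by (intro asub_mult_mono asub_power_plus_le order.refl)
    also have "\<dots> = U' * (Uz ^ (?s1 - 1) * W ^ T) + (C0 * gen {z}) ^ ?s1 * W ^ T"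
      using m by (simp add: distrib_right mult.assoc)
    also have "\<dots> \<le> ?R'" using zT by (simp add: plus_le_iff)
    finally show ?thesis .
  qed
  \<comment> \<open>The old reduction applied \<open>t\<close> times. With \<open>t = ?s1\<close>
    enough factors from the old elements are extracted for \<open>UzT\<close> to replace one of them
    by an element of \<open>U'\<close>.\<close>
  have iter: "W ^ Suc r * V ^ (s + t) \<le> lin us (Suc k) ^ t * (W ^ Suc r * V ^ s) + gen {b} * (W ^ r * V ^ (s + t))" for t
  proof (induction t)
    case (Suc t)
    let ?U = "lin us (Suc k)"
    have UV: "?U \<le> V" by (rule lin_le_V[OF us])
    have "W ^ Suc r * V ^ (s + Suc t) = (W ^ Suc r * V ^ Suc s) * V ^ t" by (simp add: power_add mult_ac)
    also have "\<dots> \<le> (?U * (W ^ Suc r * V ^ s) + gen {b} * (W ^ r * V ^ Suc s)) * V ^ t"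
      using good unfolding good_def by (intro asub_mult_mono order.refl)
    also have "\<dots> = ?U * (W ^ Suc r * V ^ (s + t)) + gen {b} * (W ^ r * V ^ (s + Suc t))"
      by (simp add: power_add algebra_simps)
    also have "\<dots> \<le> ?U * (?U ^ t * (W ^ Suc r * V ^ s) + gen {b} * (W ^ r * V ^ (s + t)))
        + gen {b} * (W ^ r * V ^ (s + Suc t))"
      by (intro asub_plus_mono asub_mult_mono order.refl Suc)
    also have "\<dots> = ?U ^ Suc t * (W ^ Suc r * V ^ s) + (gen {b} * (W ^ r * (?U * V ^ (s + t)))
        + gen {b} * (W ^ r * V ^ (s + Suc t)))"
      by (simp add: algebra_simps)
    also have "\<dots> \<le> ?U ^ Suc t * (W ^ Suc r * V ^ s) + (gen {b} * (W ^ r * V ^ (s + Suc t))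
        + gen {b} * (W ^ r * V ^ (s + Suc t)))"
    proof (intro asub_plus_mono asub_mult_mono order.refl)
      show "?U * V ^ (s + t) \<le> V ^ (s + Suc t)" using asub_mult_mono[OF UV order.refl, of "V ^ (s + t)"] by simp
    qed
    finally show ?case by simp
  qed (auto intro: asub_le_plusI1)
  have "good b us' k (r + T) (s + ?s1 - 1)"
    unfolding good_def
  proof -
    have Suc_s: "Suc (s + ?s1 - 1) = s + ?s1" using s1 by simp
    have T0: "T > 0" using N0 by (simp add: T_def)
    have "W ^ Suc (r + T) * V ^ (s + ?s1) = W ^ T * (W ^ Suc r * V ^ (s + ?s1))"
      by (simp add: power_add mult_ac)
    also have "\<dots> \<le> W ^ T * (lin us (Suc k) ^ ?s1 * (W ^ Suc r * V ^ s) + gen {b} * (W ^ r * V ^ (s + ?s1)))"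
      by (intro asub_mult_mono order.refl iter)
    also have "\<dots> \<le> W ^ T * (Uz ^ ?s1 * (W ^ Suc r * V ^ s) + gen {b} * (W ^ r * V ^ (s + ?s1)))"
      by (intro asub_mult_mono asub_plus_mono asub_power_mono ULe order.refl)
    also have "\<dots> = (Uz ^ ?s1 * W ^ T) * (W ^ Suc r * V ^ s) + gen {b} * (W ^ (r + T) * V ^ (s + ?s1))"
      by (simp add: power_add algebra_simps)
    also have "\<dots> \<le> ?R' * (W ^ Suc r * V ^ s) + gen {b} * (W ^ (r + T) * V ^ (s + ?s1))"
      by (intro asub_plus_mono asub_mult_mono UzT order.refl)
    also have "\<dots> = U' * (Uz ^ (?s1 - 1) * (W ^ (Suc r + T) * V ^ s))
        + (gen {b} * (W ^ (Suc r + (T - 1)) * V ^ (s + ?s1)) + gen {b} * (W ^ (r + T) * V ^ (s + ?s1)))"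
      by (simp only: distrib_right distrib_left power_add mult_ac add.assoc)
    also have "Suc r + (T - 1) = r + T" using T0 by simp
    also have "U' * (Uz ^ (?s1 - 1) * (W ^ (Suc r + T) * V ^ s)) \<le> U' * (W ^ Suc (r + T) * V ^ (s + ?s1 - 1))"
    proof -
      have "U' * (Uz ^ (?s1 - 1) * (W ^ (Suc r + T) * V ^ s)) \<le> U' * (V ^ (?s1 - 1) * (W ^ (Suc r + T) * V ^ s))"
        by (intro asub_mult_mono asub_power_mono UzV order.refl)
      also have "\<dots> = U' * (W ^ Suc (r + T) * (V ^ s * V ^ (?s1 - 1)))" by (simp add: mult_ac)
      also have "V ^ s * V ^ (?s1 - 1) = V ^ (s + ?s1 - 1)" using s1 by (simp add: power_add[symmetric])
      finally show ?thesis .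
    qed
    finally show "W ^ Suc (r + T) * V ^ Suc (s + ?s1 - 1)
        \<le> lin us' k * (W ^ Suc (r + T) * V ^ (s + ?s1 - 1)) + gen {b} * (W ^ (r + T) * V ^ Suc (s + ?s1 - 1))"
      unfolding Suc_s by (simp add: U'_def asub_plus_mono)
  qed
  then show ?thesis using us'V by blast
qed

text \<open>The generators of the ideal together form a reduction for trivial reasons, and they are
  dropped one at a time until \<open>n\<close> are left.\<close>

lemma exists_good:
  assumes b: "b \<noteq> 0" "b \<in> els V"
  shows "\<exists>us r s. (\<forall>i<CARD('n). us i \<in> els V) \<and> good b us CARD('n) r s"
proof -
  have step: "\<exists>us r s. (\<forall>i<CARD('n). us i \<in> els V) \<and> good b us CARD('n) r s"
    if "\<forall>i<CARD('n) + j. us i \<in> els V" "good b us (CARD('n) + j) r s" for us j r s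
    using that
  proof (induction j arbitrary: us r s)
    case 0
    then show ?case by auto
  next
    case (Suc j)
    from noether_step[OF b, of "CARD('n) + j" us r s] Suc.prems
    obtain us' r' s' where "\<forall>i<CARD('n) + j. us' i \<in> els V" "good b us' (CARD('n) + j) r' s'" by auto
    then show ?case by (rule Suc.IH)
  qed
  obtain h where h: "bij_betw h {0..<card J} J" using ex_bij_betw_nat_finite[OF J] by blast
  \<comment> \<open>Padding with zeros ensures that there are at least \<open>CARD('n)\<close>
    elements to begin with.\<close>
  define us where "us i = (if i < card J then f (h i) else 0)" for i
  have fV: "f j \<in> els V" if "j \<in> J" for j
  proof -
    have "1 * f j \<in> els (C0 * V0)" using C0_one that unfolding V0_def
      by (intro mult_els gen_base) (auto simp: one_le_iff)
    then show ?thesis by (simp add: V_def)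
  qed
  have usV: "us i \<in> els V" for i using fV bspec[OF bij_betwE[OF h]] by (auto simp: us_def)
  have "V \<le> lin us (CARD('n) + card J)"
  proof -
    have "V0 \<le> (\<Sum>i<CARD('n) + card J. gen {us i})"
      unfolding V0_def gen_le_iff
    proof
      fix x assume "x \<in> f ` J"
      then have "x \<in> f ` (h ` {0..<card J})" using h by (simp add: bij_betw_def)
      then obtain i where i: "i < card J" "x = us i" by (auto simp: us_def)
      have "gen {us i} \<le> (\<Sum>i<CARD('n) + card J. gen {us i})" using i by (intro asub_le_sum) auto
      then show "x \<in> els (\<Sum>i<CARD('n) + card J. gen {us i})" using i by (simp add: gen_le_iff)
    qed
    then have "C0 * V0 \<le> C0 * (\<Sum>i<CARD('n) + card J. gen {us i})" by (intro asub_mult_mono order.refl)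
    then show ?thesis by (simp add: V_def lin_def sum_distrib_left)
  qed
  then have "W * V \<le> W * lin us (CARD('n) + card J)" by (intro asub_mult_mono order.refl)
  then have "good b us (CARD('n) + card J) 0 0"
    by (auto simp: good_def mult.commute intro: asub_le_plusI1)
  then show ?thesis using usV by (intro step) auto
qed

end

section \<open>Containment in the ideal of \<open>p\<close>-th powers\<close>

context toric_data
begin

lemma S0_steps: "\<exists>d0\<ge>0. \<forall>d\<ge>d0. \<forall>k. S0 (d + real k) \<le> S0 1 ^ k * S0 d"
proof -
  obtain S where S: "finite S" "P = convex hull (int_vec ` S)"
    using P by (auto simp: lattice_polytope_def)
  have step: "S0 (d + 1) \<le> S0 1 * S0 d" if d: "d \<ge> real (card S)" for d
    unfolding S0_def mon_times
  proof (intro mon_mono subsetI)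
    fix b assume "b \<in> latt P (d + 1)"
    then obtain s where "s \<in> latt P 1" "b - s \<in> latt P d" using latt_step[OF S d] by blast
    then show "b \<in> {x + y |x y. x \<in> latt P 1 \<and> y \<in> latt P d}"
      by (intro CollectI exI[of _ s] exI[of _ "b - s"]) simp
  qed
  have "S0 (d + real k) \<le> S0 1 ^ k * S0 d" if d: "d \<ge> real (card S)" for d k
  proof (induction k)
    case (Suc k)
    have "S0 (d + real (Suc k)) = S0 ((d + real k) + 1)" by (simp add: algebra_simps)
    also have "\<dots> \<le> S0 1 * S0 (d + real k)" using d by (intro step) simp
    also have "\<dots> \<le> S0 1 * (S0 1 ^ k * S0 d)" by (intro asub_mult_mono order.refl Suc)
    finally show ?case by (simp add: mult.assoc)
  qed simp
  then show ?thesis by (intro exI[of _ "real (card S)"]) auto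
qed

lemma is_ring_sca: "is_ring (laurent.sca (ring_gen K) :: 'n laurent_ring asub)"
  by (simp add: is_ring_def laurent.one_le_sca ring_gen.one laurent.sca_mult[OF subring_ring_gen])

text \<open>The joint reduction extracts either \<open>n p\<close> factors from the span of the
  \<open>a i\<close>, among which one of them occurs \<open>p\<close> times, or \<open>p\<close>
  factors \<open>f j0\<close>. The set \<open>K\<close> does not depend on \<open>p\<close>, as the
  prime is chosen only after the ring of constants.\<close>

lemma joint_power:
  assumes j0: "j0 \<in> J" "f j0 \<noteq> 0"
  obtains K a r s where "finite K" "\<And>i. i < CARD('n) \<Longrightarrow> a i \<in> els (laurent.sca (ring_gen K) * V0)"
    "\<And>K' p. K \<subseteq> K' \<Longrightarrow> S0 1 ^ (r + p) * V0 ^ (s + CARD('n) * p) \<le>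
      laurent.sca (ring_gen K') * (((\<Sum>i<CARD('n). gen {a i ^ p}) + gen {f j0 ^ p}) * S0 (real (CARD('n) * p + r + s)))"
proof -
  let ?n = "CARD('n)"
  have V0_le: "V0 \<le> V" using asub_mult_mono[OF C0_one order.refl, of V0] by (simp add: V_def)
  have b0: "f j0 \<in> els V0" using j0 by (auto simp: V0_def intro: gen_base)
  obtain a r s where a: "\<And>i. i < ?n \<Longrightarrow> a i \<in> els V" and good: "good (f j0) a ?n r s"
    using exists_good[OF j0(2) leD_els[OF V0_le b0]] by blast
  have fgV0: "fg V0" unfolding V0_def using J by (intro fg_gen) auto
  have fgW: "fg (S0 1)" unfolding S0_def by (intro fg_mon finite_latt)
  have fgA: "fg (\<Sum>i<?n. gen {a i})" by (intro fg_sum fg_gen) auto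
  have "(\<Sum>i<?n. gen {a i}) \<le> C0 * V0"
    unfolding asub_sum_le_iff[OF finite_lessThan] using a by (simp add: gen_le_iff V_def)
  then obtain K1 where K1: "finite K1" "(\<Sum>i<?n. gen {a i}) \<le> laurent.sca (ring_gen K1) * V0"
    using laurent.fg_sca_descent[OF fgA] by blast
  let ?T0 = "\<Sum>i<?n. gen {a i}"
  let ?rhs = "?T0 * (S0 1 ^ Suc r * V0 ^ s) + gen {f j0} * (S0 1 ^ r * V0 ^ Suc s)"
  have "S0 1 ^ Suc r * V0 ^ Suc s \<le> C0 * ?rhs"
  proof -
    have WS: "S0 1 \<le> W" using asub_mult_mono[OF C0_one order.refl, of "S0 1"] by (simp add: W_def)
    have "S0 1 ^ Suc r * V0 ^ Suc s \<le> W ^ Suc r * V ^ Suc s"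
      by (intro asub_mult_mono asub_power_mono WS V0_le)
    also have "\<dots> \<le> lin a ?n * (W ^ Suc r * V ^ s) + gen {f j0} * (W ^ r * V ^ Suc s)"
      using good by (simp add: good_def)
    also have "\<dots> = C0 * (C0 ^ Suc r * C0 ^ s) * (?T0 * (S0 1 ^ Suc r * V0 ^ s))
        + (C0 ^ r * C0 ^ Suc s) * (gen {f j0} * (S0 1 ^ r * V0 ^ Suc s))"
      by (simp only: W_def V_def lin_def sum_distrib_left[symmetric] power_mult_distrib mult_ac)
    also have "\<dots> \<le> C0 * (?T0 * (S0 1 ^ Suc r * V0 ^ s)) + C0 * (gen {f j0} * (S0 1 ^ r * V0 ^ Suc s))"
    proof (intro asub_plus_mono asub_mult_mono order.refl)
      show "C0 * (C0 ^ Suc r * C0 ^ s) \<le> C0"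
        using C0_power[of "Suc (Suc r + s)"] by (simp add: power_add mult_ac)
      show "C0 ^ r * C0 ^ Suc s \<le> C0"
        using C0_power[of "r + Suc s"] by (simp only: power_add)
    qed
    finally show ?thesis by (simp add: distrib_left)
  qed
  then obtain K2 where K2: "finite K2" "S0 1 ^ Suc r * V0 ^ Suc s \<le> laurent.sca (ring_gen K2) * ?rhs"
    using laurent.fg_sca_descent[of "S0 1 ^ Suc r * V0 ^ Suc s"] fgV0 fgW by (blast intro: fg_mult fg_power)
  obtain K3 where K3: "finite K3" "V0 \<le> laurent.sca (ring_gen K3) * S0 1" by (rule V0_coefs)
  define K where "K = K1 \<union> K2 \<union> K3"
  show ?thesis
  proof (rule that[of K a r s])
    show "finite K" using K1 K2 K3 by (simp add: K_def)
    show "a i \<in> els (laurent.sca (ring_gen K) * V0)" if "i < ?n" for i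
    proof -
      have "gen {a i} \<le> ?T0" using that by (intro asub_le_sum) auto
      also have "\<dots> \<le> laurent.sca (ring_gen K) * V0"
        by (rule laurent.sca_descent_mono[OF K1(2)]) (auto simp: K_def)
      finally show ?thesis by (simp add: gen_le_iff)
    qed
    fix K' p assume KK': "K \<subseteq> K'"
    let ?A = "laurent.sca (ring_gen K') :: 'n laurent_ring asub"
    note AA = is_ring_mult[OF is_ring_sca[of K']] and Ap = is_ring_power[OF is_ring_sca[of K']]
    have A1: "1 \<le> ?A" using is_ring_sca by (simp add: is_ring_def)
    have T0V: "?T0 \<le> ?A * V0" by (rule laurent.sca_descent_mono[OF K1(2)]) (use KK' in \<open>auto simp: K_def\<close>)
    have red: "S0 1 ^ Suc r * V0 ^ Suc s \<le> ?A * ?rhs"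
      by (rule laurent.sca_descent_mono[OF K2(2)]) (use KK' in \<open>auto simp: K_def\<close>)
    have VW: "V0 \<le> ?A * S0 1" by (rule laurent.sca_descent_mono[OF K3(2)]) (use KK' in \<open>auto simp: K_def\<close>)
    define WA where "WA = ?A * S0 1"
    define VA where "VA = ?A * V0"
    define TA where "TA = ?A * ?T0"
    define BA where "BA = ?A * gen {f j0}"
    have T_sum: "TA = (\<Sum>i<?n. ?A * gen {a i})" by (simp add: TA_def sum_distrib_left)
    have VA_WA: "VA \<le> WA" using asub_mult_mono[OF order.refl VW, of ?A] by (simp add: VA_def WA_def mult.assoc[symmetric] AA)
    have TA_VA: "TA \<le> VA" using asub_mult_mono[OF order.refl T0V, of ?A] by (simp add: VA_def TA_def mult.assoc[symmetric] AA)
    have BA_VA: "BA \<le> VA" unfolding BA_def VA_def by (intro asub_mult_mono order.refl) (simp add: gen_le_iff b0)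
    have BA_WA: "BA \<le> WA" using BA_VA VA_WA by (rule order.trans)
    have Apow: "?A \<le> ?A ^ Suc k" for k
      using asub_power_increasing[OF A1, of 1 "Suc k"] by simp
    have red': "WA ^ Suc r * VA ^ Suc s \<le> TA * (WA ^ Suc r * VA ^ s) + BA * (WA ^ r * VA ^ Suc s)"
    proof -
      have "WA ^ Suc r * VA ^ Suc s = ?A ^ (Suc r + Suc s) * (S0 1 ^ Suc r * V0 ^ Suc s)"
        by (simp only: WA_def VA_def power_mult_distrib power_add mult_ac)
      also have "\<dots> \<le> ?A * (?A * ?rhs)" by (intro asub_mult_mono Ap red)
      also have "\<dots> = ?A * ?rhs" by (simp only: mult.assoc[symmetric] AA)
      also have "\<dots> = ?A * (?T0 * (S0 1 ^ Suc r * V0 ^ s)) + ?A * (gen {f j0} * (S0 1 ^ r * V0 ^ Suc s))"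
        by (simp only: distrib_left)
      also have "\<dots> \<le> ?A ^ Suc (Suc r + s) * (?T0 * (S0 1 ^ Suc r * V0 ^ s))
          + ?A ^ Suc (r + Suc s) * (gen {f j0} * (S0 1 ^ r * V0 ^ Suc s))"
        by (intro asub_plus_mono asub_mult_mono order.refl Apow)
      also have "\<dots> = TA * (WA ^ Suc r * VA ^ s) + BA * (WA ^ r * VA ^ Suc s)"
        by (simp only: WA_def VA_def TA_def BA_def power_mult_distrib power_add power_Suc mult_ac)
      finally show ?thesis .
    qed
    have WA_pow: "WA ^ k * VA ^ l \<le> ?A * S0 (real (k + l))" for k l
    proof -
      have "WA ^ k * VA ^ l \<le> WA ^ k * WA ^ l" by (intro asub_mult_mono asub_power_mono VA_WA order.refl)
      also have "\<dots> = WA ^ (k + l)" by (simp only: power_add)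
      also have "\<dots> = ?A ^ (k + l) * S0 1 ^ (k + l)" by (simp only: WA_def power_mult_distrib)
      also have "\<dots> \<le> ?A * S0 (1 * real (k + l))" by (intro asub_mult_mono Ap S0_power) auto
      finally show ?thesis by simp
    qed
    let ?S = "S0 (real (?n * p + r + s))" and ?G = "(\<Sum>i<?n. gen {a i ^ p}) + gen {f j0 ^ p}"
    have n1: "?n \<ge> 1" by simp
    have np: "p + (?n - 1) * p = ?n * p"
    proof -
      have "(1 + (?n - 1)) * p = ?n * p" using n1 by (simp only: le_add_diff_inverse)
      then show ?thesis by (simp only: distrib_right mult_1)
    qed
    have "S0 1 ^ (r + p) * V0 ^ (s + ?n * p) \<le> WA ^ (r + p) * VA ^ (s + ?n * p)"
      using asub_mult_mono[OF A1 order.refl, of "S0 1"] asub_mult_mono[OF A1 order.refl, of V0]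
      by (intro asub_mult_mono asub_power_mono) (simp_all add: WA_def VA_def)
    also have "\<dots> \<le> TA ^ (?n * p) * (WA ^ (r + p) * VA ^ s) + BA ^ p * (WA ^ r * VA ^ (s + ?n * p))"
      by (rule asub_joint_reduction_power[OF red' TA_VA BA_WA])
    also have "\<dots> \<le> (?A * (?G * ?S)) + (?A * (?G * ?S))"
    proof (rule asub_plus_mono)
      have "TA ^ (?n * p) \<le> (\<Sum>i<?n. (?A * gen {a i}) ^ p * TA ^ ((?n - 1) * p))"
        using asub_sum_power_le[of "{..<?n}" "\<lambda>i. ?A * gen {a i}" p] n1 by (simp add: T_sum lessThan_empty_iff)
      also have "\<dots> \<le> (\<Sum>i<?n. ?A * gen {a i ^ p} * VA ^ ((?n - 1) * p))"
        unfolding power_mult_distrib gen_singleton_power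
        by (intro asub_sum_mono asub_mult_mono Ap order.refl asub_power_mono TA_VA)
      also have "\<dots> = ?A * (\<Sum>i<?n. gen {a i ^ p}) * VA ^ ((?n - 1) * p)"
        by (simp only: sum_distrib_left sum_distrib_right)
      finally have "TA ^ (?n * p) * (WA ^ (r + p) * VA ^ s)
          \<le> ?A * (\<Sum>i<?n. gen {a i ^ p}) * VA ^ ((?n - 1) * p) * (WA ^ (r + p) * VA ^ s)"
        by (intro asub_mult_mono order.refl)
      also have "\<dots> = ?A * ((\<Sum>i<?n. gen {a i ^ p}) * (WA ^ (r + p) * VA ^ (s + (?n - 1) * p)))"
        by (simp only: power_add mult_ac)
      also have "\<dots> \<le> ?A * (?G * (?A * S0 (real ((r + p) + (s + (?n - 1) * p)))))"
        by (intro asub_mult_mono order.refl WA_pow asub_le_plus)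
      also have "(r + p) + (s + (?n - 1) * p) = ?n * p + r + s" using np by linarith
      also have "?A * (?G * (?A * ?S)) = (?A * ?A) * (?G * ?S)" by (simp only: mult_ac)
      finally show "TA ^ (?n * p) * (WA ^ (r + p) * VA ^ s) \<le> ?A * (?G * ?S)" by (simp only: AA)
      have "BA ^ p * (WA ^ r * VA ^ (s + ?n * p)) \<le> (?A * gen {f j0 ^ p}) * (?A * S0 (real (r + (s + ?n * p))))"
        unfolding BA_def power_mult_distrib gen_singleton_power by (intro asub_mult_mono order.refl Ap WA_pow)
      also have "\<dots> = (?A * ?A) * (gen {f j0 ^ p} * S0 (real (r + (s + ?n * p))))" by (simp only: mult_ac)
      also have "r + (s + ?n * p) = ?n * p + r + s" by simp
      also have "(?A * ?A) * (gen {f j0 ^ p} * ?S) \<le> ?A * (?G * ?S)"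
        unfolding AA by (intro asub_mult_mono order.refl asub_le_plus)
      finally show "BA ^ p * (WA ^ r * VA ^ (s + ?n * p)) \<le> ?A * (?G * ?S)" .
    qed
    finally show "S0 1 ^ (r + p) * V0 ^ (s + ?n * p) \<le> ?A * (?G * ?S)" by simp
  qed
qed

text \<open>The uniform multiplier leaves \<open>n p\<close> factors from the ideal and a support of
  size \<open>(e - 1) n p\<close>. The joint reduction needs \<open>p\<close> further factors of
  degree one, and \<open>en\<close> allows them to be taken from the support. The total size is
  \<open>e n p\<close>, of which \<open>p\<close> is carried by the extracted \<open>p\<close>-th
  power.\<close>

lemma frobenius_multiplier:
  assumes int: "integ u A0" and j0: "j0 \<in> J" "f j0 \<noteq> 0" and en: "(e - 1) * CARD('n) \<ge> 1"
  obtains K c D a where "finite K" "c \<noteq> 0" "D \<ge> 0"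
    "\<And>i. i \<le> CARD('n) \<Longrightarrow> a i \<in> els (laurent.sca (ring_gen K) * V0)"
    "\<And>p. c * \<phi> ^ (CARD('n) * p) \<in> els (laurent.sca (ring_gen K) *
      ((\<Sum>i\<le>CARD('n). gen {a i ^ p}) * S0 ((e * CARD('n) - 1) * real p + D)))"
proof -
  let ?n = "CARD('n)"
  obtain K1 c D where c: "finite K1" "c \<noteq> 0" "D \<ge> 0"
    "\<And>q. gen {c} * gen {\<phi>} ^ q \<le> laurent.sca (ring_gen K1) * (V0 ^ q * S0 ((e - 1) * real q + D))"
    using uniform_multiplier[OF int j0] by blast
  obtain K2 a r s where a: "finite K2" "\<And>i. i < ?n \<Longrightarrow> a i \<in> els (laurent.sca (ring_gen K2) * V0)"
    "\<And>K' p. K2 \<subseteq> K' \<Longrightarrow> S0 1 ^ (r + p) * V0 ^ (s + ?n * p) \<le>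
      laurent.sca (ring_gen K') * (((\<Sum>i<?n. gen {a i ^ p}) + gen {f j0 ^ p}) * S0 (real (?n * p + r + s)))"
    using joint_power[OF j0] by blast
  obtain d0 where d0: "d0 \<ge> 0" "\<And>d k. d \<ge> d0 \<Longrightarrow> S0 (d + real k) \<le> S0 1 ^ k * S0 d"
    using S0_steps by blast
  define K where "K = K1 \<union> K2"
  define a' where "a' i = (if i < ?n then a i else f j0)" for i
  let ?A = "laurent.sca (ring_gen K) :: 'n laurent_ring asub"
  note AA = is_ring_mult[OF is_ring_sca[of K]]
  have A1: "1 \<le> ?A" using is_ring_sca by (simp add: is_ring_def)
  have b0: "f j0 \<in> els V0" using j0 by (auto simp: V0_def intro: gen_base)
  have "a' i \<in> els (?A * V0)" if "i \<le> ?n" for i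
  proof (cases "i < ?n")
    case True
    have "laurent.sca (ring_gen K2) * V0 \<le> ?A * V0"
      by (intro asub_mult_mono laurent.sca_mono ring_gen_mono order.refl) (auto simp: K_def)
    then show ?thesis using a(2)[OF True] True by (auto simp: a'_def dest: leD_els)
  next
    case False
    have "1 * f j0 \<in> els (?A * V0)" using A1 b0 by (intro mult_els) (auto simp: one_le_iff)
    then show ?thesis using False by (simp add: a'_def)
  qed
  moreover have "c * f j0 ^ s * \<phi> ^ (?n * p) \<in> els (?A * ((\<Sum>i\<le>?n. gen {a' i ^ p}) *
      S0 ((e * ?n - 1) * real p + (D + d0 + 2 * real r + real s))))" for p
  proof -
    let ?G = "\<Sum>i\<le>?n. gen {a' i ^ p}"
    have G: "?G = (\<Sum>i<?n. gen {a i ^ p}) + gen {f j0 ^ p}"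
      by (simp add: a'_def lessThan_Suc_atMost[symmetric])
    \<comment> \<open>The support left after removing \<open>p\<close> factors of degree one. The
      summand \<open>d0\<close> keeps it in the range where \<open>S0_steps\<close> splits off
      lattice points.\<close>
    define d where "d = (e - 1) * real (?n * p) + D + d0 - real p"
    have "1 * real p \<le> ((e - 1) * ?n) * real p" using en by (intro mult_right_mono) auto
    then have dd0: "d \<ge> d0" using c(3) by (simp add: d_def mult.assoc)
    have dp: "(e - 1) * real (?n * p) + D \<le> d + real (r + p)" using d0(1) by (simp add: d_def)
    have "gen {c * f j0 ^ s} * gen {\<phi>} ^ (?n * p) = gen {f j0} ^ s * (gen {c} * gen {\<phi>} ^ (?n * p))"
      by (simp add: gen_singleton_mult[symmetric] gen_singleton_power mult_ac)
    also have "\<dots> \<le> V0 ^ s * (?A * (V0 ^ (?n * p) * S0 ((e - 1) * real (?n * p) + D)))"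
    proof (rule asub_mult_mono[OF asub_power_mono])
      show "gen {f j0} \<le> V0" by (simp add: gen_le_iff b0)
      show "gen {c} * gen {\<phi>} ^ (?n * p) \<le> ?A * (V0 ^ (?n * p) * S0 ((e - 1) * real (?n * p) + D))"
        by (rule laurent.sca_descent_mono[OF c(4)]) (simp add: K_def)
    qed
    also have "\<dots> \<le> V0 ^ s * (?A * (V0 ^ (?n * p) * (S0 1 ^ (r + p) * S0 d)))"
      using c(3) e by (intro asub_mult_mono order.refl order.trans[OF S0_mono[OF _ dp] d0(2)[OF dd0]]) simp
    also have "\<dots> = ?A * ((S0 1 ^ (r + p) * V0 ^ (s + ?n * p)) * S0 d)"
      by (simp only: power_add mult_ac)
    also have "\<dots> \<le> ?A * ((?A * (?G * S0 (real (?n * p + r + s)))) * S0 d)"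
      unfolding G by (intro asub_mult_mono order.refl a(3)) (simp add: K_def)
    also have "\<dots> = (?A * ?A) * (?G * (S0 (real (?n * p + r + s)) * S0 d))" by (simp only: mult_ac)
    also have "\<dots> \<le> ?A * (?G * S0 (real (?n * p + r + s) + d))"
      unfolding AA using dd0 d0(1) by (intro asub_mult_mono order.refl S0_mult) auto
    also have "\<dots> \<le> ?A * (?G * S0 ((e * ?n - 1) * real p + (D + d0 + 2 * real r + real s)))"
    proof (intro asub_mult_mono order.refl S0_mono)
      show "0 \<le> real (?n * p + r + s) + d" using dd0 d0(1) by simp
      show "real (?n * p + r + s) + d \<le> (e * ?n - 1) * real p + (D + d0 + 2 * real r + real s)"
        by (simp add: d_def algebra_simps)
    qed
    finally show ?thesis by (simp add: gen_singleton_power gen_singleton_mult gen_le_iff)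
  qed
  moreover have "c * f j0 ^ s \<noteq> 0" by (intro laurent_no_zero_divisors c laurent_power_nonzero j0)
  moreover have "D + d0 + 2 * real r + real s \<ge> 0" using c(3) d0(1) by simp
  moreover have "finite K" using c a by (simp add: K_def)
  ultimately show ?thesis using that by blast
qed

end

section \<open>Reduction modulo a large prime\<close>

lemma single_power:
  fixes c :: complex
  shows "Poly_Mapping.single \<gamma> c ^ k = (Poly_Mapping.single (nsc k \<gamma>) (c ^ k) :: 'n::finite laurent_ring)"
proof (induction k)
  case 0
  have "nsc 0 \<gamma> = 0" by (simp add: nsc_def vec_eq_iff)
  then show ?case by simp
next
  case (Suc k)
  have "nsc (Suc k) \<gamma> = \<gamma> + nsc k \<gamma>" by (simp add: nsc_def vec_eq_iff algebra_simps)
  then show ?case using Suc by (simp add: mult_single)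
qed

lemma subring_coefs:
  assumes "subring_set A"
  shows "subring_set {f :: 'n::finite laurent_ring. \<forall>a. coef f a \<in> A}"
  unfolding subring_set_def[of "{f. \<forall>a. coef f a \<in> A}"]
  by (auto simp: lookup_minus coef_times lookup_one when_def subring_setD[OF assms]
      intro!: subring_setD(9)[OF assms] subring_setD(6)[OF assms] subring_setD(3)[OF assms])

lemma frobenius_laurent:
  fixes a :: "'n::finite laurent_ring"
  assumes A: "subring_set A" and p: "prime p" and a: "\<And>\<gamma>. coef a \<gamma> \<in> A"
  obtains z where "\<And>\<gamma>. coef z \<gamma> \<in> A"
    "a ^ p = (\<Sum>\<gamma>\<in>Poly_Mapping.keys a. Poly_Mapping.single (nsc p \<gamma>) (coef a \<gamma> ^ p)) + of_nat p * z"
proof -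
  let ?x = "\<lambda>\<gamma>. Poly_Mapping.single \<gamma> (coef a \<gamma>) :: 'n laurent_ring"
  have "\<exists>z\<in>{f. \<forall>a. coef f a \<in> A}. (\<Sum>\<gamma>\<in>Poly_Mapping.keys a. ?x \<gamma>) ^ p = (\<Sum>\<gamma>\<in>Poly_Mapping.keys a. ?x \<gamma> ^ p) + of_nat p * z"
    by (rule frobenius_sum[OF subring_coefs[OF A] p])
      (use a subring_setD(2)[OF A] in \<open>auto simp: lookup_single when_def\<close>)
  moreover have "(\<Sum>\<gamma>\<in>Poly_Mapping.keys a. ?x \<gamma>) = a"
    by (rule poly_mapping_sum_single[symmetric]) auto
  ultimately show ?thesis using that by (auto simp: single_power)
qed

lemma coef_of_nat_times: "coef (of_nat k * (g :: 'n::finite laurent_ring)) w = of_nat k * coef g w"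
  by (induction k) (simp_all add: lookup_add distrib_right)

text \<open>Divided by \<open>m p + D\<close>, the point \<open>\<alpha> + p w\<close> tends to
  \<open>w / m\<close>, and \<open>P\<close> is closed. The bound on \<open>p\<close> is uniform in
  \<open>w\<close> because only points of a box independent of \<open>p\<close> can satisfy the
  premise.\<close>

lemma eventually_in_multiple:
  fixes P :: "(real ^ 'n::finite) set"
  assumes P: "compact P" "P \<subseteq> orthant" and m: "m > 0" and D: "D \<ge> 0"
  shows "\<exists>p0. \<forall>p\<ge>p0. \<forall>w. \<alpha> + nsc p w \<in> latt P (m * real p + D) \<longrightarrow> w \<in> latt P m"
proof -
  obtain M :: nat where M: "\<And>d b j. d \<ge> 0 \<Longrightarrow> b \<in> latt P d \<Longrightarrow> 0 \<le> b $ j \<and> real_of_int (b $ j) \<le> d * M"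
    using latt_in_box[OF P] by blast
  define B where "B = \<lceil>(m + D) * M + (\<Sum>j\<in>UNIV. \<bar>real_of_int (\<alpha> $ j)\<bar>)\<rceil>"
  let ?Box = "{w :: int ^ 'n. \<forall>j. - B \<le> w $ j \<and> w $ j \<le> B}"
  have box: "w \<in> ?Box" if w: "\<alpha> + nsc p w \<in> latt P (m * real p + D)" and p: "p \<ge> 1" for p w
  proof (intro CollectI allI)
    fix j
    have d: "m * real p + D \<ge> 0" using m D by simp
    have 1: "0 \<le> real_of_int (\<alpha> $ j) + real p * real_of_int (w $ j)"
      "real_of_int (\<alpha> $ j) + real p * real_of_int (w $ j) \<le> (m * real p + D) * M"
      using M[OF d w, of j] by (auto simp: nsc_def)
        (metis of_int_0_le_iff of_int_add of_int_mult of_int_of_nat_eq)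
    have aj: "\<bar>real_of_int (\<alpha> $ j)\<bar> \<le> (\<Sum>j\<in>UNIV. \<bar>real_of_int (\<alpha> $ j)\<bar>)" (is "_ \<le> ?s")
      by (rule member_le_sum) auto
    have B: "(m + D) * M + ?s \<le> real_of_int B" unfolding B_def by (rule le_of_int_ceiling)
    have MD: "(m + D) * M \<ge> 0" using m D by simp
    have p1: "real p \<ge> 1" using p by simp
    have "D * 1 \<le> D * real p" using D p1 by (intro mult_left_mono)
    then have "(m * real p + D) * M \<le> ((m + D) * real p) * M"
      by (intro mult_right_mono) (auto simp: algebra_simps)
    moreover have "?s * 1 \<le> ?s * real p" using p1 by (intro mult_left_mono) (auto intro: sum_nonneg)
    ultimately have "real p * real_of_int (w $ j) \<le> real p * ((m + D) * M + ?s)"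
      using 1(2) aj by (simp add: algebra_simps)
    then have "real_of_int (w $ j) \<le> (m + D) * M + ?s" using p1 by simp
    then have u: "real_of_int (w $ j) \<le> real_of_int B" using B by linarith
    have "real p * (- ?s) \<le> real p * real_of_int (w $ j)"
      using 1(1) aj \<open>?s * 1 \<le> ?s * real p\<close> by (simp add: algebra_simps)
    then have "- ?s \<le> real_of_int (w $ j)" using p1 by (simp only: mult_le_cancel_left_pos)
    then have "- real_of_int B \<le> real_of_int (w $ j)" using B MD by linarith
    then show "- B \<le> w $ j \<and> w $ j \<le> B" using u by linarith
  qed
  have one: "\<exists>p0. \<forall>p\<ge>p0. \<not> \<alpha> + nsc p w \<in> latt P (m * real p + D)" if w: "w \<notin> latt P m" for w
  proof (rule ccontr)
    assume "\<not> ?thesis"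
    then have fr: "\<forall>p0. \<exists>p\<ge>p0. \<alpha> + nsc p w \<in> latt P (m * real p + D)" by blast
    define y :: "nat \<Rightarrow> real ^ 'n" where "y p = (1 / (m * real p + D)) *\<^sub>R (int_vec \<alpha> + real p *\<^sub>R int_vec w)" for p
    have yP: "y p \<in> P" if "\<alpha> + nsc p w \<in> latt P (m * real p + D)" "p \<ge> 1" for p
    proof -
      have pos: "m * real p + D > 0" using m D that(2) by (simp add: add_pos_nonneg)
      obtain x where "x \<in> P" "int_vec (\<alpha> + nsc p w) = (m * real p + D) *\<^sub>R x"
        using \<open>\<alpha> + nsc p w \<in> _\<close> by (auto simp: latt_def)
      then show ?thesis using pos by (simp add: y_def)
    qed
    have lim: "y \<longlonglongrightarrow> (1 / m) *\<^sub>R int_vec w"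
    proof -
      have a: "(\<lambda>p. 1 / (m * real p + D)) \<longlonglongrightarrow> 0"
      proof (rule real_tendsto_divide_at_top[OF tendsto_const])
        show "filterlim (\<lambda>p. m * real p + D) at_top sequentially"
          by (rule filterlim_at_top_mono[OF filterlim_tendsto_pos_mult_at_top[OF tendsto_const m filterlim_real_sequentially]])
            (use D in simp)
      qed
      have "(\<lambda>p. real p * (1 / (m * real p + D))) \<longlonglongrightarrow> 1 / m"
      proof -
        have "(\<lambda>p. 1 / m - D / m * (1 / (m * real p + D))) \<longlonglongrightarrow> 1 / m - D / m * 0"
          by (intro tendsto_intros a)
        moreover have "eventually (\<lambda>p. 1 / m - D / m * (1 / (m * real p + D)) = real p * (1 / (m * real p + D))) sequentially"
        proof (rule eventually_sequentiallyI[of 1])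
          fix p :: nat assume "p \<ge> 1"
          then have t0: "m * real p + D \<noteq> 0" using m D by (simp add: add_pos_nonneg less_imp_neq[symmetric])
          have "1 / m - D / m * (1 / t) = (t - D) / m * (1 / t)" if "t \<noteq> 0" for t
            using m that by (simp add: field_simps)
          from this[OF t0] show "1 / m - D / m * (1 / (m * real p + D)) = real p * (1 / (m * real p + D))"
            using m by simp
        qed
        ultimately show ?thesis by (simp add: tendsto_cong)
      qed
      then have "(\<lambda>p. (1 / (m * real p + D)) *\<^sub>R int_vec \<alpha> + (real p * (1 / (m * real p + D))) *\<^sub>R int_vec w)
          \<longlonglongrightarrow> 0 *\<^sub>R (int_vec \<alpha> :: real ^ 'n) + (1 / m) *\<^sub>R int_vec w"
        by (intro tendsto_intros a)
      then show ?thesis by (simp add: y_def[abs_def] scaleR_add_right mult.commute)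
    qed
    have "(1 / m) *\<^sub>R int_vec w \<in> P"
    proof (rule ccontr)
      assume "(1 / m) *\<^sub>R int_vec w \<notin> P"
      moreover have "open (- P)" using compact_imp_closed[OF P(1)] by (simp add: open_Compl)
      ultimately have "eventually (\<lambda>p. y p \<in> - P) sequentially"
        using lim by (auto dest: topological_tendstoD)
      then obtain N where N: "\<And>p. p \<ge> N \<Longrightarrow> y p \<notin> P" by (auto simp: eventually_sequentially)
      obtain p where p: "p \<ge> max N 1" "\<alpha> + nsc p w \<in> latt P (m * real p + D)" using fr by blast
      have "y p \<in> P" using yP[OF p(2)] p(1) by simp
      moreover have "y p \<notin> P" using N[of p] p(1) by simp
      ultimately show False by blast
    qed
    then have "w \<in> latt P m"
      using m by (auto simp: latt_def intro!: image_eqI[of _ _ "(1 / m) *\<^sub>R int_vec w"])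
    then show False using w by blast
  qed
  have fin: "finite (?Box - latt P m)" using finite_int_box by blast
  have "\<exists>p0. \<forall>p\<ge>p0. \<forall>w\<in>T. \<not> \<alpha> + nsc p w \<in> latt P (m * real p + D)" if "finite T" "T \<subseteq> - latt P m" for T
    using that
  proof (induction T rule: finite_induct)
    case (insert w T)
    then obtain p0 where p0: "\<forall>p\<ge>p0. \<forall>w\<in>T. \<not> \<alpha> + nsc p w \<in> latt P (m * real p + D)" by auto
    obtain p1 where p1: "\<forall>p\<ge>p1. \<not> \<alpha> + nsc p w \<in> latt P (m * real p + D)" using one[of w] insert by auto
    show ?case using p0 p1 by (intro exI[of _ "max p0 p1"]) auto
  qed auto
  from this[OF fin] obtain p0 where p0: "\<forall>p\<ge>p0. \<forall>w\<in>?Box - latt P m. \<not> \<alpha> + nsc p w \<in> latt P (m * real p + D)"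
    by blast
  have "w \<in> latt P m" if p: "p \<ge> max p0 1" and w: "\<alpha> + nsc p w \<in> latt P (m * real p + D)" for p w
  proof (rule ccontr)
    assume "w \<notin> latt P m"
    then have "w \<in> ?Box - latt P m" using box[OF w] p by simp
    then show False using p0 p w by simp
  qed
  then show ?thesis by (intro exI[of _ "max p0 1"]) blast
qed

context toric_data
begin

text \<open>
  If \<open>\<phi>\<^sup>n\<close> were not in the span, a linear functional \<open>L\<close> would separate it. With
  \<open>l w = L (z\<^sup>w)\<close> the functional \<open>g \<mapsto> \<Sum>w. g\<^bsub>\<alpha> + p w\<^esub> (l w)\<^sup>p\<close> is modulo \<open>p\<close> the Frobenius
  twist of \<open>L\<close>: it kills every \<open>a\<^sub>i\<^sup>p g\<^sub>i\<close> and maps \<open>c \<phi>\<^bsup>n p\<^esup>\<close> to the unit \<open>c\<^sub>\<alpha>\<close>.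
\<close>

lemma power_membership:
  assumes int: "integ u A0" and j0: "j0 \<in> J" "f j0 \<noteq> 0" and en: "(e - 1) * CARD('n) \<ge> 1"
  shows "\<phi> ^ CARD('n) \<in> els (C0 * (V0 * S0 (e * CARD('n) - 1)))"
proof (rule ccontr)
  let ?n = "CARD('n)"
  let ?H = "els (C0 * (V0 * S0 (e * ?n - 1)))"
  assume notin: "\<phi> ^ ?n \<notin> ?H"
  have smul: "cst c * x \<in> ?H" if "x \<in> ?H" for c x
  proof -
    have "cst c * x \<in> els (C0 * (C0 * (V0 * S0 (e * ?n - 1))))" by (intro mult_els laurent.s_in_sca that) simp
    then show ?thesis by (simp only: mult.assoc[symmetric] C0_idem)
  qed
  obtain L where L: "\<And>x y. L (x + y) = L x + L y" "\<And>c x. L (cst c * x) = c * L x"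
    "\<And>x. x \<in> ?H \<Longrightarrow> L x = (0 :: complex)" "L (\<phi> ^ ?n) = 1"
    by (rule separating_functional[of ?H "\<phi> ^ ?n"])
      (rule zero_els, rule add_els, assumption, assumption, rule smul, assumption, rule notin, rule that)
  have n1: "real ?n \<ge> 1" by simp
  have en1: "e * ?n - 1 \<ge> ?n" using en by (simp add: algebra_simps)
  define E where "E = latt P (e * ?n)"
  define E' where "E' = latt P (e * ?n - 1)"
  have finE: "finite E" "finite E'" by (simp_all add: E_def E'_def finite_latt)
  have EE: "w + \<gamma> \<in> E" if "w \<in> E'" "\<gamma> \<in> latt P 1" for w \<gamma>
    using latt_add[OF convex_P, of "e * ?n - 1" 1 w \<gamma>] that en1 n1 by (simp add: E_def E'_def)
  \<comment> \<open>Cut off outside the finite set \<open>E\<close>, so that only finitely many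
    values have to be adjoined to the ring of constants.\<close>
  define l where "l w = (if w \<in> E then L (laurent_monom w) else 0)" for w
  have L_sum: "L (\<Sum>i\<in>I. x i) = (\<Sum>i\<in>I. L (x i))" for x :: "'b \<Rightarrow> 'n laurent_ring" and I
  proof (induction I rule: infinite_finite_induct)
    have "L 0 = 0" using L(1)[of 0 0] by simp
    then show "L (\<Sum>i\<in>{}. x i) = (\<Sum>i\<in>{}. L (x i))" by simp
    then show "L (\<Sum>i\<in>A. x i) = (\<Sum>i\<in>A. L (x i))" if "infinite A" for A using that by simp
  qed (simp add: L(1))
  have L_l: "L g = (\<Sum>\<gamma>\<in>Poly_Mapping.keys g. coef g \<gamma> * l \<gamma>)" if "Poly_Mapping.keys g \<subseteq> E" for g
  proof -
    have "L g = L (\<Sum>\<gamma>\<in>Poly_Mapping.keys g. cst (coef g \<gamma>) * laurent_monom \<gamma>)"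
      by (subst laurent_sum_monom[OF finite_keys order.refl, of g]) simp
    also have "\<dots> = (\<Sum>\<gamma>\<in>Poly_Mapping.keys g. coef g \<gamma> * L (laurent_monom \<gamma>))" by (simp add: L_sum L(2))
    also have "\<dots> = (\<Sum>\<gamma>\<in>Poly_Mapping.keys g. coef g \<gamma> * l \<gamma>)"
      using that by (intro sum.cong refl) (auto simp: l_def)
    finally show ?thesis .
  qed
  obtain K c D a where M: "finite K" "c \<noteq> 0" "D \<ge> 0"
    "\<And>i. i \<le> ?n \<Longrightarrow> a i \<in> els (laurent.sca (ring_gen K) * V0)"
    "\<And>p. c * \<phi> ^ (?n * p) \<in> els (laurent.sca (ring_gen K) *
      ((\<Sum>i\<le>?n. gen {a i ^ p}) * S0 ((e * ?n - 1) * real p + D)))"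
    using frobenius_multiplier[OF int j0 en] by metis
  obtain K3 where K3: "finite K3" "V0 \<le> laurent.sca (ring_gen K3) * S0 1" by (rule V0_coefs)
  obtain \<alpha> where \<alpha>: "\<alpha> \<in> Poly_Mapping.keys c" using M(2) by (metis all_not_in_conv keys_eq_empty)
  define ca where "ca = coef c \<alpha>"
  have ca0: "ca \<noteq> 0" using \<alpha> by (simp add: ca_def in_keys_iff)
  \<comment> \<open>The inverse of \<open>ca\<close> is adjoined as well: if \<open>ca\<close> is
    divisible by \<open>p\<close> in this ring, then so is \<open>1\<close>.\<close>
  define K4 where "K4 = K \<union> K3 \<union> coef c ` Poly_Mapping.keys c \<union> coef (\<phi> ^ ?n) ` Poly_Mapping.keys (\<phi> ^ ?n)
    \<union> l ` E \<union> {1 / ca}"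
  have "finite K4" using M(1) K3(1) finE by (simp add: K4_def)
  define A where "A = ring_gen K4"
  have A: "subring_set A" unfolding A_def by (rule subring_ring_gen)
  note AD = subring_setD[OF A]
  have K4A: "x \<in> A" if "x \<in> K4" for x using that by (simp add: A_def ring_gen.base)
  have lA: "l w \<in> A" for w
    using K4A[of "l w"] AD(2) by (cases "w \<in> E") (auto simp: K4_def l_def)
  have coefA: "coef g w \<in> A" if "coef g ` Poly_Mapping.keys g \<subseteq> K4" for g :: "'n laurent_ring" and w
  proof (cases "w \<in> Poly_Mapping.keys g")
    case True
    then show ?thesis using that by (intro K4A) blast
  next
    case False
    then show ?thesis using AD(2) by (simp add: in_keys_iff)
  qed
  have cA: "coef c w \<in> A" and \<phi>A: "coef (\<phi> ^ ?n) w \<in> A" for w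
    by (rule coefA; auto simp: K4_def)+
  have KK4: "laurent.sca (ring_gen K) \<le> (laurent.sca A :: 'n laurent_ring asub)"
    "laurent.sca (ring_gen K3) \<le> (laurent.sca A :: 'n laurent_ring asub)"
    unfolding A_def by (intro laurent.sca_mono ring_gen_mono; auto simp: K4_def)+
  have aA: "Poly_Mapping.keys (a i) \<subseteq> latt P 1 \<and> (\<forall>w. coef (a i) w \<in> A)" if i: "i \<le> ?n" for i
  proof -
    have "laurent.sca (ring_gen K) * V0 \<le> laurent.sca A * (laurent.sca A * S0 1)"
      by (intro asub_mult_mono KK4 order.trans[OF K3(2)] order.refl)
    then have "laurent.sca (ring_gen K) * V0 \<le> laurent.sca A * S0 1"
      by (simp only: mult.assoc[symmetric] laurent.sca_mult[OF A])
    then have "a i \<in> els (laurent.sca A * mon (latt P 1))" using M(4)[OF i] by (auto simp: S0_def dest: leD_els)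
    then show ?thesis by (simp add: mem_sca_mon[OF A])
  qed
  \<comment> \<open>\<open>a i * laurent_monom w\<close> belongs to \<open>?H\<close>, where
    \<open>L\<close> vanishes; expanded into monomials this is a linear relation between the values
    of \<open>l\<close>.\<close>
  have a_kill: "(\<Sum>\<gamma>\<in>Poly_Mapping.keys (a i). coef (a i) \<gamma> * l (w + \<gamma>)) = 0" if i: "i \<le> ?n" and w: "w \<in> E'" for i w
  proof -
    have "laurent.sca (ring_gen K) * V0 \<le> C0 * V0" by (intro asub_mult_mono laurent.sca_mono order.refl) simp
    then have "a i * laurent_monom w \<in> els ((C0 * V0) * S0 (e * ?n - 1))"
      using M(4)[OF i] w by (intro mult_els) (auto simp: S0_def E'_def intro: monom_in_mon dest: leD_els)
    then have "0 = L (a i * laurent_monom w)" using L(3) by (simp add: mult.assoc)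
    also have "a i * laurent_monom w = (\<Sum>\<gamma>\<in>Poly_Mapping.keys (a i). cst (coef (a i) \<gamma>) * laurent_monom (w + \<gamma>))"
      by (subst laurent_sum_monom[OF finite_keys order.refl, of "a i"])
        (simp add: sum_distrib_left sum_distrib_right laurent_monom_add mult_ac)
    also have "L \<dots> = (\<Sum>\<gamma>\<in>Poly_Mapping.keys (a i). coef (a i) \<gamma> * l (w + \<gamma>))"
      unfolding L_sum L(2) using aA[OF i] EE[OF w] by (intro sum.cong refl) (auto simp: l_def)
    finally show ?thesis by simp
  qed
  have "\<phi> \<in> els (C0 * S0 e)" using \<phi> by (simp add: S0_def mem_sca_UNIV_mon)
  then have "gen {\<phi>} ^ ?n \<le> (C0 * S0 e) ^ ?n" by (intro asub_power_mono) (simp add: gen_le_iff)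
  also have "\<dots> \<le> C0 * S0 (e * ?n)"
    unfolding power_mult_distrib using e by (intro asub_mult_mono C0_power S0_power) auto
  finally have \<phi>E: "Poly_Mapping.keys (\<phi> ^ ?n) \<subseteq> E"
    by (simp add: gen_singleton_power gen_le_iff S0_def mem_sca_UNIV_mon E_def)
  have \<phi>L: "(\<Sum>\<gamma>\<in>Poly_Mapping.keys (\<phi> ^ ?n). coef (\<phi> ^ ?n) \<gamma> * l \<gamma>) = 1"
    using L_l[OF \<phi>E] L(4) by simp
  obtain p0 where p0: "\<And>p w. p \<ge> p0 \<Longrightarrow> \<alpha> + nsc p w \<in> latt P ((e * ?n - 1) * real p + D) \<Longrightarrow> w \<in> E'"
    using eventually_in_multiple[OF compact_P P_orthant _ M(3), of "e * ?n - 1" \<alpha>] en1 n1 unfolding E'_def by auto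
  \<comment> \<open>For \<open>p > Bc\<close> no other exponent of \<open>c\<close> is congruent to
    \<open>\<alpha>\<close> modulo \<open>p\<close>, so that \<open>\<Psi>\<close> sees only the
    coefficient \<open>ca\<close> of \<open>c\<close>.\<close>
  define Bc where "Bc = nat (\<Sum>\<beta>\<in>Poly_Mapping.keys c. \<Sum>j\<in>UNIV. \<bar>\<beta> $ j - \<alpha> $ j\<bar>)"
  obtain p where p: "prime p" "p > max p0 Bc" and inv: "\<And>x. x \<in> A \<Longrightarrow> of_nat p * x \<noteq> (1::complex)"
    using ring_gen_noninvertible_prime[OF \<open>finite K4\<close>] unfolding A_def by blast
  have sparse: "v = 0" if "\<alpha> + nsc p v \<in> Poly_Mapping.keys c" for v
  proof (rule ccontr)
    assume "v \<noteq> 0"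
    then obtain j where j: "v $ j \<noteq> 0" by (auto simp: vec_eq_iff)
    let ?\<beta> = "\<alpha> + nsc p v"
    have "int p * 1 \<le> int p * \<bar>v $ j\<bar>" using j by (intro mult_left_mono) auto
    also have "\<dots> = \<bar>?\<beta> $ j - \<alpha> $ j\<bar>" by (simp add: nsc_def abs_mult)
    also have "\<dots> \<le> (\<Sum>j\<in>UNIV. \<bar>?\<beta> $ j - \<alpha> $ j\<bar>)"
      by (rule member_le_sum[of j UNIV "\<lambda>j. \<bar>?\<beta> $ j - \<alpha> $ j\<bar>"]) auto
    also have "\<dots> \<le> (\<Sum>\<beta>\<in>Poly_Mapping.keys c. \<Sum>j\<in>UNIV. \<bar>\<beta> $ j - \<alpha> $ j\<bar>)"
      using that by (intro member_le_sum[of ?\<beta> "Poly_Mapping.keys c" "\<lambda>\<beta>. \<Sum>j\<in>UNIV. \<bar>\<beta> $ j - \<alpha> $ j\<bar>"])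
        (auto intro: sum_nonneg)
    finally show False using p(2) unfolding Bc_def by linarith
  qed
  define \<Psi> where "\<Psi> g = (\<Sum>w\<in>E. coef g (\<alpha> + nsc p w) * l w ^ p)" for g :: "'n laurent_ring"
  have \<Psi>_add: "\<Psi> (g + h) = \<Psi> g + \<Psi> h" for g h
    by (simp add: \<Psi>_def lookup_add distrib_right sum.distrib)
  have \<Psi>_sum: "\<Psi> (\<Sum>i\<in>I. x i) = (\<Sum>i\<in>I. \<Psi> (x i))" for x :: "'b \<Rightarrow> 'n laurent_ring" and I
    by (induction I rule: infinite_finite_induct) (simp_all add: \<Psi>_add, simp_all add: \<Psi>_def)
  have \<Psi>_p: "\<Psi> (of_nat p * g) = of_nat p * \<Psi> g" for g
    by (simp add: \<Psi>_def coef_of_nat_times sum_distrib_left mult.assoc)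
  have \<Psi>A: "\<Psi> g \<in> A" if "\<And>w. coef g w \<in> A" for g
    unfolding \<Psi>_def by (intro AD that lA)
  have nsc_diff: "\<alpha> + nsc p w - nsc p \<gamma> = \<alpha> + nsc p (w - \<gamma>)" for w \<gamma>
    by (simp add: nsc_def vec_eq_iff algebra_simps)
  have \<Psi>_single: "\<Psi> (Poly_Mapping.single (nsc p \<gamma>) t * g) = t * (\<Sum>w\<in>E. coef g (\<alpha> + nsc p (w - \<gamma>)) * l w ^ p)" for \<gamma> t g
    by (simp add: \<Psi>_def coef_single_times nsc_diff sum_distrib_left mult.assoc)
  define pA where "pA = {of_nat p * x |x. x \<in> A}"
  have pA_add: "x + y \<in> pA" if "x \<in> pA" "y \<in> pA" for x y
    using that AD(5) unfolding pA_def by (auto simp: distrib_left[symmetric])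
  have pA_mult: "x * y \<in> pA" if "x \<in> pA" "y \<in> A" for x y
    using that AD(6) unfolding pA_def by (auto simp: mult.assoc)
  have pA_0: "0 \<in> pA" using AD(2) unfolding pA_def by (auto intro: exI[of _ 0])
  have pA_sum: "(\<Sum>i\<in>I. x i) \<in> pA" if "\<And>i. i \<in> I \<Longrightarrow> x i \<in> pA" for x :: "'b \<Rightarrow> complex" and I
    using that by (induction I rule: infinite_finite_induct) (auto intro: pA_0 pA_add)
  have pA_I: "of_nat p * x \<in> pA" if "x \<in> A" for x using that by (auto simp: pA_def)
  have p0': "p > 0" using p(1) by (simp add: prime_gt_0_nat)
  have coefs_mult: "coef (g * h) w \<in> A" if "\<And>w. coef g w \<in> A" "\<And>w. coef h w \<in> A" for g h :: "'n laurent_ring" and w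
    using subring_setD(6)[OF subring_coefs[OF A], of g h] that by auto
  \<comment> \<open>Modulo \<open>p\<close> the power \<open>a i ^ p\<close> is the sum of the
    \<open>p\<close>-th powers of its terms. For fixed \<open>w\<close> their contributions combine
    to the \<open>p\<close>-th power of the sum in \<open>a_kill\<close>, which is zero. Only
    \<open>w \<in> E'\<close> contribute, by the choice of \<open>p0\<close>.\<close>
  have kill: "\<Psi> (a i ^ p * g) \<in> pA"
    if i: "i \<le> ?n" and g: "Poly_Mapping.keys g \<subseteq> latt P ((e * ?n - 1) * real p + D)" "\<And>w. coef g w \<in> A" for i g
  proof -
    let ?k = "Poly_Mapping.keys (a i)"
    obtain z where z: "\<And>\<gamma>. coef z \<gamma> \<in> A"
      "a i ^ p = (\<Sum>\<gamma>\<in>?k. Poly_Mapping.single (nsc p \<gamma>) (coef (a i) \<gamma> ^ p)) + of_nat p * z"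
      using frobenius_laurent[OF A p(1), of "a i"] aA[OF i] by blast
    have h0: "coef g (\<alpha> + nsc p w) = 0" if "w \<notin> E'" for w
      using p0[of p w] p(2) g(1) that by (auto simp: in_keys_iff)
    have shift: "(\<Sum>w\<in>E. coef g (\<alpha> + nsc p (w - \<gamma>)) * l w ^ p) = (\<Sum>w\<in>E'. coef g (\<alpha> + nsc p w) * l (w + \<gamma>) ^ p)"
      if \<gamma>: "\<gamma> \<in> ?k" for \<gamma>
    proof -
      have "(\<Sum>w\<in>E. coef g (\<alpha> + nsc p (w - \<gamma>)) * l w ^ p)
          = (\<Sum>w\<in>(\<lambda>w. w + \<gamma>) ` E'. coef g (\<alpha> + nsc p (w - \<gamma>)) * l w ^ p)"
      proof (rule sum.mono_neutral_right[OF finE(1)])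
        show "(\<lambda>w. w + \<gamma>) ` E' \<subseteq> E" using EE aA[OF i] \<gamma> by blast
        show "\<forall>w\<in>E - (\<lambda>w. w + \<gamma>) ` E'. coef g (\<alpha> + nsc p (w - \<gamma>)) * l w ^ p = 0"
        proof
          fix w assume w: "w \<in> E - (\<lambda>w. w + \<gamma>) ` E'"
          have "w - \<gamma> \<notin> E'"
          proof
            assume "w - \<gamma> \<in> E'"
            then have "(w - \<gamma>) + \<gamma> \<in> (\<lambda>w. w + \<gamma>) ` E'" by blast
            then show False using w by simp
          qed
          then show "coef g (\<alpha> + nsc p (w - \<gamma>)) * l w ^ p = 0" using h0 by simp
        qed
      qed
      also have "\<dots> = (\<Sum>w\<in>E'. coef g (\<alpha> + nsc p w) * l (w + \<gamma>) ^ p)"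
        by (subst sum.reindex) (auto simp: inj_on_def)
      finally show ?thesis .
    qed
    have "a i ^ p * g = (\<Sum>\<gamma>\<in>?k. Poly_Mapping.single (nsc p \<gamma>) (coef (a i) \<gamma> ^ p) * g) + of_nat p * (z * g)"
      by (simp add: z(2) distrib_right sum_distrib_right mult.assoc)
    then have "\<Psi> (a i ^ p * g) = (\<Sum>\<gamma>\<in>?k. coef (a i) \<gamma> ^ p * (\<Sum>w\<in>E'. coef g (\<alpha> + nsc p w) * l (w + \<gamma>) ^ p))
        + of_nat p * \<Psi> (z * g)"
      by (simp add: \<Psi>_add \<Psi>_sum \<Psi>_p \<Psi>_single shift)
    also have "(\<Sum>\<gamma>\<in>?k. coef (a i) \<gamma> ^ p * (\<Sum>w\<in>E'. coef g (\<alpha> + nsc p w) * l (w + \<gamma>) ^ p))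
        = (\<Sum>w\<in>E'. (\<Sum>\<gamma>\<in>?k. (coef (a i) \<gamma> * l (w + \<gamma>)) ^ p) * coef g (\<alpha> + nsc p w))"
      by (simp add: sum_distrib_left sum_distrib_right power_mult_distrib mult_ac sum.swap[of _ E'])
    also have "\<dots> + of_nat p * \<Psi> (z * g) \<in> pA"
    proof -
      have "(\<Sum>\<gamma>\<in>?k. (coef (a i) \<gamma> * l (w + \<gamma>)) ^ p) \<in> pA" if w: "w \<in> E'" for w
      proof -
        have "\<exists>y\<in>A. (\<Sum>\<gamma>\<in>?k. coef (a i) \<gamma> * l (w + \<gamma>)) ^ p
            = (\<Sum>\<gamma>\<in>?k. (coef (a i) \<gamma> * l (w + \<gamma>)) ^ p) + of_nat p * y"
          using aA[OF i] by (intro frobenius_sum[OF A p(1)] AD(6) lA) blast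
        then obtain y where y: "y \<in> A" "(\<Sum>\<gamma>\<in>?k. coef (a i) \<gamma> * l (w + \<gamma>)) ^ p
            = (\<Sum>\<gamma>\<in>?k. (coef (a i) \<gamma> * l (w + \<gamma>)) ^ p) + of_nat p * y" by (rule bexE)
        then have "(\<Sum>\<gamma>\<in>?k. (coef (a i) \<gamma> * l (w + \<gamma>)) ^ p) = of_nat p * (- y)"
          using p0' by (simp add: a_kill[OF i w] eq_neg_iff_add_eq_0 power_0_left)
        then show ?thesis using pA_I[OF AD(4)[OF y(1)]] by simp
      qed
      then show ?thesis
        by (intro pA_add pA_sum[of E'] pA_mult pA_I \<Psi>A coefs_mult z g)
    qed
    finally show ?thesis .
  qed
  have "\<Psi> (c * \<phi> ^ (?n * p)) \<in> pA"
  proof -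
    let ?S = "S0 ((e * ?n - 1) * real p + D)"
    have "laurent.sca (ring_gen K) * ((\<Sum>i\<le>?n. gen {a i ^ p}) * ?S)
        \<le> laurent.sca A * ((\<Sum>i\<le>?n. gen {a i ^ p}) * ?S)"
      by (intro asub_mult_mono KK4 order.refl)
    also have "\<dots> = (\<Sum>i\<le>?n. gen {a i ^ p} * (laurent.sca A * ?S))"
      by (simp only: sum_distrib_left sum_distrib_right mult_ac)
    finally have "c * \<phi> ^ (?n * p) \<in> els (\<Sum>i\<le>?n. gen {a i ^ p} * (laurent.sca A * ?S))"
      using M(5)[of p] by (rule leD_els)
    then obtain y where y: "c * \<phi> ^ (?n * p) = (\<Sum>i\<le>?n. y i)"
      "\<And>i. i \<in> {..?n} \<Longrightarrow> y i \<in> els (gen {a i ^ p} * (laurent.sca A * ?S))"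
      by (rule els_sumE[OF finite_atMost]) blast
    have "\<Psi> (y i) \<in> pA" if i: "i \<in> {..?n}" for i
    proof -
      obtain g where "y i = a i ^ p * g" "g \<in> els (laurent.sca A * ?S)"
        using y(2)[OF i] by (rule els_gen_singleton_times)
      then show ?thesis using kill[of i g] i by (simp add: S0_def mem_sca_mon[OF A])
    qed
    then show ?thesis unfolding y(1) \<Psi>_sum by (rule pA_sum)
  qed
  \<comment> \<open>Modulo \<open>p\<close> the value is \<open>ca\<close> times the
    \<open>p\<close>-th power of \<open>L (\<phi> ^ n) = 1\<close>.\<close>
  moreover have "ca - \<Psi> (c * \<phi> ^ (?n * p)) \<in> pA"
  proof -
    let ?g = "\<phi> ^ ?n" and ?k = "Poly_Mapping.keys (\<phi> ^ ?n)"
    obtain z where z: "\<And>\<gamma>. coef z \<gamma> \<in> A"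
      "?g ^ p = (\<Sum>\<gamma>\<in>?k. Poly_Mapping.single (nsc p \<gamma>) (coef ?g \<gamma> ^ p)) + of_nat p * z"
      using frobenius_laurent[OF A p(1), of ?g] \<phi>A by blast
    have one: "(\<Sum>w\<in>E. coef c (\<alpha> + nsc p (w - \<gamma>)) * l w ^ p) = ca * l \<gamma> ^ p" if \<gamma>: "\<gamma> \<in> ?k" for \<gamma>
    proof -
      have "(\<Sum>w\<in>E. coef c (\<alpha> + nsc p (w - \<gamma>)) * l w ^ p) = (\<Sum>w\<in>E. if w = \<gamma> then ca * l \<gamma> ^ p else 0)"
      proof (rule sum.cong[OF refl])
        fix w
        have n0: "nsc p (0 :: int ^ 'n) = 0" by (simp add: nsc_def vec_eq_iff)
        have "coef c (\<alpha> + nsc p (w - \<gamma>)) = 0" if "w \<noteq> \<gamma>"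
          using sparse[of "w - \<gamma>"] that by (auto simp: in_keys_iff)
        then show "coef c (\<alpha> + nsc p (w - \<gamma>)) * l w ^ p = (if w = \<gamma> then ca * l \<gamma> ^ p else 0)"
          using n0 by (simp add: ca_def)
      qed
      then show ?thesis using finE(1) \<phi>E \<gamma> by (auto simp: subset_iff)
    qed
    have "c * \<phi> ^ (?n * p) = (\<Sum>\<gamma>\<in>?k. Poly_Mapping.single (nsc p \<gamma>) (coef ?g \<gamma> ^ p) * c) + of_nat p * (z * c)"
    proof -
      have "c * \<phi> ^ (?n * p) = ?g ^ p * c" unfolding power_mult by (rule mult.commute)
      then show ?thesis unfolding z(2) by (simp only: distrib_right sum_distrib_right mult.assoc)
    qed
    then have "\<Psi> (c * \<phi> ^ (?n * p)) = (\<Sum>\<gamma>\<in>?k. coef ?g \<gamma> ^ p * (ca * l \<gamma> ^ p)) + of_nat p * \<Psi> (z * c)"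
      by (simp add: \<Psi>_add \<Psi>_sum \<Psi>_p \<Psi>_single one)
    also have "(\<Sum>\<gamma>\<in>?k. coef ?g \<gamma> ^ p * (ca * l \<gamma> ^ p)) = ca * (\<Sum>\<gamma>\<in>?k. (coef ?g \<gamma> * l \<gamma>) ^ p)"
      by (simp add: sum_distrib_left power_mult_distrib mult_ac)
    finally have eq: "\<Psi> (c * \<phi> ^ (?n * p)) = ca * (\<Sum>\<gamma>\<in>?k. (coef ?g \<gamma> * l \<gamma>) ^ p) + of_nat p * \<Psi> (z * c)" .
    obtain y where y: "y \<in> A" "(\<Sum>\<gamma>\<in>?k. coef ?g \<gamma> * l \<gamma>) ^ p = (\<Sum>\<gamma>\<in>?k. (coef ?g \<gamma> * l \<gamma>) ^ p) + of_nat p * y"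
      using frobenius_sum[OF A p(1), of ?k "\<lambda>\<gamma>. coef ?g \<gamma> * l \<gamma>"] \<phi>A lA AD(6) by blast
    then have S: "(\<Sum>\<gamma>\<in>?k. (coef ?g \<gamma> * l \<gamma>) ^ p) = 1 - of_nat p * y" by (simp add: \<phi>L eq_diff_eq)
    have "ca - \<Psi> (c * \<phi> ^ (?n * p)) = of_nat p * (ca * y - \<Psi> (z * c))"
      unfolding eq S by (simp add: algebra_simps)
    also have "\<dots> \<in> pA"
      unfolding ca_def by (intro pA_I AD(3) AD(6) cA y \<Psi>A coefs_mult z)
    finally show ?thesis .
  qed
  ultimately have "\<Psi> (c * \<phi> ^ (?n * p)) + (ca - \<Psi> (c * \<phi> ^ (?n * p))) \<in> pA" by (rule pA_add)
  then have "ca * (1 / ca) \<in> pA" by (intro pA_mult) (auto intro: K4A simp: K4_def)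
  then have "1 \<in> pA" using ca0 by simp
  then show False using inv by (auto simp: pA_def)
qed

end

section \<open>From polynomials to Laurent polynomials and back\<close>

definition nat_exp :: "nat ^ 'n \<Rightarrow> int ^ 'n::finite"
  where "nat_exp a = (\<chi> j. int (a $ j))"

definition nonneg_exps :: "(int ^ 'n::finite) set"
  where "nonneg_exps = {a. \<forall>j. 0 \<le> a $ j}"

lemma nat_exp_eq_iff: "nat_exp a = nat_exp b \<longleftrightarrow> a = b"
  by (simp add: nat_exp_def vec_eq_iff)

lemma nat_exp_add: "nat_exp (a + b) = nat_exp a + nat_exp b"
  by (simp add: nat_exp_def vec_eq_iff)

lemma nat_exp_0 [simp]: "nat_exp 0 = 0"
  by (simp add: nat_exp_def vec_eq_iff)

lemma nonneg_exps_eq: "nonneg_exps = range nat_exp"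
proof
  show "nonneg_exps \<subseteq> range nat_exp"
  proof
    fix a :: "int ^ 'n" assume "a \<in> nonneg_exps"
    then have "a = nat_exp (\<chi> j. nat (a $ j))" by (simp add: nonneg_exps_def nat_exp_def vec_eq_iff)
    then show "a \<in> range nat_exp" by (rule range_eqI)
  qed
qed (auto simp: nonneg_exps_def nat_exp_def)

lemma to_laurent_alt:
  assumes "finite K" "Poly_Mapping.keys F \<subseteq> K"
  shows "to_laurent F = (\<Sum>a\<in>K. Poly_Mapping.single (nat_exp a) (coef F a))"
  unfolding to_laurent_def nat_exp_def[symmetric] using assms
  by (intro sum.mono_neutral_left) (auto simp: in_keys_iff)

lemma coef_to_laurent: "coef (to_laurent F) (nat_exp b) = coef F b"
proof -
  have "coef (to_laurent F) (nat_exp b) = (\<Sum>a\<in>insert b (Poly_Mapping.keys F). if a = b then coef F b else 0)"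
    by (subst to_laurent_alt[of "insert b (Poly_Mapping.keys F)"])
      (auto simp: lookup_sum lookup_single when_def nat_exp_eq_iff intro!: sum.cong)
  then show ?thesis by simp
qed

lemma coef_to_laurent_outside: "w \<notin> nonneg_exps \<Longrightarrow> coef (to_laurent F) w = 0"
  unfolding to_laurent_def nat_exp_def[symmetric] nonneg_exps_eq
  by (auto simp: lookup_sum lookup_single when_def intro!: sum.neutral)

lemma to_laurent_eqI:
  assumes "Poly_Mapping.keys g \<subseteq> nonneg_exps" "\<And>b. coef g (nat_exp b) = coef F b"
  shows "to_laurent F = g"
proof (rule poly_mapping_eqI)
  fix w
  show "coef (to_laurent F) w = coef g w"
  proof (cases "w \<in> nonneg_exps")
    case True
    then obtain b where "w = nat_exp b" by (auto simp: nonneg_exps_eq)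
    then show ?thesis using assms(2) by (simp add: coef_to_laurent)
  next
    case False
    then have "w \<notin> Poly_Mapping.keys g" using assms(1) by blast
    then show ?thesis using False by (simp add: coef_to_laurent_outside in_keys_iff)
  qed
qed

lemma keys_to_laurent: "Poly_Mapping.keys (to_laurent F) = nat_exp ` Poly_Mapping.keys F"
proof (intro equalityI subsetI)
  fix w assume w: "w \<in> Poly_Mapping.keys (to_laurent F)"
  then have "w \<in> nonneg_exps" using coef_to_laurent_outside[of w F] by (auto simp: in_keys_iff)
  then obtain b where "w = nat_exp b" by (auto simp: nonneg_exps_eq)
  then show "w \<in> nat_exp ` Poly_Mapping.keys F" using w by (auto simp: in_keys_iff coef_to_laurent)
qed (auto simp: in_keys_iff coef_to_laurent)

lemma to_laurent_inj: "to_laurent F = to_laurent G \<Longrightarrow> F = G"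
  by (rule poly_mapping_eqI) (metis coef_to_laurent)

lemma to_laurent_add: "to_laurent (F + G) = to_laurent F + to_laurent G"
  by (rule to_laurent_eqI)
    (use keys_add[of "to_laurent F" "to_laurent G"] in \<open>auto simp: keys_to_laurent nonneg_exps_eq lookup_add coef_to_laurent\<close>)

lemma to_laurent_0 [simp]: "to_laurent 0 = 0"
  by (simp add: to_laurent_def)

lemma to_laurent_sum: "to_laurent (\<Sum>i\<in>I. F i) = (\<Sum>i\<in>I. to_laurent (F i))"
  by (induction I rule: infinite_finite_induct) (simp_all add: to_laurent_add)

lemma to_laurent_single: "to_laurent (Poly_Mapping.single a c) = Poly_Mapping.single (nat_exp a) c"
  by (simp add: to_laurent_def nat_exp_def)

lemma to_laurent_1 [simp]: "to_laurent 1 = 1"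
  by (simp add: single_one[symmetric] to_laurent_single del: single_one)

lemma to_laurent_mult: "to_laurent (F * G) = to_laurent F * to_laurent G"
proof -
  let ?F = "\<Sum>a\<in>Poly_Mapping.keys F. Poly_Mapping.single a (coef F a)"
  let ?G = "\<Sum>b\<in>Poly_Mapping.keys G. Poly_Mapping.single b (coef G b)"
  have "F = ?F" "G = ?G" by (rule poly_mapping_sum_single; simp)+
  then have "to_laurent (F * G) = to_laurent (?F * ?G)" by (rule arg_cong2)
  also have "\<dots> = (\<Sum>a\<in>Poly_Mapping.keys F. \<Sum>b\<in>Poly_Mapping.keys G.
      Poly_Mapping.single (nat_exp (a + b)) (coef F a * coef G b))"
    by (simp add: sum_product mult_single to_laurent_sum to_laurent_single)
  also have "\<dots> = to_laurent F * to_laurent G"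
    by (simp add: to_laurent_alt[OF finite_keys order.refl] sum_product mult_single nat_exp_add)
  finally show ?thesis .
qed

lemma to_laurent_power: "to_laurent (F ^ k) = to_laurent F ^ k"
  by (induction k) (simp_all add: to_laurent_mult)

lemma int_vec_nat_exp: "int_vec (nat_exp a) = nat_vec a"
  by (simp add: int_vec_def nat_exp_def nat_vec_def vec_eq_iff)

lemma laurent_supp_to_laurent: "laurent_supp (to_laurent F) = supp F"
  by (auto simp: laurent_supp_def supp_def keys_to_laurent image_image int_vec_nat_exp)

lemma from_laurent:
  assumes "Poly_Mapping.keys g \<subseteq> nonneg_exps"
  obtains G where "to_laurent G = g"
proof -
  define G where "G = (\<Sum>w\<in>Poly_Mapping.keys g. Poly_Mapping.single (\<chi> j. nat (w $ j)) (coef g w))"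
  have "nat_exp (\<chi> j. nat (w $ j)) = w" if "w \<in> Poly_Mapping.keys g" for w
    using assms that by (auto simp: nonneg_exps_def nat_exp_def vec_eq_iff subset_iff)
  then have "to_laurent G = (\<Sum>w\<in>Poly_Mapping.keys g. Poly_Mapping.single w (coef g w))"
    by (simp add: G_def to_laurent_sum to_laurent_single)
  also have "\<dots> = g" by (rule poly_mapping_sum_single[symmetric]) auto
  finally show ?thesis by (rule that)
qed

lemma laurent_supp_subset_iff: "laurent_supp f \<subseteq> (*\<^sub>R) d ` P \<longleftrightarrow> Poly_Mapping.keys f \<subseteq> latt P d"
  by (auto simp: laurent_supp_def latt_def)

section \<open>Powers of the ideal\<close>

text \<open>Polynomial coefficients are collected in the factor \<open>N\<close>, which absorbs its
  own square. So each product of ideals adds one factor \<open>V\<close>, and the induction follows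
  the recursive definition of ideal powers.\<close>

lemma ideal_power_to_laurent:
  fixes F :: "nat \<Rightarrow> 'n::finite poly_ring" and J :: "nat set"
  defines "R \<equiv> ring_on (UNIV :: 'n poly_ring set)"
  defines "N \<equiv> laurent.sca UNIV * mon nonneg_exps :: 'n laurent_ring asub"
  defines "V \<equiv> gen ((\<lambda>j. to_laurent (F j)) ` J)"
  assumes "x \<in> genideal R (F ` J) [^]\<^bsub>ideals_set R\<^esub> (k::nat)"
  shows "to_laurent x \<in> els (N * V ^ k)"
proof -
  have polyN: "to_laurent G \<in> els N" for G
    by (auto simp: N_def mem_sca_UNIV_mon keys_to_laurent nonneg_exps_eq)
  have NN: "N * N \<le> N"
  proof -
    have "mon nonneg_exps * mon nonneg_exps \<le> mon (nonneg_exps :: (int ^ 'n) set)"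
      unfolding mon_times by (rule mon_mono) (auto simp: nonneg_exps_def)
    then have "(laurent.sca UNIV * laurent.sca UNIV) * (mon nonneg_exps * mon nonneg_exps) \<le> N"
      unfolding N_def laurent.sca_mult[OF subring_UNIV] by (intro asub_mult_mono order.refl)
    then show ?thesis by (simp add: N_def mult_ac)
  qed
  let ?I = "{G. to_laurent G \<in> els (N * V)}"
  have Nmult: "to_laurent (a * y) \<in> els (N * X)" if "to_laurent y \<in> els (N * X)" for a y X
  proof -
    have "to_laurent a * to_laurent y \<in> els (N * (N * X))" by (intro mult_els polyN that)
    also have "N * (N * X) = (N * N) * X" by (simp only: mult.assoc)
    finally show ?thesis
      using leD_els[OF asub_mult_mono[OF NN order.refl]] by (simp add: to_laurent_mult)
  qed
  have "ideal ?I R"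
    unfolding R_def ideal_ring_on_iff[OF subring_UNIV]
    by (auto simp: to_laurent_add intro: add_els Nmult)
  moreover have "F ` J \<subseteq> ?I"
  proof
    fix G assume "G \<in> F ` J"
    then obtain j where "j \<in> J" "G = F j" by blast
    then have "1 * to_laurent G \<in> els (N * V)"
      using polyN[of 1] by (intro mult_els) (auto simp: V_def intro: gen_base)
    then show "G \<in> ?I" by simp
  qed
  moreover have "ring R"
    unfolding R_def by (rule cring.axioms(1)) (rule cring_ring_on; simp)
  ultimately have I: "genideal R (F ` J) \<subseteq> ?I" by (simp add: ring.genideal_minimal)
  show ?thesis
    using assms(4)
  proof (induction k arbitrary: x)
    case 0
    then show ?case using polyN by simp
  next
    case (Suc k)
    have "x \<in> ideal_prod R (genideal R (F ` J) [^]\<^bsub>ideals_set R\<^esub> k) (genideal R (F ` J))"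
      using Suc.prems by (simp add: nat_pow_def ideals_set_def)
    then show ?case
    proof induction
      case (prod i j)
      have "to_laurent i * to_laurent j \<in> els ((N * V ^ k) * (N * V))"
        using Suc.IH[OF prod(1)] I prod(2) by (intro mult_els) auto
      also have "(N * V ^ k) * (N * V) = (N * N) * V ^ Suc k" by (simp add: mult_ac)
      finally show ?case
        using leD_els[OF asub_mult_mono[OF NN order.refl]] by (simp add: R_def to_laurent_mult)
    next
      case (sum s t)
      then show ?case by (simp add: R_def to_laurent_add add_els)
    qed
  qed
qed

section \<open>Rationality of the dilation factor\<close>

text \<open>\<open>P\<close> has a nonzero vertex, which is a lattice point, and scaling by
  \<open>e > 0\<close> carries it to a vertex of the dilated polytope, again a lattice point.
  Comparing a nonzero coordinate exhibits \<open>e\<close> as a quotient of integers.\<close>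

lemma dilation_rational:
  fixes P :: "(real ^ 'n::finite) set"
  assumes P: "lattice_polytope P" "P \<noteq> {0}" "0 \<in> P" and e: "e \<ge> 0" "lattice_polytope ((*\<^sub>R) e ` P)"
  shows "e \<in> \<rat>"
proof (cases "e = 0")
  case False
  then have e0: "e > 0" using e by simp
  obtain S T where S: "finite S" "P = convex hull (int_vec ` S)"
    and T: "finite T" "(*\<^sub>R) e ` P = convex hull (int_vec ` T)"
    using P(1) e(2) by (auto simp: lattice_polytope_def)
  have "P = convex hull {x. x extreme_point_of P}"
    using Krein_Milman_Minkowski[OF lattice_polytope_props(2,1)[OF P(1)]] .
  moreover have "convex hull {x. x extreme_point_of P} \<subseteq> {0}" if "\<And>x. x extreme_point_of P \<Longrightarrow> x = 0"
    by (rule hull_minimal) (use that in auto)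
  ultimately obtain v where v: "v extreme_point_of P" "v \<noteq> 0" using P(2,3) by blast
  have "(e *\<^sub>R v) extreme_point_of ((*\<^sub>R) e ` P)"
    unfolding extreme_point_of_def
  proof (intro conjI ballI notI)
    show "e *\<^sub>R v \<in> (*\<^sub>R) e ` P" using v by (intro imageI) (simp add: extreme_point_of_def)
    fix a b assume ab: "a \<in> (*\<^sub>R) e ` P" "b \<in> (*\<^sub>R) e ` P" "e *\<^sub>R v \<in> open_segment a b"
    then obtain x y where xy: "x \<in> P" "y \<in> P" "a = e *\<^sub>R x" "b = e *\<^sub>R y" by blast
    obtain t where t: "a \<noteq> b" "0 < t" "t < 1" "e *\<^sub>R v = (1 - t) *\<^sub>R a + t *\<^sub>R b"
      using ab(3) by (auto simp: in_segment)
    have "e *\<^sub>R v = e *\<^sub>R ((1 - t) *\<^sub>R x + t *\<^sub>R y)"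
      using t(4) xy by (simp add: scaleR_add_right mult.commute)
    then have "v = (1 - t) *\<^sub>R x + t *\<^sub>R y" using e0 by (simp only: scaleR_cancel_left) simp
    then have "v \<in> open_segment x y" using t xy by (auto simp: in_segment)
    then show False using v xy by (auto simp: extreme_point_of_def)
  qed
  then have "e *\<^sub>R v \<in> int_vec ` T" unfolding T(2) by (rule extreme_point_of_convex_hull)
  moreover have "v \<in> int_vec ` S" using v(1) unfolding S(2) by (rule extreme_point_of_convex_hull)
  ultimately obtain s t where st: "v = int_vec s" "e *\<^sub>R v = int_vec t" by blast
  obtain j where j: "v $ j \<noteq> 0" using v(2) by (auto simp: vec_eq_iff)
  have "e * of_int (s $ j) = of_int (t $ j)"
    using arg_cong[OF st(2), of "\<lambda>x. x $ j"] st(1) by (simp add: int_vec_def)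
  moreover have "of_int (s $ j) \<noteq> (0 :: real)" using j st(1) by (simp add: int_vec_def)
  ultimately have "e = of_int (t $ j) / of_int (s $ j)" by (simp add: field_simps)
  then show ?thesis by simp
qed simp

lemma V0_membership:
  fixes F :: "nat \<Rightarrow> 'n::finite laurent_ring"
  assumes "finite J" "x \<in> els (laurent.sca UNIV * (gen (F ` J) * mon X))"
  obtains g where "x = (\<Sum>j\<in>J. F j * g j)" "\<And>j. j \<in> J \<Longrightarrow> Poly_Mapping.keys (g j) \<subseteq> X"
proof -
  have "gen (F ` J) = (\<Sum>j\<in>J. gen {F j})"
    using gen_UN[OF assms(1), of "\<lambda>j. {F j}"] by (simp add: UNION_singleton_eq_range)
  then have "laurent.sca UNIV * (gen (F ` J) * mon X) = (\<Sum>j\<in>J. gen {F j} * (laurent.sca UNIV * mon X))"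
    by (simp only: mult.left_commute[of "laurent.sca UNIV"]) (rule sum_distrib_right)
  then have "x \<in> els (\<Sum>j\<in>J. gen {F j} * (laurent.sca UNIV * mon X))" using assms(2) by simp
  then obtain y where y: "x = (\<Sum>j\<in>J. y j)" "\<And>j. j \<in> J \<Longrightarrow> y j \<in> els (gen {F j} * (laurent.sca UNIV * mon X))"
    by (rule els_sumE[OF assms(1)]) (rule that)
  have "\<exists>g. y j = F j * g \<and> Poly_Mapping.keys g \<subseteq> X" if j: "j \<in> J" for j
    using y(2)[OF j] by (rule els_gen_singleton_times) (auto simp: mem_sca_UNIV_mon)
  then have "\<forall>j\<in>J. \<exists>g. y j = F j * g \<and> Poly_Mapping.keys g \<subseteq> X" by blast
  then obtain g where g: "\<forall>j\<in>J. y j = F j * g j \<and> Poly_Mapping.keys (g j) \<subseteq> X" by (rule bchoice[THEN exE])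
  show ?thesis
  proof (rule that)
    show "x = (\<Sum>j\<in>J. F j * g j)" unfolding y(1) by (intro sum.cong refl) (use g in blast)
    show "Poly_Mapping.keys (g j) \<subseteq> X" if "j \<in> J" for j using g that by blast
  qed
qed

theorem theorem1p3:
  fixes F :: "nat \<Rightarrow> 'n::finite poly_ring"
    and \<Phi> :: "'n poly_ring"
    and m :: nat
    and P :: "(real ^ 'n) set"
    and e :: real
  assumes "lattice_polytope P"
    and "P \<subseteq> orthant"
    and "0 \<in> P"
    and "\<And>j. j \<in> {1..m} \<Longrightarrow> supp (F j) \<subseteq> P"
    and "no_common_zeros_at_infinity P (F ` {1..m})"
    and "in_integral_closure (genideal (ring_on UNIV) (F ` {1..m})) \<Phi>"
    and "e \<ge> 0"
    and "lattice_polytope ((*\<^sub>R) e ` P)"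
    and "supp \<Phi> \<subseteq> (*\<^sub>R) e ` P"
  shows "\<exists>G :: nat \<Rightarrow> 'n poly_ring.
    (\<Sum>j=1..m. F j * G j) = \<Phi> ^ CARD('n) \<and>
    (\<forall>j\<in>{1..m}. supp (F j * G j) \<subseteq>
      (*\<^sub>R) (max (real CARD('n) + 1) (real CARD('n) * e)) ` P)"
proof -
  let ?n = "CARD('n)" and ?J = "{1..m}"
  define f where "f j = to_laurent (F j)" for j
  define \<phi> where "\<phi> = to_laurent \<Phi>"
  \<comment> \<open>For \<open>P = {0}\<close> the assumptions do not make \<open>e\<close> rational.\<close>
  define e1 where "e1 = (if P = {0} then 0 else e)"
  \<comment> \<open>The bound \<open>1 + 1 / n\<close> is the least value with
    \<open>(e2 - 1) n \<ge> 1\<close>, and \<open>e2 * n\<close> is the factor of the theorem with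
    \<open>e1\<close> in place of \<open>e\<close>.\<close>
  define e2 where "e2 = max (1 + 1 / real ?n) e1"
  have convexP: "convex P" by (rule lattice_polytope_props(1)[OF assms(1)])
  have n1: "real ?n \<ge> 1" by simp
  have e1: "e1 \<ge> 0" "e1 \<in> \<rat>"
    using dilation_rational[OF assms(1) _ assms(3,7,8)] assms(7) by (auto simp: e1_def)
  have e2: "e2 > 1" using n1 by (simp add: e2_def less_max_iff_disj)
  have en: "(e2 - 1) * ?n \<ge> 1"
  proof -
    have "1 / real ?n * real ?n \<le> (e2 - 1) * ?n" by (intro mult_right_mono) (auto simp: e2_def)
    then show ?thesis by simp
  qed
  have e2n: "e2 * ?n = max (real ?n + 1) (real ?n * e1)"
  proof -
    have "e2 * ?n = max ((1 + 1 / real ?n) * ?n) (e1 * ?n)"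
      unfolding e2_def by (subst max_mult_distrib_right) simp
    moreover have "(1 + 1 / real ?n) * ?n = real ?n + 1" by (simp add: distrib_right)
    ultimately show ?thesis by (simp only: mult.commute[of e1])
  qed
  have "e2 - 1 \<in> \<rat>" using e1 by (auto simp: e2_def max_def)
  then obtain a b :: nat where ab: "b \<noteq> 0" "\<bar>e2 - 1\<bar> = real a / real b" by (rule Rats_abs_nat_div_natE)
  have e_rat: "\<exists>R K :: nat. R \<ge> 1 \<and> real K = real R * (e2 - 1)"
    using ab e2 by (intro exI[of _ b] exI[of _ a]) (auto simp: field_simps)
  have P1: "(*\<^sub>R) 1 ` P = P" by simp
  have keysf: "Poly_Mapping.keys (f j) \<subseteq> latt P 1" if "j \<in> ?J" for j
    using assms(4)[OF that] laurent_supp_subset_iff[of "f j" 1 P]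
    unfolding P1 by (simp add: f_def laurent_supp_to_laurent)
  have eP: "(*\<^sub>R) e ` P = (*\<^sub>R) e1 ` P" by (auto simp: e1_def)
  have "Poly_Mapping.keys \<phi> \<subseteq> latt P e1"
    using assms(9) unfolding eP laurent_supp_subset_iff[symmetric] by (simp add: \<phi>_def laurent_supp_to_laurent)
  then have keys\<phi>: "Poly_Mapping.keys \<phi> \<subseteq> latt P e2"
    using latt_mono[OF convexP assms(3) e1(1), of e2] by (auto simp: e2_def)
  interpret toric_data P ?J f \<phi> e2
    by unfold_locales (use assms e2 e_rat keysf keys\<phi> in auto)
  obtain \<Delta> where \<Delta>: "complete_fan \<Delta>" "compatible \<Delta> P" "orthant \<in> \<Delta>"
    and inf: "\<not> (\<exists>x\<in>variety_at_infinity \<Delta>. \<forall>G\<in>F ` ?J. section_vanishes_at P (to_laurent G) x)"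
    using assms(5) unfolding no_common_zeros_at_infinity_def by blast
  have at_infinity: "\<exists>v g h. cone_vertex P \<sigma> v \<and>
      1 = (\<Sum>j\<in>?J. laurent_monom (- v) * f j * g j) + h \<and>
      (\<forall>j\<in>?J. laurent_supp (g j) \<subseteq> dual_cone \<sigma>) \<and> laurent_supp h \<subseteq> dual_cone \<sigma> \<and>
      (\<forall>a\<in>Poly_Mapping.keys h. \<exists>x\<in>\<sigma>. x \<bullet> int_vec a > 0)"
    if \<sigma>: "\<sigma> \<in> \<Delta>" "\<not> \<sigma> \<subseteq> orthant" for \<sigma>
  proof -
    obtain g h where gh: "1 = (\<Sum>j\<in>?J. local_section P (to_laurent (F j)) \<sigma> * g j) + h"
      "\<And>j. j \<in> ?J \<Longrightarrow> laurent_supp (g j) \<subseteq> dual_cone \<sigma>" "laurent_supp h \<subseteq> dual_cone \<sigma>"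
      "\<And>a. a \<in> Poly_Mapping.keys h \<Longrightarrow> \<exists>u\<in>\<sigma>. u \<bullet> int_vec a > 0"
    proof (rule unit_ideal_at_infinity[OF \<Delta> inf finite_atLeastAtMost _ \<sigma>])
      show "laurent_supp (to_laurent (F j)) \<subseteq> P" if "j \<in> ?J" for j
        using assms(4)[OF that] by (simp add: laurent_supp_to_laurent)
    qed (rule that)
    show ?thesis
      using cone_vertex_some[OF \<Delta>(2) \<sigma>(1)] gh unfolding local_section_def f_def[symmetric]
      by (intro exI[of _ "SOME v. cone_vertex P \<sigma> v"] exI[of _ g] exI[of _ h] conjI ballI) assumption+
  qed
  \<comment> \<open>If all \<open>f j\<close> vanished, then \<open>h = 1\<close> for a cone
    containing the vector \<open>- 1\<close>, but the only exponent \<open>0\<close> of this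
    \<open>h\<close> is not positive anywhere on the cone.\<close>
  obtain j0 where j0: "j0 \<in> ?J" "f j0 \<noteq> 0"
  proof (rule ccontr)
    assume "\<not> thesis"
    then have f0: "f j = 0" if "j \<in> ?J" for j using that \<open>\<And>j0. j0 \<in> ?J \<Longrightarrow> f j0 \<noteq> 0 \<Longrightarrow> thesis\<close> by blast
    have "(- 1 :: real ^ 'n) \<in> \<Union>\<Delta>" using \<Delta>(1) by (simp add: complete_fan_def)
    then obtain \<sigma> where \<sigma>: "\<sigma> \<in> \<Delta>" "(- 1 :: real ^ 'n) \<in> \<sigma>" by blast
    moreover have "(- 1 :: real ^ 'n) \<notin> orthant" by (simp add: orthant_def)
    ultimately have "\<not> \<sigma> \<subseteq> orthant" by blast
    from at_infinity[OF \<sigma>(1) this] obtain v g h where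
      "1 = (\<Sum>j\<in>?J. laurent_monom (- v) * f j * g j) + h"
      "\<forall>a\<in>Poly_Mapping.keys h. \<exists>x\<in>\<sigma>. x \<bullet> int_vec a > 0" by blast
    moreover from this have "h = 1" using f0 by simp
    ultimately show False by auto
  qed
  obtain r H where r: "1 \<le> r" "\<And>k. k \<in> {1..r} \<Longrightarrow> H k \<in> genideal (ring_on UNIV) (F ` ?J) [^]\<^bsub>ideals_set (ring_on UNIV)\<^esub> (k::nat)"
    "\<Phi> ^ r + (\<Sum>k=1..r. H k * \<Phi> ^ (r - k)) = 0"
    using assms(6) unfolding in_integral_closure_def by blast
  have "integ u A0"
  proof (rule integ_u[OF \<Delta>(1) at_infinity r(1)])
    show "\<phi> ^ r + (\<Sum>k=1..r. to_laurent (H k) * \<phi> ^ (r - k)) = 0"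
      using arg_cong[OF r(3), of to_laurent]
      by (simp add: to_laurent_add to_laurent_sum to_laurent_mult to_laurent_power \<phi>_def)
    show "to_laurent (H k) \<in> els (C0 * V0 ^ k * mon {\<alpha>. \<forall>j. 0 \<le> \<alpha> $ j})" if "k \<in> {1..r}" for k
      using ideal_power_to_laurent[OF r(2)[OF that]]
      unfolding V0_def by (simp add: f_def[abs_def] nonneg_exps_def mult_ac)
  qed
  from power_membership[OF this j0 en]
  have "\<phi> ^ ?n \<in> els (laurent.sca UNIV * (gen (f ` ?J) * mon (latt P (e2 * ?n - 1))))"
    unfolding V0_def S0_def .
  then obtain g where g: "\<phi> ^ ?n = (\<Sum>j\<in>?J. f j * g j)"
    "\<And>j. j \<in> ?J \<Longrightarrow> Poly_Mapping.keys (g j) \<subseteq> latt P (e2 * ?n - 1)"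
    by (rule V0_membership[OF finite_atLeastAtMost]) (rule that)
  have d0: "e2 * ?n - 1 \<ge> 0" using en n1 by (simp add: algebra_simps)
  obtain M :: nat where M: "\<And>d b j. d \<ge> 0 \<Longrightarrow> b \<in> latt P d \<Longrightarrow> 0 \<le> b $ j \<and> real_of_int (b $ j) \<le> d * M"
    using latt_in_box[OF compact_P assms(2)] by blast
  \<comment> \<open>The cofactors inherit nonnegative exponents from \<open>P\<close>, so they come
    from polynomials.\<close>
  have "latt P (e2 * ?n - 1) \<subseteq> nonneg_exps" using M[OF d0] by (auto simp: nonneg_exps_def)
  then have "\<exists>G. to_laurent G = g j" if "j \<in> ?J" for j
    using from_laurent[of "g j"] g(2)[OF that] by blast
  then obtain G where G: "\<And>j. j \<in> ?J \<Longrightarrow> to_laurent (G j) = g j" by metis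
  have "to_laurent (\<Sum>j\<in>?J. F j * G j) = (\<Sum>j\<in>?J. f j * g j)"
    unfolding to_laurent_sum to_laurent_mult f_def using G by (intro sum.cong refl) simp
  also have "\<dots> = to_laurent (\<Phi> ^ ?n)" unfolding g(1)[symmetric] \<phi>_def by (rule to_laurent_power[symmetric])
  finally have "(\<Sum>j\<in>?J. F j * G j) = \<Phi> ^ ?n" by (rule to_laurent_inj)
  moreover have "supp (F j * G j) \<subseteq> (*\<^sub>R) (max (real ?n + 1) (real ?n * e)) ` P" if j: "j \<in> ?J" for j
  proof -
    have "Poly_Mapping.keys (f j * g j) \<subseteq> latt P (e2 * ?n)"
    proof
      fix w assume "w \<in> Poly_Mapping.keys (f j * g j)"
      then obtain x y where xy: "w = x + y" "x \<in> latt P 1" "y \<in> latt P (e2 * ?n - 1)"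
        using keys_mult[of "f j" "g j"] keysf[OF j] g(2)[OF j] by blast
      have "x + y \<in> latt P (1 + (e2 * ?n - 1))" by (rule latt_add[OF convexP _ d0 xy(2,3)]) simp
      then show "w \<in> latt P (e2 * ?n)" using xy(1) by simp
    qed
    then have "supp (F j * G j) \<subseteq> (*\<^sub>R) (e2 * ?n) ` P"
      unfolding laurent_supp_subset_iff[symmetric] laurent_supp_to_laurent[symmetric]
      by (simp add: to_laurent_mult f_def G[OF j])
    \<comment> \<open>For \<open>P = {0}\<close> all multiples of \<open>P\<close> coincide, so
      replacing \<open>e\<close> by \<open>0\<close> has not changed the bound.\<close>
    also have "\<dots> = (*\<^sub>R) (max (real ?n + 1) (real ?n * e)) ` P"
      unfolding e2n by (auto simp: e1_def)
    finally show ?thesis .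
  qed
  ultimately show ?thesis by blast
qed

end
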